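(* Let $n\ge1$ and let $v_{T',T}$ ($T,T'$ standard tableaux with $n$ boxes of the same shape) be the left weight basis of $\mathbb{C}[S_n]$, where $T'$ is the restriction tableau and $T$ is the induction tableau for the left action. Then: (1) For each standard tableau $T$ with $n$ boxes, the weight space $V_{T,\bullet}=\bigoplus_{T'}\langle v_{T,T'}\rangle$ is equal to the subspace of $\mathbb{C}[S_n]$ obtained by following the induction path specified by $T$ for the right action of $S_n$. (2) The weight basis for the left action of $S_n$ is also a weight basis for the right action, with the induction and restriction tableaux reversed: for all $T,T'$ of the same shape, $v_{T',T}$ is, up to a nonzero scalar, the right weight vector with right induction tableau $T'$ and right restriction tableau $T$.
   Context: Permutations compose as functions; $S_k\subseteq S_n$ is the subgroup fixing $k+1,\ldots,n$. $X_k=(1\ k)+\cdots+(k-1\ k)\in\mathbb{C}[S_n]$, $X_1=0$. The content of a box of a Young diagram (rows counted from the top) is (column index) $-$ (row index). A standard tableau of shape $\lambda\vdash n$ is a filling of the boxes of $\lambda$ by $1,\ldots,n$, each used once, increasing along rows and down columns. $b(T,i)$ is the box of $T$ containing $i$, $T^{(i)}$ the subtableau formed by $1,\ldots,i$. For a partition $\lambda$ of $k$, $V_\lambda$ denotes the irreducible complex $S_k$-module (Young's seminormal form) having a basis $\{v_T\}$ indexed by standard tableaux $T$ of shape $\lambda$ with $X_i\cdot v_T=\mathrm{cont}(b(T,i))\,v_T$ for all $i$; these are all the irreducible $S_k$-modules. A right $S_k$-module has type $\lambda$ if it becomes isomorphic to $V_\lambda$ when regarded as a left module via $\sigma\cdot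 v=v\sigma^{-1}$. Left construction. Given a standard tableau $T$ with $n$ boxes, let $V_{T^{(1)}}=\mathbb{C}[S_1]$ and, for $2\le k\le n$, let $V_{T^{(k)}}\subseteq\mathbb{C}[S_k]$ be the unique irreducible left $S_k$-submodule of $\mathrm{Ind}_{S_{k-1}}^{S_k}V_{T^{(k-1)}}=\mathbb{C}[S_k]\cdot V_{T^{(k-1)}}$ isomorphic to $V_{\mathrm{shape}(T^{(k)})}$ (this induced module is multiplicity-free). Put $V_T=V_{\bullet,T}:=V_{T^{(n)}}\subseteq\mathbb{C}[S_n]$. For $T'$ standard of the same shape as $T$, $v_{T',T}$ is the vector (unique up to nonzero scalar) in $V_T$ with $X_i\cdot v_{T',T}=\mathrm{cont}(b(T',i))\,v_{T',T}$ for all $i$. $T$ is its (left) induction tableau and $T'$ its (left) restriction tableau. The $v_{T',T}$ form a basis of $\mathbb{C}[S_n]$. Right construction. The same with left and right exchanged: start from $\mathbb{C}[S_1]$ and at step $k$ take the unique irreducible right $S_k$-submodule of (previous module)$\,\cdot\,\mathbb{C}[S_k]$ of type $\mathrm{shape}(T^{(k)})$; the result after step $n$ is the subspace obtained by following the induction path $T$ for the right action. Inside the right module with right induction tableau $T'$, the right weight vector with right restriction tableau $T$ is the vector $v$ (unique up to nonzero scalar) with $v\cdot X_i=\mathrm{cont}(b(T,i))\,v$ for all $i$. *)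

theory Defs
  imports
    Complex_Main
    "HOL-Library.Function_Algebras"
    "HOL-Combinatorics.Permutations"
begin

section \<open>Complex function spaces\<close>

text \<open>Addition of functions is the pointwise one of \<^theory>\<open>HOL-Library.Function_Algebras\<close>.\<close>

definition fscale :: "complex \<Rightarrow> ('a \<Rightarrow> complex) \<Rightarrow> 'a \<Rightarrow> complex" where
  "fscale c f = (\<lambda>x. c * f x)"

global_interpretation fn: vector_space fscale
  by unfold_locales (auto simp: fscale_def algebra_simps)

definition delta :: "'a \<Rightarrow> 'a \<Rightarrow> complex" where
  "delta a = (\<lambda>x. if x = a then 1 else 0)"


section \<open>The group algebra of the symmetric group\<close>

definition sym_group :: "nat \<Rightarrow> (nat \<Rightarrow> nat) set" where
  "sym_group k = {p. p permutes {1..k}}"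

text \<open>Elements are coefficient functions on \<^typ>\<open>nat \<Rightarrow> nat\<close> supported on \<^term>\<open>sym_group k\<close>,
  so that the algebras of the \<^term>\<open>sym_group k\<close> form an increasing chain with one common product.\<close>

type_synonym galg = "(nat \<Rightarrow> nat) \<Rightarrow> complex"

definition group_algebra :: "nat \<Rightarrow> galg set" where
  "group_algebra k = {f. \<forall>p. f p \<noteq> 0 \<longrightarrow> p \<in> sym_group k}"

definition gmult :: "galg \<Rightarrow> galg \<Rightarrow> galg" (infixl "\<star>" 70) where
  "f \<star> g = (\<lambda>p. \<Sum>(q, r) | f q \<noteq> 0 \<and> g r \<noteq> 0 \<and> q \<circ> r = p. f q * g r)"

definition jucys_murphy :: "nat \<Rightarrow> galg" where
  "jucys_murphy k = (\<Sum>j\<in>{1..<k}. delta (transpose j k))"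


section \<open>Young diagrams and standard tableaux\<close>

definition is_partition :: "nat \<Rightarrow> nat list \<Rightarrow> bool" where
  "is_partition k ls \<longleftrightarrow> sorted_wrt (\<ge>) ls \<and> 0 \<notin> set ls \<and> sum_list ls = k"

text \<open>Boxes are pairs (row, column), both counted from 0; contents do not depend on
  the common offset. A partition is represented by its diagram.\<close>

definition diagram :: "nat list \<Rightarrow> (nat \<times> nat) set" where
  "diagram ls = {(r, c). r < length ls \<and> c < ls ! r}"

definition young_diagrams :: "nat \<Rightarrow> (nat \<times> nat) set set" where
  "young_diagrams k = diagram ` {ls. is_partition k ls}"

definition content :: "nat \<times> nat \<Rightarrow> int" where
  "content b = int (snd b) - int (fst b)"

text \<open>A filling takes the value 0 exactly outside its shape, so that equality of functions is
  equality of tableaux.\<close>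

type_synonym tableau = "nat \<times> nat \<Rightarrow> nat"

definition shape :: "tableau \<Rightarrow> (nat \<times> nat) set" where
  "shape T = {b. T b \<noteq> 0}"

definition standard :: "nat \<Rightarrow> tableau \<Rightarrow> bool" where
  "standard n T \<longleftrightarrow>
     shape T \<in> young_diagrams n \<and>
     bij_betw T (shape T) {1..n} \<and>
     (\<forall>r c c'. (r, c) \<in> shape T \<and> (r, c') \<in> shape T \<and> c < c' \<longrightarrow> T (r, c) < T (r, c')) \<and>
     (\<forall>r r' c. (r, c) \<in> shape T \<and> (r', c) \<in> shape T \<and> r < r' \<longrightarrow> T (r, c) < T (r', c))"

definition std_tableaux :: "nat \<Rightarrow> (nat \<times> nat) set \<Rightarrow> tableau set" where
  "std_tableaux k D = {T. standard k T \<and> shape T = D}"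

definition box_of :: "tableau \<Rightarrow> nat \<Rightarrow> nat \<times> nat" where
  "box_of T i = inv_into (shape T) T i"

definition cont :: "tableau \<Rightarrow> nat \<Rightarrow> complex" where
  "cont T i = of_int (content (box_of T i))"

definition subtableau :: "tableau \<Rightarrow> nat \<Rightarrow> tableau" where
  "subtableau T k = (\<lambda>b. if T b \<le> k then T b else 0)"


section \<open>Modules over the symmetric group\<close>

definition is_module ::
  "nat \<Rightarrow> ((nat \<Rightarrow> nat) \<Rightarrow> ('a \<Rightarrow> complex) \<Rightarrow> ('a \<Rightarrow> complex)) \<Rightarrow> ('a \<Rightarrow> complex) set \<Rightarrow> bool" where
  "is_module k act W \<longleftrightarrow>
     fn.subspace W \<and>
     (\<forall>\<sigma>\<in>sym_group k. \<forall>v\<in>W. act \<sigma> v \<in> W) \<and>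
     (\<forall>\<sigma>\<in>sym_group k. \<forall>v\<in>W. \<forall>w\<in>W. act \<sigma> (v + w) = act \<sigma> v + act \<sigma> w) \<and>
     (\<forall>\<sigma>\<in>sym_group k. \<forall>v\<in>W. \<forall>c. act \<sigma> (fscale c v) = fscale c (act \<sigma> v)) \<and>
     (\<forall>v\<in>W. act id v = v) \<and>
     (\<forall>\<sigma>\<in>sym_group k. \<forall>\<tau>\<in>sym_group k. \<forall>v\<in>W. act (\<sigma> \<circ> \<tau>) v = act \<sigma> (act \<tau> v))"

definition irreducible_module ::
  "nat \<Rightarrow> ((nat \<Rightarrow> nat) \<Rightarrow> ('a \<Rightarrow> complex) \<Rightarrow> ('a \<Rightarrow> complex)) \<Rightarrow> ('a \<Rightarrow> complex) set \<Rightarrow> bool" where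
  "irreducible_module k act W \<longleftrightarrow>
     is_module k act W \<and> W \<noteq> {0} \<and>
     (\<forall>U. U \<subseteq> W \<and> is_module k act U \<longrightarrow> U = {0} \<or> U = W)"

definition isomorphic_modules ::
  "nat \<Rightarrow> ((nat \<Rightarrow> nat) \<Rightarrow> ('a \<Rightarrow> complex) \<Rightarrow> ('a \<Rightarrow> complex)) \<Rightarrow> ('a \<Rightarrow> complex) set \<Rightarrow>
   ((nat \<Rightarrow> nat) \<Rightarrow> ('b \<Rightarrow> complex) \<Rightarrow> ('b \<Rightarrow> complex)) \<Rightarrow> ('b \<Rightarrow> complex) set \<Rightarrow> bool" where
  "isomorphic_modules k act W act' W' \<longleftrightarrow>
     is_module k act W \<and> is_module k act' W' \<and>
     (\<exists>\<phi>. bij_betw \<phi> W W' \<and>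
       (\<forall>v\<in>W. \<forall>w\<in>W. \<phi> (v + w) = \<phi> v + \<phi> w) \<and>
       (\<forall>v\<in>W. \<forall>c. \<phi> (fscale c v) = fscale c (\<phi> v)) \<and>
       (\<forall>\<sigma>\<in>sym_group k. \<forall>v\<in>W. \<phi> (act \<sigma> v) = act' \<sigma> (\<phi> v)))"

text \<open>The irreducible module attached to a diagram, written in coordinates with respect to its
  weight basis: the carrier consists of the functions supported on the standard tableaux of shape
  \<open>D\<close>, the basis vector of \<open>T\<close> is \<^term>\<open>delta T\<close>, and \<open>\<rho>\<close> is the action. The action \<open>\<rho>\<close> is
  determined up to rescaling the basis vectors, hence the module up to isomorphism.\<close>

definition young_carrier :: "nat \<Rightarrow> (nat \<times> nat) set \<Rightarrow> (tableau \<Rightarrow> complex) set" where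
  "young_carrier k D = {f. \<forall>T. f T \<noteq> 0 \<longrightarrow> T \<in> std_tableaux k D}"

definition is_young_action ::
  "nat \<Rightarrow> (nat \<times> nat) set \<Rightarrow> ((nat \<Rightarrow> nat) \<Rightarrow> (tableau \<Rightarrow> complex) \<Rightarrow> (tableau \<Rightarrow> complex)) \<Rightarrow> bool" where
  "is_young_action k D \<rho> \<longleftrightarrow>
     irreducible_module k \<rho> (young_carrier k D) \<and>
     (\<forall>T\<in>std_tableaux k D. \<forall>i\<in>{1..k}.
        (\<Sum>j\<in>{1..<i}. \<rho> (transpose j i) (delta T)) = fscale (cont T i) (delta T))"

definition has_type ::
  "nat \<Rightarrow> (nat \<times> nat) set \<Rightarrow> ((nat \<Rightarrow> nat) \<Rightarrow> ('a \<Rightarrow> complex) \<Rightarrow> ('a \<Rightarrow> complex)) \<Rightarrow>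
   ('a \<Rightarrow> complex) set \<Rightarrow> bool" where
  "has_type k D act W \<longleftrightarrow>
     (\<exists>\<rho>. is_young_action k D \<rho> \<and> isomorphic_modules k act W \<rho> (young_carrier k D))"


section \<open>Left and right constructions\<close>

definition left_act :: "(nat \<Rightarrow> nat) \<Rightarrow> galg \<Rightarrow> galg" where
  "left_act \<sigma> v = delta \<sigma> \<star> v"

text \<open>Right multiplication turned into a left action; a right submodule is a submodule for it.\<close>

definition right_act :: "(nat \<Rightarrow> nat) \<Rightarrow> galg \<Rightarrow> galg" where
  "right_act \<sigma> v = v \<star> delta (inv \<sigma>)"

text \<open>The constructions start at 1; index 0 is a junk case.\<close>

fun left_induced :: "tableau \<Rightarrow> nat \<Rightarrow> galg set" where
  "left_induced T 0 = group_algebra 0"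
| "left_induced T (Suc 0) = group_algebra 1"
| "left_induced T (Suc (Suc m)) =
    (let k = Suc (Suc m) in
     THE W. W \<subseteq> fn.span {a \<star> w | a w. a \<in> group_algebra k \<and> w \<in> left_induced T (Suc m)} \<and>
       irreducible_module k left_act W \<and>
       has_type k (shape (subtableau T k)) left_act W)"

fun right_induced :: "tableau \<Rightarrow> nat \<Rightarrow> galg set" where
  "right_induced T 0 = group_algebra 0"
| "right_induced T (Suc 0) = group_algebra 1"
| "right_induced T (Suc (Suc m)) =
    (let k = Suc (Suc m) in
     THE W. W \<subseteq> fn.span {w \<star> a | w a. w \<in> right_induced T (Suc m) \<and> a \<in> group_algebra k} \<and>
       irreducible_module k right_act W \<and>
       has_type k (shape (subtableau T k)) right_act W)"

definition left_weight_vector :: "nat \<Rightarrow> tableau \<Rightarrow> tableau \<Rightarrow> galg \<Rightarrow> bool" where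
  "left_weight_vector n Tind Tres v \<longleftrightarrow>
     v \<in> left_induced Tind n \<and> v \<noteq> 0 \<and>
     (\<forall>i\<in>{1..n}. jucys_murphy i \<star> v = fscale (cont Tres i) v)"

definition right_weight_vector :: "nat \<Rightarrow> tableau \<Rightarrow> tableau \<Rightarrow> galg \<Rightarrow> bool" where
  "right_weight_vector n Tind Tres v \<longleftrightarrow>
     v \<in> right_induced Tind n \<and> v \<noteq> 0 \<and>
     (\<forall>i\<in>{1..n}. v \<star> jucys_murphy i = fscale (cont Tres i) v)"

definition tableau_pairs :: "nat \<Rightarrow> (tableau \<times> tableau) set" where
  "tableau_pairs n = {(T', T). standard n T' \<and> standard n T \<and> shape T' = shape T}"

definition indexed_basis :: "nat \<Rightarrow> (tableau \<Rightarrow> tableau \<Rightarrow> galg) \<Rightarrow> bool" where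
  "indexed_basis n v \<longleftrightarrow>
     inj_on (\<lambda>(T', T). v T' T) (tableau_pairs n) \<and>
     fn.independent ((\<lambda>(T', T). v T' T) ` tableau_pairs n) \<and>
     fn.span ((\<lambda>(T', T). v T' T) ` tableau_pairs n) = group_algebra n"

end

theory Submission
  imports Defs "HOL-Computational_Algebra.Polynomial"
begin

hide_const (open) Polynomial.content
hide_fact (open) Polynomial.content_def

text \<open>
  Write \<open>X\<^sub>i\<close> for the Jucys-Murphy elements and \<open>A\<^sub>k\<close> for the group algebra of the \<open>k\<close>-th
  symmetric group. To every standard tableau \<open>T\<close> belongs an idempotent \<open>e\<^sub>T\<close>, a polynomial in the
  \<open>X\<^sub>i\<close>, on which \<open>X\<^sub>i\<close> acts by the content of the box of \<open>i\<close>. Everything rests on the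
  identification of the two constructions with the ideals generated by this idempotent: following
  the induction path \<open>T\<close> for the left action ends in \<open>A\<^sub>n e\<^sub>T\<close>, and following it for the right
  action ends in \<open>e\<^sub>T A\<^sub>n\<close> (\<open>left_induced_eq\<close>, \<open>right_induced_eq\<close>). Indeed
  \<open>A\<^sub>k (A\<^bsub>k-1\<^esub> e\<^sub>Q) = A\<^sub>k e\<^sub>Q\<close>, and \<open>e\<^sub>Q\<close> is the sum of the \<open>e\<^sub>T\<close> over the extensions \<open>T\<close> of \<open>Q\<close> by
  one box. A vector of left weight \<open>T'\<close> is one that is fixed by left multiplication with \<open>e\<^bsub>T'\<^esub>\<close>, and
  likewise on the right. So \<open>v\<^bsub>T',T\<^esub>\<close> spans the line \<open>e\<^bsub>T'\<^esub> A\<^sub>n e\<^sub>T\<close>, whose description is symmetric in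
  left and right, and the theorem follows from \<open>\<Sum> e\<^sub>T = 1\<close>.

  The work lies in constructing the idempotents without any knowledge of the irreducible modules.
  Tableaux are replaced by paths, that is lists of boxes, each of which is addable to the diagram of
  the boxes after it. Given \<open>e\<^sub>Q\<close> for a path of length \<open>k\<close>, the idempotents of its extensions are the
  Lagrange interpolation polynomials of the addable contents evaluated at \<open>X\<^bsub>k+1\<^esub>\<close>. This works once
  \<open>X\<^bsub>k+1\<^esub>\<close> is known to be diagonalisable on \<open>e\<^sub>Q\<close> with exactly the addable contents as eigenvalues.
  The proof computes the moments of \<open>X\<^bsub>k+1\<^esub>\<close>: truncating \<open>q(X\<^bsub>k+1\<^esub>)\<close> to \<open>A\<^sub>k\<close> multiplies \<open>e\<^sub>Q\<close> by the
  residue at infinity of \<open>q N / D\<close>, where \<open>D\<close> has the addable and \<open>N\<close> the removable contents as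
  roots (\<open>gz_moments\<close>). Adding a box of content \<open>c\<close> multiplies \<open>N / D\<close> by \<open>(z - c)\<^sup>2 / ((z - c)\<^sup>2 - 1)\<close>
  (\<open>corner_poly_insert\<close>), and the moments change in the same way because the intertwiner
  \<open>\<phi> = X\<^sub>k s - s X\<^sub>k\<close> with \<open>s = (k k+1)\<close> has the square \<open>1 - (X\<^bsub>k+1\<^esub> - X\<^sub>k)\<^sup>2\<close> (\<open>moment_quad\<close>). The moment of
  \<open>D\<^sup>2\<close> is zero, so \<open>D(X\<^bsub>k+1\<^esub>) e\<^sub>Q = 0\<close> by positivity (\<open>vanish_on_addable\<close>), and the moments of the
  Lagrange polynomials are not zero, so no idempotent vanishes (\<open>path_res_lag\<close>).

  The blocks \<open>e\<^bsub>T'\<^esub> A\<^sub>n e\<^sub>T\<close> are found by induction on \<open>n\<close> from \<open>A\<^bsub>k+1\<^esub> = A\<^sub>k + A\<^sub>k s A\<^sub>k\<close>: they vanish for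
  different shapes, and \<open>e\<^sub>T A\<^sub>n e\<^sub>T\<close> consists of scalars (\<open>block_all\<close>). For equal shapes the
  idempotents are equivalent, since \<open>\<phi>\<close> is invertible between two paths that differ by the order of
  their last two boxes (\<open>gz_equiv_same_set\<close>). Hence \<open>A\<^sub>n e\<^sub>T\<close> is irreducible, has a weight basis indexed by
  the tableaux of its shape, and is the only submodule of its type in \<open>A\<^sub>n e\<^sub>Q\<close>
  (\<open>irreducible_of_type_unique\<close>). The right-handed statements are obtained from the left-handed ones by
  the anti-automorphism that inverts permutations, which fixes every \<open>e\<^sub>T\<close>.
\<close>

section \<open>The group algebra as a ring\<close>

text \<open>The product \<open>\<star>\<close> is associative on functions of finite support. They form the monoid algebra of all
  maps \<open>nat \<Rightarrow> nat\<close>, which as a type is a ring and contains the whole chain of group algebras.\<close>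

typedef ga = "{f :: galg. finite {p. f p \<noteq> 0}}"
  morphisms coef Abs_ga
  by (rule exI[of _ 0]) simp

setup_lifting type_definition_ga

lemma finite_support_coef [simp]: "finite {p. coef x p \<noteq> 0}"
  using coef[of x] by simp

lemma gmult_eq_double_sum:
  assumes "finite S" "finite S'" "\<And>q. f q \<noteq> 0 \<Longrightarrow> q \<in> S" "\<And>r. g r \<noteq> 0 \<Longrightarrow> r \<in> S'"
  shows "(f \<star> g) p = (\<Sum>q\<in>S. \<Sum>r\<in>S'. if q \<circ> r = p then f q * g r else 0)"
proof -
  have "(\<Sum>q\<in>S. \<Sum>r\<in>S'. if q \<circ> r = p then f q * g r else 0)
      = (\<Sum>(q, r)\<in>S \<times> S'. if q \<circ> r = p then f q * g r else 0)"
    by (rule sum.cartesian_product)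
  also have "\<dots> = (\<Sum>(q, r) | f q \<noteq> 0 \<and> g r \<noteq> 0 \<and> q \<circ> r = p. f q * g r)"
    by (rule sum.mono_neutral_cong_right) (use assms in \<open>auto split: if_splits\<close>)
  finally show ?thesis by (simp add: gmult_def)
qed

text \<open>A product is tested against an arbitrary weight \<open>w\<close>; both sides of the associative law are the
  case where \<open>w\<close> sums the coefficients of a third factor.\<close>

lemma sum_gmult_times:
  assumes "finite S" "finite S'" "\<And>q. f q \<noteq> 0 \<Longrightarrow> q \<in> S" "\<And>r. g r \<noteq> 0 \<Longrightarrow> r \<in> S'"
    and "finite U" "\<And>q r. q \<in> S \<Longrightarrow> r \<in> S' \<Longrightarrow> q \<circ> r \<in> U"
  shows "(\<Sum>u\<in>U. (f \<star> g) u * w u) = (\<Sum>q\<in>S. \<Sum>r\<in>S'. f q * g r * w (q \<circ> r))"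
proof -
  have "(\<Sum>u\<in>U. (f \<star> g) u * w u)
      = (\<Sum>u\<in>U. \<Sum>q\<in>S. \<Sum>r\<in>S'. if q \<circ> r = u then f q * g r * w u else 0)"
    by (simp add: gmult_eq_double_sum[OF assms(1-4)] sum_distrib_right if_distrib[of "\<lambda>z. z * _"] cong: if_cong)
  also have "\<dots> = (\<Sum>q\<in>S. \<Sum>u\<in>U. \<Sum>r\<in>S'. if q \<circ> r = u then f q * g r * w u else 0)"
    by (rule sum.swap)
  also have "\<dots> = (\<Sum>q\<in>S. \<Sum>r\<in>S'. \<Sum>u\<in>U. if q \<circ> r = u then f q * g r * w u else 0)"
    by (intro sum.cong refl sum.swap)
  also have "\<dots> = (\<Sum>q\<in>S. \<Sum>r\<in>S'. f q * g r * w (q \<circ> r))"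
    using assms(5,6) by (intro sum.cong refl) simp
  finally show ?thesis .
qed

lemma gmult_support: "(f \<star> g) p \<noteq> 0 \<Longrightarrow> \<exists>q r. f q \<noteq> 0 \<and> g r \<noteq> 0 \<and> p = q \<circ> r"
  unfolding gmult_def by (rule ccontr) (auto intro!: sum.neutral)

lemma finite_support_gmult:
  assumes "finite {p. f p \<noteq> 0}" "finite {p. g p \<noteq> 0}"
  shows "finite {p. (f \<star> g) p \<noteq> 0}"
proof (rule finite_subset)
  show "{p. (f \<star> g) p \<noteq> 0} \<subseteq> (\<lambda>(q, r). q \<circ> r) ` ({p. f p \<noteq> 0} \<times> {p. g p \<noteq> 0})"
    using gmult_support[of f g] by (auto simp: image_iff)
qed (use assms in auto)

lemma gmult_assoc:
  assumes F: "finite {p. f p \<noteq> 0}" "finite {p. g p \<noteq> 0}" "finite {p. h p \<noteq> 0}"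
  shows "(f \<star> g) \<star> h = f \<star> (g \<star> h)"
proof
  fix p
  define S1 S2 S3 where S: "S1 = {p. f p \<noteq> 0}" "S2 = {p. g p \<noteq> 0}" "S3 = {p. h p \<noteq> 0}"
  define S12 S23 where S': "S12 = (\<lambda>(q, r). q \<circ> r) ` (S1 \<times> S2)" "S23 = (\<lambda>(q, r). q \<circ> r) ` (S2 \<times> S3)"
  have fin: "finite S1" "finite S2" "finite S3" "finite S12" "finite S23"
    using F by (auto simp: S S')
  have s12: "(f \<star> g) u \<noteq> 0 \<Longrightarrow> u \<in> S12" for u
    using gmult_support[of f g u] by (auto simp: S S')
  have s23: "(g \<star> h) u \<noteq> 0 \<Longrightarrow> u \<in> S23" for u
    using gmult_support[of g h u] by (auto simp: S S')
  have "((f \<star> g) \<star> h) p = (\<Sum>u\<in>S12. \<Sum>t\<in>S3. if u \<circ> t = p then (f \<star> g) u * h t else 0)"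
    by (rule gmult_eq_double_sum) (use fin s12 in \<open>auto simp: S\<close>)
  also have "\<dots> = (\<Sum>u\<in>S12. (f \<star> g) u * (\<Sum>t\<in>S3. if u \<circ> t = p then h t else 0))"
    by (simp add: sum_distrib_left if_distrib cong: if_cong)
  also have "\<dots> = (\<Sum>q\<in>S1. \<Sum>r\<in>S2. f q * g r * (\<Sum>t\<in>S3. if (q \<circ> r) \<circ> t = p then h t else 0))"
    by (rule sum_gmult_times) (use fin in \<open>auto simp: S S'\<close>)
  also have "\<dots> = (\<Sum>q\<in>S1. \<Sum>r\<in>S2. \<Sum>t\<in>S3. g r * h t * (if q \<circ> (r \<circ> t) = p then f q else 0))"
    by (simp add: sum_distrib_left if_distrib o_assoc mult_ac cong: if_cong)
  also have "\<dots> = (\<Sum>q\<in>S1. \<Sum>v\<in>S23. (g \<star> h) v * (if q \<circ> v = p then f q else 0))"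
    by (intro sum.cong refl sum_gmult_times[symmetric]) (use fin in \<open>auto simp: S S'\<close>)
  also have "\<dots> = (\<Sum>q\<in>S1. \<Sum>v\<in>S23. if q \<circ> v = p then f q * (g \<star> h) v else 0)"
    by (simp add: if_distrib mult_ac cong: if_cong)
  also have "\<dots> = (f \<star> (g \<star> h)) p"
    by (rule gmult_eq_double_sum[symmetric]) (use fin s23 in \<open>auto simp: S\<close>)
  finally show "((f \<star> g) \<star> h) p = (f \<star> (g \<star> h)) p" .
qed

lemma gmult_add_left:
  assumes F: "finite {p. f p \<noteq> 0}" "finite {p. g p \<noteq> 0}" "finite {p. h p \<noteq> 0}"
  shows "(f + g) \<star> h = f \<star> h + g \<star> h"
proof
  fix p
  let ?S = "{p. f p \<noteq> 0} \<union> {p. g p \<noteq> 0}" and ?S' = "{p. h p \<noteq> 0}"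
  have fin: "finite ?S" "finite ?S'" using F by auto
  have e: "(f' \<star> h) p = (\<Sum>q\<in>?S. \<Sum>r\<in>?S'. if q \<circ> r = p then f' q * h r else 0)"
    if "\<And>q. f' q \<noteq> 0 \<Longrightarrow> q \<in> ?S" for f'
    by (rule gmult_eq_double_sum) (use fin that in auto)
  have E: "((f + g) \<star> h) p = (f \<star> h) p + (g \<star> h) p"
  proof -
    have "((f + g) \<star> h) p = (\<Sum>q\<in>?S. \<Sum>r\<in>?S'. (if q \<circ> r = p then f q * h r else 0) + (if q \<circ> r = p then g q * h r else 0))"
      by (subst e) (auto simp: distrib_right intro!: sum.cong)
    also have "\<dots> = (f \<star> h) p + (g \<star> h) p"
      unfolding sum.distrib by (rule arg_cong2[where f = plus]; rule e[symmetric]; simp)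
    finally show ?thesis .
  qed
  from E show "((f + g) \<star> h) p = (f \<star> h + g \<star> h) p" by simp
qed

lemma gmult_add_right:
  assumes F: "finite {p. f p \<noteq> 0}" "finite {p. g p \<noteq> 0}" "finite {p. h p \<noteq> 0}"
  shows "h \<star> (f + g) = h \<star> f + h \<star> g"
proof
  fix p
  let ?S = "{p. f p \<noteq> 0} \<union> {p. g p \<noteq> 0}" and ?S' = "{p. h p \<noteq> 0}"
  have fin: "finite ?S'" "finite ?S" using F by auto
  have e: "(h \<star> f') p = (\<Sum>q\<in>?S'. \<Sum>r\<in>?S. if q \<circ> r = p then h q * f' r else 0)"
    if "\<And>q. f' q \<noteq> 0 \<Longrightarrow> q \<in> ?S" for f'
    by (rule gmult_eq_double_sum) (use fin that in auto)
  have E: "(h \<star> (f + g)) p = (h \<star> f) p + (h \<star> g) p"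
  proof -
    have "(h \<star> (f + g)) p = (\<Sum>q\<in>?S'. \<Sum>r\<in>?S. (if q \<circ> r = p then h q * f r else 0) + (if q \<circ> r = p then h q * g r else 0))"
      by (subst e) (auto simp: distrib_left intro!: sum.cong)
    also have "\<dots> = (h \<star> f) p + (h \<star> g) p"
      unfolding sum.distrib by (rule arg_cong2[where f = plus]; rule e[symmetric]; simp)
    finally show ?thesis .
  qed
  from E show "(h \<star> (f + g)) p = (h \<star> f + h \<star> g) p" by simp
qed

lemma gmult_fscale_left:
  assumes F: "finite {p. f p \<noteq> 0}" "finite {p. g p \<noteq> 0}"
  shows "fscale c f \<star> g = fscale c (f \<star> g)"
proof
  fix p
  show "(fscale c f \<star> g) p = fscale c (f \<star> g) p"
  proof -
    have "(fscale c f \<star> g) p = (\<Sum>q | f q \<noteq> 0. \<Sum>r | g r \<noteq> 0. if q \<circ> r = p then (fscale c f) q * (g) r else 0)"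
      by (rule gmult_eq_double_sum[OF F]) (auto simp: fscale_def)
    also have "\<dots> = c * (\<Sum>q | f q \<noteq> 0. \<Sum>r | g r \<noteq> 0. if q \<circ> r = p then f q * g r else 0)"
      unfolding sum_distrib_left by (intro sum.cong refl) (simp add: fscale_def)
    also have "(\<Sum>q | f q \<noteq> 0. \<Sum>r | g r \<noteq> 0. if q \<circ> r = p then f q * g r else 0) = (f \<star> g) p"
      by (rule gmult_eq_double_sum[OF F, symmetric]) auto
    finally show ?thesis by (simp add: fscale_def)
  qed
qed

lemma gmult_fscale_right:
  assumes F: "finite {p. f p \<noteq> 0}" "finite {p. g p \<noteq> 0}"
  shows "f \<star> fscale c g = fscale c (f \<star> g)"
proof
  fix p
  show "(f \<star> fscale c g) p = fscale c (f \<star> g) p"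
  proof -
    have "(f \<star> fscale c g) p = (\<Sum>q | f q \<noteq> 0. \<Sum>r | g r \<noteq> 0. if q \<circ> r = p then (f) q * (fscale c g) r else 0)"
      by (rule gmult_eq_double_sum[OF F]) (auto simp: fscale_def)
    also have "\<dots> = c * (\<Sum>q | f q \<noteq> 0. \<Sum>r | g r \<noteq> 0. if q \<circ> r = p then f q * g r else 0)"
      unfolding sum_distrib_left by (intro sum.cong refl) (simp add: fscale_def)
    also have "(\<Sum>q | f q \<noteq> 0. \<Sum>r | g r \<noteq> 0. if q \<circ> r = p then f q * g r else 0) = (f \<star> g) p"
      by (rule gmult_eq_double_sum[OF F, symmetric]) auto
    finally show ?thesis by (simp add: fscale_def)
  qed
qed

lemma finite_support_delta [simp]: "finite {p. delta a p \<noteq> 0}"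
  by (rule finite_subset[of _ "{a}"]) (auto simp: delta_def)

lemma gmult_delta_delta: "delta \<sigma> \<star> delta \<tau> = delta (\<sigma> \<circ> \<tau>)"
proof
  fix p
  show "(delta \<sigma> \<star> delta \<tau>) p = delta (\<sigma> \<circ> \<tau>) p"
    by (subst gmult_eq_double_sum[where S = "{\<sigma>}" and S' = "{\<tau>}"]) (auto simp: delta_def split: if_splits)
qed

lemma gmult_delta_id:
  assumes "finite {p. f p \<noteq> 0}"
  shows "delta id \<star> f = f" "f \<star> delta id = f"
proof -
  show "delta id \<star> f = f"
  proof
    fix p show "(delta id \<star> f) p = f p"
      by (subst gmult_eq_double_sum[where S = "{id}" and S' = "{p. f p \<noteq> 0}"])
        (use assms in \<open>auto simp: delta_def split: if_splits\<close>)
  qed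
  show "f \<star> delta id = f"
  proof
    fix p show "(f \<star> delta id) p = f p"
      by (subst gmult_eq_double_sum[where S = "{p. f p \<noteq> 0}" and S' = "{id}"])
        (use assms in \<open>auto simp: delta_def split: if_splits\<close>)
  qed
qed

lemma finite_support_plus:
  "finite {p. f p \<noteq> 0} \<Longrightarrow> finite {p. g p \<noteq> 0} \<Longrightarrow> finite {p. (f + g) p \<noteq> (0::complex)}"
  by (rule finite_subset[of _ "{p. f p \<noteq> 0} \<union> {p. g p \<noteq> 0}"]) auto

instantiation ga :: ring_1
begin

lift_definition zero_ga :: ga is 0 by simp
lift_definition one_ga :: ga is "delta id" by simp
lift_definition plus_ga :: "ga \<Rightarrow> ga \<Rightarrow> ga" is "\<lambda>f g. f + g" by (rule finite_support_plus)
lift_definition uminus_ga :: "ga \<Rightarrow> ga" is "\<lambda>f. - f" by simp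
definition minus_ga :: "ga \<Rightarrow> ga \<Rightarrow> ga" where "minus_ga x y = x + - y"
lift_definition times_ga :: "ga \<Rightarrow> ga \<Rightarrow> ga" is "\<lambda>f g. f \<star> g" by (rule finite_support_gmult)

instance
proof
  fix a b c :: ga
  note rep = coef_inject[symmetric] plus_ga.rep_eq uminus_ga.rep_eq
    zero_ga.rep_eq one_ga.rep_eq times_ga.rep_eq
  show "a * b * c = a * (b * c)" unfolding rep by (rule gmult_assoc) simp_all
  show "(a + b) * c = a * c + b * c" unfolding rep by (rule gmult_add_left) simp_all
  show "c * (a + b) = c * a + c * b" unfolding rep by (rule gmult_add_right) simp_all
  show "1 * a = a" "a * 1 = a" unfolding rep by (rule gmult_delta_id, simp)+
  show "a + b + c = a + (b + c)" unfolding rep by (rule add.assoc)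
  show "a + b = b + a" unfolding rep by (rule add.commute)
  show "0 + a = a" unfolding rep by (rule add_0)
  show "- a + a = 0" unfolding rep by (rule left_minus)
  show "a - b = a + - b" by (rule minus_ga_def)
  have "coef 0 id \<noteq> coef 1 id" by (simp add: zero_ga.rep_eq one_ga.rep_eq delta_def)
  then show "(0::ga) \<noteq> 1" by force
qed

end

lift_definition cs :: "complex \<Rightarrow> ga \<Rightarrow> ga" is fscale
  by (erule finite_subset[rotated]) (auto simp: fscale_def)

lift_definition grp :: "(nat \<Rightarrow> nat) \<Rightarrow> ga" is delta by simp

lemma coef_simps:
  "coef (x + y) = coef x + coef y" "coef (x - y) = coef x - coef y" "coef (- x) = - coef x" "coef 0 = 0"
  "coef 1 = delta id" "coef (x * y) = coef x \<star> coef y" "coef (cs c x) = fscale c (coef x)"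
  "coef (grp \<sigma>) = delta \<sigma>"
  unfolding minus_ga_def plus_ga.rep_eq uminus_ga.rep_eq zero_ga.rep_eq one_ga.rep_eq
    times_ga.rep_eq cs.rep_eq grp.rep_eq
  by (rule refl diff_conv_add_uminus[symmetric])+

global_interpretation ga: vector_space cs
  by (unfold_locales; unfold coef_inject[symmetric] coef_simps)
    (rule fn.scale_right_distrib fn.scale_left_distrib fn.scale_scale fn.scale_one)+

lemma mult_cs [simp]: "cs c x * y = cs c (x * y)" "x * cs c y = cs c (x * y)"
  unfolding coef_inject[symmetric] coef_simps
  by (rule gmult_fscale_left gmult_fscale_right; simp)+

lemma coef_sum: "coef (sum f I) = (\<Sum>i\<in>I. coef (f i))"
  by (induction I rule: infinite_finite_induct) (simp_all add: coef_simps)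

lemma grp_mult: "grp \<sigma> * grp \<tau> = grp (\<sigma> \<circ> \<tau>)"
  unfolding coef_inject[symmetric] coef_simps by (rule gmult_delta_delta)

lemma grp_id [simp]: "grp id = 1"
  unfolding coef_inject[symmetric] coef_simps ..

section \<open>The chain of symmetric group algebras\<close>

definition GA :: "nat \<Rightarrow> ga set" where
  "GA k = {x. coef x \<in> group_algebra k}"

lemma sym_group_id [simp]: "id \<in> sym_group k"
  by (simp add: sym_group_def permutes_id)

lemma sym_group_comp: "p \<in> sym_group k \<Longrightarrow> q \<in> sym_group k \<Longrightarrow> p \<circ> q \<in> sym_group k"
  by (simp add: sym_group_def permutes_compose)

lemma sym_group_inv: "p \<in> sym_group k \<Longrightarrow> inv p \<in> sym_group k"
  by (simp add: sym_group_def permutes_inv)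

lemma sym_group_mono: "k \<le> m \<Longrightarrow> sym_group k \<subseteq> sym_group m"
  by (auto simp: sym_group_def intro: permutes_subset)

lemma sym_group_transpose: "i \<in> {1..k} \<Longrightarrow> j \<in> {1..k} \<Longrightarrow> transpose i j \<in> sym_group k"
  by (simp add: sym_group_def permutes_swap_id)

lemma sym_group_bij: "p \<in> sym_group k \<Longrightarrow> bij p"
  by (auto simp: sym_group_def permutes_bij)

lemma finite_sym_group [simp]: "finite (sym_group k)"
  by (simp add: sym_group_def finite_permutations)

lemma sym_group_inv_comp:
  assumes "p \<in> sym_group k"
  shows "p \<circ> inv p = id" "inv p \<circ> p = id" "inv (inv p) = p"
  using assms by (auto simp: sym_group_def permutes_inv_o permutes_inv_inv)

lemma GA_mono: "k \<le> m \<Longrightarrow> GA k \<subseteq> GA m"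
  using sym_group_mono[of k m] by (auto simp: GA_def group_algebra_def)

lemma GA_0 [simp]: "0 \<in> GA k"
  by (simp add: GA_def group_algebra_def coef_simps)

lemma GA_grp [simp]: "\<sigma> \<in> sym_group k \<Longrightarrow> grp \<sigma> \<in> GA k"
  by (auto simp: GA_def group_algebra_def coef_simps delta_def split: if_splits)

lemma GA_1 [simp]: "1 \<in> GA k"
  using GA_grp[of id k] by simp

lemma GA_add [simp]: "x \<in> GA k \<Longrightarrow> y \<in> GA k \<Longrightarrow> x + y \<in> GA k"
  by (force simp: GA_def group_algebra_def coef_simps)

lemma GA_cs [simp]: "x \<in> GA k \<Longrightarrow> cs c x \<in> GA k"
  by (force simp: GA_def group_algebra_def coef_simps fscale_def)

lemma GA_uminus [simp]: "x \<in> GA k \<Longrightarrow> - x \<in> GA k"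
  by (force simp: GA_def group_algebra_def coef_simps)

lemma GA_diff [simp]: "x \<in> GA k \<Longrightarrow> y \<in> GA k \<Longrightarrow> x - y \<in> GA k"
  by (metis GA_add GA_uminus diff_conv_add_uminus)

lemma GA_mult [simp]: "x \<in> GA k \<Longrightarrow> y \<in> GA k \<Longrightarrow> x * y \<in> GA k"
  unfolding GA_def group_algebra_def coef_simps mem_Collect_eq
  using gmult_support[of "coef x" "coef y"] by (metis sym_group_comp)

lemma GA_sum [simp]: "(\<And>i. i \<in> I \<Longrightarrow> f i \<in> GA k) \<Longrightarrow> sum f I \<in> GA k"
  by (induction I rule: infinite_finite_induct) auto

lemma sum_fun_apply: "(sum f I) x = (\<Sum>i\<in>I. f i x)"
  by (induction I rule: infinite_finite_induct) simp_all

text \<open>Bilinear identities need to be checked on permutations only; this is the purpose of the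
  expansion and of the induction rule derived from it.\<close>

lemma GA_expand:
  assumes "x \<in> GA k"
  shows "x = (\<Sum>p\<in>sym_group k. cs (coef x p) (grp p))"
proof -
  have "coef x q = coef (\<Sum>p\<in>sym_group k. cs (coef x p) (grp p)) q" for q
  proof -
    have "coef (\<Sum>p\<in>sym_group k. cs (coef x p) (grp p)) q
        = (\<Sum>p\<in>sym_group k. if q = p then coef x p else 0)"
      unfolding coef_sum coef_simps sum_fun_apply
      by (rule sum.cong) (auto simp: fscale_def delta_def)
    also have "\<dots> = coef x q"
      using assms by (auto simp: GA_def group_algebra_def)
    finally show ?thesis by simp
  qed
  then show ?thesis unfolding coef_inject[symmetric] by blast
qed

lemma GA_induct [consumes 1, case_names grp add scale]:
  assumes "x \<in> GA k"
    and grp: "\<And>\<sigma>. \<sigma> \<in> sym_group k \<Longrightarrow> Q (grp \<sigma>)"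
    and add: "\<And>x y. x \<in> GA k \<Longrightarrow> y \<in> GA k \<Longrightarrow> Q x \<Longrightarrow> Q y \<Longrightarrow> Q (x + y)"
    and scale: "\<And>c x. x \<in> GA k \<Longrightarrow> Q x \<Longrightarrow> Q (cs c x)"
  shows "Q x"
proof -
  have Q0: "Q 0"
    using scale[OF GA_1 , of 0] grp[of id] by simp
  have "S \<subseteq> sym_group k \<Longrightarrow> finite S \<Longrightarrow>
      Q (\<Sum>p\<in>S. cs (c p) (grp p)) \<and> (\<Sum>p\<in>S. cs (c p) (grp p)) \<in> GA k" for c and S :: "(nat \<Rightarrow> nat) set"
  proof (induction S rule: infinite_finite_induct)
    case (insert p F)
    then show ?case by (auto intro!: add scale grp)
  qed (simp_all add: Q0)
  then show ?thesis
    using GA_expand[OF assms(1)] finite_sym_group[of k] by (metis order_refl)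
qed

section \<open>Truncation to a smaller symmetric group\<close>

text \<open>This is the conditional expectation onto the algebra of a smaller symmetric group: it is a
  bimodule map over that algebra.\<close>

lift_definition trunc :: "nat \<Rightarrow> ga \<Rightarrow> ga" is "\<lambda>k f p. if p \<in> sym_group k then f p else 0"
  by (erule finite_subset[rotated]) auto

lemma trunc_add: "trunc k (x + y) = trunc k x + trunc k y"
  unfolding coef_inject[symmetric] coef_simps trunc.rep_eq by (rule ext) simp

lemma trunc_cs: "trunc k (cs c x) = cs c (trunc k x)"
  unfolding coef_inject[symmetric] coef_simps trunc.rep_eq by (rule ext) (simp add: fscale_def)

lemma trunc_uminus: "trunc k (- x) = - trunc k x"
  unfolding coef_inject[symmetric] coef_simps trunc.rep_eq by (rule ext) simp

lemma trunc_diff: "trunc k (x - y) = trunc k x - trunc k y"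
  using trunc_add[of k x "- y"] by (simp add: trunc_uminus)

lemma trunc_0 [simp]: "trunc k 0 = 0"
  using trunc_cs[of k 0 0] by simp

lemma trunc_sum: "trunc k (sum f I) = (\<Sum>i\<in>I. trunc k (f i))"
  by (induction I rule: infinite_finite_induct) (simp_all add: trunc_add)

lemma trunc_grp: "trunc k (grp \<sigma>) = (if \<sigma> \<in> sym_group k then grp \<sigma> else 0)"
proof (cases "\<sigma> \<in> sym_group k")
  case True
  then show ?thesis
    unfolding coef_inject[symmetric] trunc.rep_eq by (auto simp: coef_simps delta_def)
next
  case False
  then show ?thesis
    unfolding coef_inject[symmetric] trunc.rep_eq by (auto simp: coef_simps delta_def)
qed

lemma trunc_in_GA [simp]: "trunc k x \<in> GA k"
  by (simp add: GA_def group_algebra_def trunc.rep_eq)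

lemma trunc_GA [simp]: "x \<in> GA k \<Longrightarrow> trunc k x = x"
  unfolding coef_inject[symmetric] trunc.rep_eq by (rule ext) (auto simp: GA_def group_algebra_def)

lemma trunc_mult_left:
  assumes "a \<in> GA k" "x \<in> GA m"
  shows "trunc k (a * x) = a * trunc k x"
  using assms
proof (induction rule: GA_induct)
  case (grp \<sigma>)
  from grp(2) show ?case
  proof (induction rule: GA_induct)
    case (grp \<tau>)
    have "\<sigma> \<circ> \<tau> \<in> sym_group k \<longleftrightarrow> \<tau> \<in> sym_group k"
      using sym_group_comp[OF sym_group_inv[OF \<open>\<sigma> \<in> sym_group k\<close>], of "\<sigma> \<circ> \<tau>"]
        sym_group_comp[OF \<open>\<sigma> \<in> sym_group k\<close>, of \<tau>] sym_group_inv_comp[OF \<open>\<sigma> \<in> sym_group k\<close>]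
      by (auto simp: o_assoc)
    then show ?case by (simp add: trunc_grp grp_mult)
  qed (simp_all add: algebra_simps trunc_add trunc_cs)
qed (simp_all add: algebra_simps trunc_add trunc_cs)

lemma trunc_mult_right:
  assumes "a \<in> GA k" "x \<in> GA m"
  shows "trunc k (x * a) = trunc k x * a"
  using assms
proof (induction rule: GA_induct)
  case (grp \<sigma>)
  from grp(2) show ?case
  proof (induction rule: GA_induct)
    case (grp \<tau>)
    have "\<tau> \<circ> \<sigma> \<in> sym_group k \<longleftrightarrow> \<tau> \<in> sym_group k"
      using sym_group_comp[OF _ sym_group_inv[OF \<open>\<sigma> \<in> sym_group k\<close>], of "\<tau> \<circ> \<sigma>"]
        sym_group_comp[OF _ \<open>\<sigma> \<in> sym_group k\<close>, of \<tau>] sym_group_inv_comp[OF \<open>\<sigma> \<in> sym_group k\<close>]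
      by (auto simp: comp_assoc)
    then show ?case by (simp add: trunc_grp grp_mult)
  qed (simp_all add: algebra_simps trunc_add trunc_cs)
qed (simp_all add: algebra_simps trunc_add trunc_cs)


section \<open>Inversion of permutations and positivity\<close>

text \<open>The linear anti-automorphism that inverts permutations. Maps that are not bijective have no
  inverse and are sent to zero.\<close>

lift_definition iota :: "ga \<Rightarrow> ga" is "\<lambda>f p. if bij p then f (inv p) else 0"
proof -
  fix f :: galg
  assume "finite {p. f p \<noteq> 0}"
  then have "finite (inv ` {p. f p \<noteq> 0})" by simp
  moreover have "{p. (if bij p then f (inv p) else 0) \<noteq> 0} \<subseteq> inv ` {p. f p \<noteq> 0}"
    by (auto simp: image_iff intro!: exI[of _ "inv _"] inv_inv_eq[symmetric] split: if_splits)
  ultimately show "finite {p. (if bij p then f (inv p) else 0) \<noteq> 0}"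
    by (rule finite_subset[rotated])
qed

lemma iota_add: "iota (x + y) = iota x + iota y"
  unfolding coef_inject[symmetric] coef_simps iota.rep_eq by (rule ext) simp

lemma iota_cs: "iota (cs c x) = cs c (iota x)"
  unfolding coef_inject[symmetric] coef_simps iota.rep_eq by (rule ext) (simp add: fscale_def)

lemma iota_0 [simp]: "iota 0 = 0"
  using iota_cs[of 0 0] by simp

lemma iota_sum: "iota (sum f I) = (\<Sum>i\<in>I. iota (f i))"
  by (induction I rule: infinite_finite_induct) (simp_all add: iota_add)

lemma iota_grp:
  assumes "bij \<sigma>"
  shows "iota (grp \<sigma>) = grp (inv \<sigma>)"
proof -
  have "(if bij p then delta \<sigma> (inv p) else 0) = delta (inv \<sigma>) p" for p
    using assms inv_inv_eq[of p] inv_inv_eq[of \<sigma>] bij_imp_bij_inv[of \<sigma>]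
    by (auto simp: delta_def)
  then show ?thesis
    unfolding coef_inject[symmetric] iota.rep_eq coef_simps by auto
qed

lemma iota_1 [simp]: "iota 1 = 1"
  using iota_grp[of id] by simp

lemma iota_GA [simp]: "x \<in> GA k \<Longrightarrow> iota x \<in> GA k"
  using sym_group_inv inv_inv_eq by (fastforce simp: GA_def group_algebra_def iota.rep_eq)

lemma iota_iota [simp]: "x \<in> GA k \<Longrightarrow> iota (iota x) = x"
  by (induction rule: GA_induct)
    (simp_all add: iota_add iota_cs iota_grp sym_group_bij sym_group_inv bij_imp_bij_inv inv_inv_eq)

lemma iota_mult:
  assumes "x \<in> GA k" "y \<in> GA m"
  shows "iota (x * y) = iota y * iota x"
  using assms
proof (induction rule: GA_induct)
  case (grp \<sigma>)
  from grp(2) show ?case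
  proof (induction rule: GA_induct)
    case (grp \<tau>)
    then show ?case
      using \<open>\<sigma> \<in> sym_group k\<close>
      by (simp add: iota_grp sym_group_bij grp_mult bij_comp o_inv_distrib)
  qed (simp_all add: algebra_simps iota_add iota_cs)
qed (simp_all add: algebra_simps iota_add iota_cs)

definition real_el :: "ga \<Rightarrow> bool" where
  "real_el x \<longleftrightarrow> (\<forall>p. coef x p \<in> \<real>)"

lemma real_el_add: "real_el x \<Longrightarrow> real_el y \<Longrightarrow> real_el (x + y)"
  by (simp add: real_el_def coef_simps)

lemma real_el_cs: "c \<in> \<real> \<Longrightarrow> real_el x \<Longrightarrow> real_el (cs c x)"
  by (simp add: real_el_def coef_simps fscale_def)

lemma real_el_grp: "real_el (grp \<sigma>)"
  by (simp add: real_el_def coef_simps delta_def)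

lemma real_el_1: "real_el 1"
  using real_el_grp[of id] by simp

lemma real_el_sum: "(\<And>i. i \<in> I \<Longrightarrow> real_el (f i)) \<Longrightarrow> real_el (sum f I)"
  using real_el_cs[OF _ real_el_1, of 0]
  by (induction I rule: infinite_finite_induct) (auto intro: real_el_add)

lemma real_el_mult: "real_el x \<Longrightarrow> real_el y \<Longrightarrow> real_el (x * y)"
  unfolding real_el_def coef_simps gmult_def by (auto intro!: sum_in_Reals Reals_mult)

text \<open>The form \<open>(x, y) \<mapsto> \<tau> (x\<^sup>* y)\<close>, where \<open>\<tau>\<close> is the coefficient of the identity, is positive
  definite; on elements that are real and invariant under inversion the square already detects
  vanishing.\<close>

lemma real_symmetric_square_zero:
  assumes x: "x \<in> GA k" "real_el x" "iota x = x" and z: "coef (x * x) id = 0"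
  shows "x = 0"
proof -
  have sq: "coef x p * coef x (inv p) = (coef x p)\<^sup>2" if "p \<in> sym_group k" for p
    using arg_cong[OF x(3), of "\<lambda>z. coef z p"] sym_group_bij[OF that]
    by (simp add: iota.rep_eq power2_eq_square)
  have "0 = (coef x \<star> coef x) id" using z by (simp add: coef_simps)
  also have "\<dots> = (\<Sum>q\<in>sym_group k. \<Sum>r\<in>sym_group k. if q \<circ> r = id then coef x q * coef x r else 0)"
    by (rule gmult_eq_double_sum) (use x(1) in \<open>auto simp: GA_def group_algebra_def\<close>)
  also have "\<dots> = (\<Sum>q\<in>sym_group k. \<Sum>r\<in>sym_group k. if r = inv q then coef x q * coef x r else 0)"
  proof (intro sum.cong refl if_cong)
    fix q r assume "q \<in> sym_group k" "r \<in> sym_group k"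
    then show "q \<circ> r = id \<longleftrightarrow> r = inv q"
      using sym_group_inv_comp[of q k] by (metis comp_assoc comp_id id_comp)
  qed
  also have "\<dots> = (\<Sum>q\<in>sym_group k. (coef x q)\<^sup>2)"
    by (intro sum.cong refl) (simp add: sym_group_inv sq)
  also have "\<dots> = of_real (\<Sum>q\<in>sym_group k. (Re (coef x q))\<^sup>2)"
  proof -
    have "coef x q = of_real (Re (coef x q))" for q
      using x(2) by (metis real_el_def of_real_Re)
    then have "(coef x q)\<^sup>2 = of_real ((Re (coef x q))\<^sup>2)" for q
      by (metis of_real_power)
    then show ?thesis by simp
  qed
  finally have "(\<Sum>q\<in>sym_group k. (Re (coef x q))\<^sup>2) = 0"
    by (metis of_real_eq_0_iff)
  then have "\<forall>q\<in>sym_group k. Re (coef x q) = 0"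
    by (subst (asm) sum_nonneg_eq_0_iff) auto
  then have "coef x q = 0" for q
    using x(1,2) by (metis (mono_tags, lifting) GA_def group_algebra_def mem_Collect_eq
        real_el_def of_real_0 of_real_Re)
  then show ?thesis
    unfolding coef_inject[symmetric] coef_simps by auto
qed

section \<open>Evaluating complex polynomials in the group algebra\<close>

text \<open>The coefficients are scalars and the argument lies in a noncommutative algebra, so
  \<open>poly\<close> does not apply.\<close>

definition peval :: "complex poly \<Rightarrow> ga \<Rightarrow> ga" where
  "peval p x = fold_coeffs (\<lambda>a v. cs a 1 + x * v) p 0"

lemma peval_0 [simp]: "peval 0 x = 0"
  by (simp add: peval_def)

lemma peval_pCons [simp]: "peval (pCons a p) x = cs a 1 + x * peval p x"
  by (cases "p = 0 \<and> a = 0") (auto simp: peval_def)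

lemma peval_1 [simp]: "peval 1 x = 1"
  by (simp add: one_pCons)

lemma peval_add: "peval (p + q) x = peval p x + peval q x"
  by (induction p q rule: poly_induct2) (simp_all add: algebra_simps)

lemma peval_smult: "peval (smult c p) x = cs c (peval p x)"
  by (induction p) (simp_all add: algebra_simps)

lemma peval_mult: "peval (p * q) x = peval p x * peval q x"
  by (induction p) (simp_all add: algebra_simps peval_add peval_smult)

lemma peval_diff: "peval (p - q) x = peval p x - peval q x"
  using peval_add[of p "- q" x] peval_smult[of "-1" q x] by simp

lemma peval_sum: "peval (sum f I) x = (\<Sum>i\<in>I. peval (f i) x)"
  by (induction I rule: infinite_finite_induct) (simp_all add: peval_add)

text \<open>Used with \<open>x = y\<close> for commuting elements, and with different \<open>x\<close> and \<open>y\<close> for the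
  intertwiner.\<close>

lemma peval_intertwine:
  assumes "x * z = z * y"
  shows "peval p x * z = z * peval p y"
proof (induction p)
  case (pCons a p)
  have "x * peval p x * z = z * (y * peval p y)"
    by (simp add: mult.assoc pCons) (simp add: assms mult.assoc[symmetric])
  then show ?case by (simp add: algebra_simps)
qed simp

lemma peval_eigen_left:
  assumes "x * z = cs a z"
  shows "peval p x * z = cs (poly p a) z"
  by (induction p) (simp_all add: algebra_simps assms)

lemma peval_GA [simp]: "x \<in> GA k \<Longrightarrow> peval p x \<in> GA k"
  by (induction p) simp_all

lemma iota_peval:
  assumes "x \<in> GA k"
  shows "iota (peval p x) = peval p (iota x)"
proof (induction p)
  case (pCons a p)
  have "iota (peval p x * x) = iota x * iota (peval p x)"
    using assms by (intro iota_mult[of _ k _ k]) auto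
  moreover have "peval p x * x = x * peval p x"
    by (rule peval_intertwine) simp
  ultimately show ?case by (simp add: iota_add iota_cs pCons)
qed simp

lemma real_el_peval_prod:
  assumes "\<And>i. i \<in> I \<Longrightarrow> real_el (peval (f i) x)"
  shows "real_el (peval (prod f I) x)"
  using assms
  by (induction I rule: infinite_finite_induct) (auto simp: peval_mult real_el_1 intro: real_el_mult)


section \<open>Jucys-Murphy elements\<close>

definition JM :: "nat \<Rightarrow> ga" where
  "JM k = (\<Sum>j\<in>{1..<k}. grp (transpose j k))"

lemma coef_JM: "coef (JM k) = jucys_murphy k"
  by (simp add: JM_def jucys_murphy_def coef_sum coef_simps)

lemma JM_1 [simp]: "JM (Suc 0) = 0"
  by (simp add: JM_def)

lemma JM_in_GA [simp]: "k \<le> m \<Longrightarrow> JM k \<in> GA m"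
  by (auto simp: JM_def intro!: GA_sum GA_grp sym_group_transpose)

lemma real_el_JM: "real_el (JM k)"
  by (auto simp: JM_def intro: real_el_sum real_el_grp)

lemma iota_JM [simp]: "iota (JM k) = JM k"
  by (simp add: JM_def iota_sum iota_grp)

text \<open>Conjugation by a permutation of the first \<open>k\<close> letters permutes the summands of \<open>X\<^bsub>k+1\<^esub>\<close>.\<close>

lemma JM_Suc_commute_grp:
  assumes "\<sigma> \<in> sym_group k"
  shows "JM (Suc k) * grp \<sigma> = grp \<sigma> * JM (Suc k)"
proof -
  have p: "\<sigma> permutes {1..k}" using assms by (simp add: sym_group_def)
  have "transpose (\<sigma> j) (Suc k) \<circ> \<sigma> = \<sigma> \<circ> transpose j (Suc k)" if "j \<in> {1..k}" for j
  proof
    fix i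
    have "\<sigma> (Suc k) = Suc k" by (rule permutes_not_in[OF p]) auto
    moreover have "\<sigma> a = \<sigma> b \<longleftrightarrow> a = b" for a b
      using permutes_inj[OF p] by (auto simp: inj_eq)
    ultimately show "(transpose (\<sigma> j) (Suc k) \<circ> \<sigma>) i = (\<sigma> \<circ> transpose j (Suc k)) i"
      unfolding transpose_def comp_def by metis
  qed
  then have "grp \<sigma> * JM (Suc k) = (\<Sum>j\<in>{1..k}. grp (transpose (\<sigma> j) (Suc k) \<circ> \<sigma>))"
    by (auto simp: JM_def sum_distrib_left grp_mult atLeastLessThanSuc_atLeastAtMost intro!: sum.cong)
  also have "\<dots> = (\<Sum>j\<in>{1..k}. grp (transpose j (Suc k) \<circ> \<sigma>))"
    by (rule sum.reindex_bij_betw[OF permutes_imp_bij[OF p]])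
  also have "\<dots> = JM (Suc k) * grp \<sigma>"
    by (auto simp: JM_def sum_distrib_right grp_mult atLeastLessThanSuc_atLeastAtMost)
  finally show ?thesis ..
qed

lemma JM_Suc_commute:
  assumes "x \<in> GA k"
  shows "JM (Suc k) * x = x * JM (Suc k)"
  using assms by (induction rule: GA_induct) (simp_all add: JM_Suc_commute_grp algebra_simps)

definition adj :: "nat \<Rightarrow> ga" where
  "adj k = grp (transpose k (Suc k))"

lemma adj_in_GA: "k \<ge> 1 \<Longrightarrow> adj k \<in> GA (Suc k)"
  by (auto simp: adj_def intro!: GA_grp sym_group_transpose)

lemma adj_adj [simp]: "adj k * adj k = 1"
  by (simp add: adj_def grp_mult)

lemma adj_commute:
  assumes "x \<in> GA k"
  shows "adj (Suc k) * x = x * adj (Suc k)"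
  using assms
proof (induction rule: GA_induct)
  case (grp \<sigma>)
  have p: "\<sigma> permutes {1..k}" using grp by (simp add: sym_group_def)
  have f: "\<sigma> (Suc k) = Suc k" "\<sigma> (Suc (Suc k)) = Suc (Suc k)"
    by (rule permutes_not_in[OF p]; simp)+
  have "transpose (Suc k) (Suc (Suc k)) \<circ> \<sigma> = \<sigma> \<circ> transpose (Suc k) (Suc (Suc k))"
  proof
    fix i
    show "(transpose (Suc k) (Suc (Suc k)) \<circ> \<sigma>) i = (\<sigma> \<circ> transpose (Suc k) (Suc (Suc k))) i"
      using permutes_inj[OF p] f by (auto simp: transpose_def) (metis inj_eq)+
  qed
  then show ?case by (simp add: adj_def grp_mult)
qed (simp_all add: algebra_simps)

lemma JM_Suc_adj:
  assumes "k \<ge> 1"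
  shows "JM (Suc k) * adj k = adj k * JM k + 1"
proof -
  have "transpose j (Suc k) \<circ> transpose k (Suc k) = transpose k (Suc k) \<circ> transpose j k"
    if "j \<in> {1..<k}" for j
    using that by (auto simp: transpose_def fun_eq_iff)
  moreover have "{1..<Suc k} = insert k {1..<k}" using assms by auto
  ultimately show ?thesis
    by (simp add: JM_def adj_def sum_distrib_left sum_distrib_right distrib_right grp_mult)
qed

text \<open>Every permutation of \<open>k + 1\<close> letters either fixes the last one or is a product of two
  elements of the smaller group around the last adjacent transposition.\<close>

lemma GA_Suc_induct [consumes 2, case_names small mixed add scale]:
  assumes "x \<in> GA (Suc k)" "k \<ge> 1"
    and small: "\<And>x. x \<in> GA k \<Longrightarrow> Q x"
    and mixed: "\<And>x y. x \<in> GA k \<Longrightarrow> y \<in> GA k \<Longrightarrow> Q (x * adj k * y)"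
    and add: "\<And>x y. x \<in> GA (Suc k) \<Longrightarrow> y \<in> GA (Suc k) \<Longrightarrow> Q x \<Longrightarrow> Q y \<Longrightarrow> Q (x + y)"
    and scale: "\<And>c x. x \<in> GA (Suc k) \<Longrightarrow> Q x \<Longrightarrow> Q (cs c x)"
  shows "Q x"
  using assms(1)
proof (induction rule: GA_induct)
  case (grp p)
  have p: "p permutes {1..Suc k}" using grp by (simp add: sym_group_def)
  have shrink: "q \<in> sym_group k" if "q \<in> sym_group (Suc k)" "q (Suc k) = Suc k" for q
    using that permutes_superset[of q "{1..Suc k}" "{1..k}"]
    by (auto simp: sym_group_def le_Suc_eq)
  show ?case
  proof (cases "p (Suc k) = Suc k")
    case True
    then show ?thesis using shrink[OF grp] small by simp
  next
    case False
    define j where "j = p (Suc k)"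
    have "j \<in> {1..Suc k}" using permutes_in_image[OF p, of "Suc k"] by (simp add: j_def)
    with False have j: "j \<in> {1..k}" by (auto simp: j_def)
    define \<sigma> \<tau> where "\<sigma> = transpose j k" and "\<tau> = transpose k (Suc k) \<circ> (\<sigma> \<circ> p)"
    have \<sigma>: "\<sigma> \<in> sym_group k" using j by (auto simp: \<sigma>_def intro!: sym_group_transpose)
    have "\<sigma> \<in> sym_group (Suc k)" using \<sigma> sym_group_mono[of k "Suc k"] by auto
    then have "\<tau> \<in> sym_group (Suc k)"
      unfolding \<tau>_def using grp assms(2) by (intro sym_group_comp sym_group_transpose) auto
    moreover have "\<tau> (Suc k) = Suc k"
      by (simp add: \<tau>_def \<sigma>_def j_def[symmetric])
    ultimately have \<tau>: "\<tau> \<in> sym_group k" by (rule shrink)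
    have "p = \<sigma> \<circ> transpose k (Suc k) \<circ> \<tau>"
      by (simp add: \<tau>_def \<sigma>_def fun_eq_iff)
    then have "grp p = grp \<sigma> * adj k * grp \<tau>"
      by (simp add: adj_def grp_mult)
    then show ?thesis using mixed[of "grp \<sigma>" "grp \<tau>"] \<sigma> \<tau> by simp
  qed
qed (use add scale in auto)

lemma trunc_JM_Suc: "trunc k (JM (Suc k)) = 0"
proof -
  have "transpose j (Suc k) \<notin> sym_group k" if "j \<in> {1..<Suc k}" for j
  proof
    assume "transpose j (Suc k) \<in> sym_group k"
    then have "transpose j (Suc k) (Suc k) = Suc k"
      by (intro permutes_not_in[of _ "{1..k}"]) (simp_all add: sym_group_def)
    then show False using that by simp
  qed
  then show ?thesis unfolding JM_def trunc_sum trunc_grp by (intro sum.neutral ballI) meson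
qed

text \<open>If \<open>\<sigma>\<close> fixes its last letter, conjugation with the next adjacent transposition does nothing;
  otherwise the conjugate moves \<open>k + 2\<close> and is truncated to zero.\<close>

lemma trunc_adj_conj:
  assumes "x \<in> GA (Suc k)"
  shows "trunc (Suc k) (adj (Suc k) * x * adj (Suc k)) = trunc k x"
  using assms
proof (induction rule: GA_induct)
  case (grp \<sigma>)
  let ?t = "transpose (Suc k) (Suc (Suc k))"
  have p: "\<sigma> permutes {1..Suc k}" using grp by (simp add: sym_group_def)
  have f: "\<sigma> (Suc (Suc k)) = Suc (Suc k)"
    by (rule permutes_not_in[OF p]) auto
  have e: "adj (Suc k) * grp \<sigma> * adj (Suc k) = grp (?t \<circ> \<sigma> \<circ> ?t)"
    by (simp add: adj_def grp_mult)
  show ?case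
  proof (cases "\<sigma> \<in> sym_group k")
    case True
    then have "adj (Suc k) * grp \<sigma> * adj (Suc k) = grp \<sigma>"
      using adj_commute[of "grp \<sigma>" k] by (simp add: mult.assoc)
    then show ?thesis using True grp by (simp add: trunc_grp)
  next
    case False
    have "?t \<circ> \<sigma> \<circ> ?t \<notin> sym_group (Suc k)"
    proof
      assume "?t \<circ> \<sigma> \<circ> ?t \<in> sym_group (Suc k)"
      then have "?t \<circ> \<sigma> \<circ> ?t permutes {1..Suc k}"
        by (simp only: sym_group_def mem_Collect_eq)
      then have "(?t \<circ> \<sigma> \<circ> ?t) (Suc (Suc k)) = Suc (Suc k)"
        by (rule permutes_not_in) simp
      then have "?t (\<sigma> (Suc k)) = ?t (Suc k)" by simp
      then have "\<sigma> (Suc k) = Suc k"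
        by (metis transpose_involutory)
      then have "\<sigma> \<in> sym_group k"
        using p permutes_superset[of \<sigma> "{1..Suc k}" "{1..k}"]
        by (auto simp: sym_group_def le_Suc_eq)
      with False show False ..
    qed
    then show ?thesis using False by (simp add: e trunc_grp)
  qed
qed (simp_all add: algebra_simps trunc_add trunc_cs)


section \<open>The intertwiner\<close>

text \<open>The calculation takes place in the degenerate affine Hecke algebra on two strands: \<open>f\<close> exchanges
  the commuting elements \<open>x\<close> and \<open>y\<close>, and its square measures when this exchange is invertible.\<close>

lemma intertwiner_relations:
  fixes s x y :: "'a :: ring_1"
  assumes ss: "s * s = 1" and xs: "x * s = s * y + 1" and xy: "x * y = y * x"
  defines "f \<equiv> y * s - s * y"
  shows intertwiner_left: "f = 1 - (x - y) * s"
    and intertwiner_y: "x * f = f * y"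
    and intertwiner_x: "f * x = y * f"
    and intertwiner_square: "f * f = 1 - (x - y) * (x - y)"
proof -
  have "s * x = s * (x * s) * s" by (simp add: mult.assoc ss)
  also have "\<dots> = s * s * y * s + s * s" by (simp add: xs algebra_simps)
  finally have sx: "s * x = y * s + 1" by (simp add: ss)
  show left: "f = 1 - (x - y) * s"
    by (simp add: f_def xs algebra_simps)
  have right: "f = s * (x - y) - 1"
    by (simp add: f_def sx algebra_simps)
  have "x * f = x * s * (x - y) - x" by (simp add: right algebra_simps)
  also have "\<dots> = s * (y * x) - s * y * y - y" by (simp add: xs algebra_simps)
  also have "\<dots> = f * y" by (simp add: right xy[symmetric] algebra_simps)
  finally show "x * f = f * y" .
  have "y * f = y * s * (x - y) - y" by (simp add: right algebra_simps)
  also have "\<dots> = (s * x - 1) * (x - y) - y" by (simp add: sx)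
  also have "\<dots> = f * x" by (simp add: right algebra_simps xy)
  finally show "f * x = y * f" ..
  have "f * f = (1 - (x - y) * s) * (s * (x - y) - 1)"
    by (metis left right)
  also have "\<dots> = s * (x - y) - 1 - (x - y) * (s * s) * (x - y) + (x - y) * s"
    by (simp add: algebra_simps)
  also have "s * (x - y) = 2 - (x - y) * s"
    using left right by (simp add: algebra_simps)
  finally show "f * f = 1 - (x - y) * (x - y)" by (simp add: ss)
qed

definition phi :: "nat \<Rightarrow> ga" where
  "phi k = JM k * adj k - adj k * JM k"

lemma phi_relations:
  assumes "k \<ge> 1"
  shows phi_left: "phi k = 1 - (JM (Suc k) - JM k) * adj k"
    and phi_JM: "JM (Suc k) * phi k = phi k * JM k"
    and phi_JM_Suc: "phi k * JM (Suc k) = JM k * phi k"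
    and phi_phi: "phi k * phi k = 1 - (JM (Suc k) - JM k) * (JM (Suc k) - JM k)"
  using intertwiner_relations[of "adj k" "JM (Suc k)" "JM k"] JM_Suc_commute[of "JM k" k] assms
  by (simp_all add: JM_Suc_adj phi_def)

lemma phi_in_GA: "k \<ge> 1 \<Longrightarrow> phi k \<in> GA (Suc k)"
  by (simp add: phi_def adj_in_GA)


section \<open>Diagrams and their corners\<close>

definition is_diagram :: "(nat \<times> nat) set \<Rightarrow> bool" where
  "is_diagram D \<longleftrightarrow> finite D \<and> (\<forall>r c r' c'. (r, c) \<in> D \<and> r' \<le> r \<and> c' \<le> c \<longrightarrow> (r', c') \<in> D)"

definition addable :: "(nat \<times> nat) set \<Rightarrow> (nat \<times> nat) set" where
  "addable D = {b. b \<notin> D \<and> is_diagram (insert b D)}"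

definition removable :: "(nat \<times> nat) set \<Rightarrow> (nat \<times> nat) set" where
  "removable D = {b \<in> D. is_diagram (D - {b})}"

lemma is_diagram_empty [simp]: "is_diagram {}"
  by (simp add: is_diagram_def)

lemma is_diagramD: "is_diagram D \<Longrightarrow> (r, c) \<in> D \<Longrightarrow> r' \<le> r \<Longrightarrow> c' \<le> c \<Longrightarrow> (r', c') \<in> D"
  unfolding is_diagram_def by blast

lemma addable_iff:
  assumes D: "is_diagram D"
  shows "(r, c) \<in> addable D \<longleftrightarrow> (r, c) \<notin> D \<and> (\<forall>r'<r. (r', c) \<in> D) \<and> (\<forall>c'<c. (r, c') \<in> D)"
    (is "?A \<longleftrightarrow> ?B")
proof
  assume A: ?A
  then have "is_diagram (insert (r, c) D)" "(r, c) \<notin> D" by (auto simp: addable_def)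
  moreover from is_diagramD[OF this(1), of r c] have "(r', c') \<in> insert (r, c) D"
    if "r' \<le> r" "c' \<le> c" for r' c' using that by blast
  ultimately show ?B by (metis insertE order_refl less_imp_le less_irrefl prod.inject)
next
  assume B: ?B
  have "is_diagram (insert (r, c) D)"
    unfolding is_diagram_def
  proof (intro conjI allI impI)
    show "finite (insert (r, c) D)" using D by (simp add: is_diagram_def)
    fix r1 c1 r' c' assume h: "(r1, c1) \<in> insert (r, c) D \<and> r' \<le> r1 \<and> c' \<le> c1"
    show "(r', c') \<in> insert (r, c) D"
    proof (cases "(r1, c1) = (r, c)")
      case True
      then show ?thesis using h B is_diagramD[OF D, of r' c r' c'] is_diagramD[OF D, of r c' r' c']
        by (metis Pair_inject insertCI le_neq_implies_less order_refl)
    next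
      case False
      then show ?thesis using h is_diagramD[OF D] by blast
    qed
  qed
  with B show ?A by (simp add: addable_def)
qed

lemma removable_iff:
  assumes D: "is_diagram D"
  shows "(r, c) \<in> removable D \<longleftrightarrow> (r, c) \<in> D \<and> (Suc r, c) \<notin> D \<and> (r, Suc c) \<notin> D"
    (is "?A \<longleftrightarrow> ?B")
proof
  assume A: ?A
  then have d: "is_diagram (D - {(r, c)})" and "(r, c) \<in> D" by (auto simp: removable_def)
  moreover have "(Suc r, c) \<notin> D"
    using is_diagramD[OF d, of "Suc r" c r c] by auto
  moreover have "(r, Suc c) \<notin> D"
    using is_diagramD[OF d, of r "Suc c" r c] by auto
  ultimately show ?B by blast
next
  assume B: ?B
  have "is_diagram (D - {(r, c)})"
    unfolding is_diagram_def
  proof (intro conjI allI impI)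
    show "finite (D - {(r, c)})" using D by (simp add: is_diagram_def)
    fix r1 c1 r' c' assume h: "(r1, c1) \<in> D - {(r, c)} \<and> r' \<le> r1 \<and> c' \<le> c1"
    have "(r', c') \<noteq> (r, c)"
    proof
      assume e: "(r', c') = (r, c)"
      with h have "Suc r \<le> r1 \<or> Suc c \<le> c1" by auto
      then show False
        using h e B is_diagramD[OF D, of r1 c1 "Suc r" c] is_diagramD[OF D, of r1 c1 r "Suc c"] by auto
    qed
    then show "(r', c') \<in> D - {(r, c)}" using h is_diagramD[OF D] by blast
  qed
  with B show ?A by (simp add: removable_def)
qed

lemma is_diagram_insert: "b \<in> addable D \<Longrightarrow> is_diagram (insert b D)"
  by (simp add: addable_def)

lemma finite_addable: "is_diagram D \<Longrightarrow> finite (addable D)"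
proof (rule finite_subset)
  assume D: "is_diagram D"
  show "addable D \<subseteq> {(0, 0)} \<union> (\<lambda>(r, c). (Suc r, c)) ` D \<union> (\<lambda>(r, c). (r, Suc c)) ` D"
  proof
    fix b assume "b \<in> addable D"
    moreover obtain r c where "b = (r, c)" by force
    ultimately have "b = (0, 0) \<or> (\<exists>r'. b = (Suc r', c) \<and> (r', c) \<in> D) \<or> (\<exists>c'. b = (r, Suc c') \<and> (r, c') \<in> D)"
      using addable_iff[OF D, of r c] by (cases r; cases c) auto
    then show "b \<in> {(0, 0)} \<union> (\<lambda>(r, c). (Suc r, c)) ` D \<union> (\<lambda>(r, c). (r, Suc c)) ` D"
      by force
  qed
  show "finite ({(0, 0)} \<union> (\<lambda>(r, c). (Suc r, c)) ` D \<union> (\<lambda>(r, c). (r, Suc c)) ` D)"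
    using D by (simp add: is_diagram_def)
qed

text \<open>Of two addable boxes the lower one lies strictly further to the left.\<close>

lemma addable_content_gap:
  assumes D: "is_diagram D" and b: "b \<in> addable D" "b' \<in> addable D" "b \<noteq> b'"
  shows "\<bar>content b - content b'\<bar> \<ge> 2"
proof -
  have *: "content b - content b' \<ge> 2"
    if h: "b \<in> addable D" "b' \<in> addable D" "b \<noteq> b'" "fst b \<le> fst b'" for b b'
  proof -
    obtain r c r' c' where e: "b = (r, c)" "b' = (r', c')" by force
    have "r \<noteq> r'"
      using h by (auto simp: e addable_iff[OF D]) (metis nat_neq_iff)
    then have "r < r'" using h e by simp
    then have "(r, c') \<in> D" "(r, c) \<notin> D" using h by (auto simp: e addable_iff[OF D])
    then have "c' < c" using is_diagramD[OF D, of r c' r c] by (meson not_less order_refl)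
    then show ?thesis using \<open>r < r'\<close> by (simp add: e content_def)
  qed
  show ?thesis
    using *[of b b'] *[of b' b] b by (cases "fst b \<le> fst b'") auto
qed

lemma content_inj_addable: "is_diagram D \<Longrightarrow> inj_on content (addable D)"
  using addable_content_gap by (fastforce intro: inj_onI)

text \<open>A removable box on the diagonal of an addable one would have a neighbour that belongs to the
  diagram.\<close>

lemma content_addable_removable:
  assumes D: "is_diagram D" and b: "b \<in> addable D" "b' \<in> removable D"
  shows "content b \<noteq> content b'"
proof
  assume eq: "content b = content b'"
  obtain r c r' c' where e: "b = (r, c)" "b' = (r', c')" by force
  have i: "int c - int r = int c' - int r'" using eq by (simp add: e content_def)
  show False
  proof (cases "r \<le> r'")
    case True
    then have "c \<le> c'" using i by linarith
    then show ?thesis using b True is_diagramD[OF D, of r' c' r c]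
      by (auto simp: e addable_iff[OF D] removable_iff[OF D])
  next
    case False
    then have "r' < r" "c' < c" using i by linarith+
    then have "(r', c) \<in> D" using b by (auto simp: e addable_iff[OF D])
    then have "(r', Suc c') \<in> D" using \<open>c' < c\<close> is_diagramD[OF D, of r' c r' "Suc c'"] by simp
    then show ?thesis using b by (auto simp: e removable_iff[OF D])
  qed
qed

lemma addable_removable_insert:
  assumes "b \<in> addable D" "is_diagram D"
  shows "b \<in> removable (insert b D)"
  using assms by (auto simp: removable_def addable_def)

lemma addable_insert_keep:
  assumes D: "is_diagram D" and b: "b \<in> addable D" "b' \<in> addable D" "b \<noteq> b'"
  shows "b' \<in> addable (insert b D)"
  using b addable_iff[OF D] addable_iff[OF is_diagram_insert[OF b(1)]]
  by (cases b') auto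


section \<open>The corner polynomials\<close>

definition lin :: "nat \<times> nat \<Rightarrow> complex poly" where
  "lin b = [:- of_int (content b), 1:]"

definition add_poly :: "(nat \<times> nat) set \<Rightarrow> complex poly" where
  "add_poly D = prod lin (addable D)"

definition rem_poly :: "(nat \<times> nat) set \<Rightarrow> complex poly" where
  "rem_poly D = prod lin (removable D)"

lemma finite_removable: "is_diagram D \<Longrightarrow> finite (removable D)"
  by (simp add: removable_def is_diagram_def)

lemma lead_coeff_lin [simp]: "lead_coeff (lin b) = 1"
  by (simp add: lin_def)

lemma monic_prod_lin: "lead_coeff (prod lin B) = 1"
  by (induction B rule: infinite_finite_induct) (simp_all add: lead_coeff_mult)

lemma add_poly_monic: "lead_coeff (add_poly D) = 1" and rem_poly_monic: "lead_coeff (rem_poly D) = 1"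
  by (simp_all add: add_poly_def rem_poly_def monic_prod_lin)

lemma add_poly_nz [simp]: "add_poly D \<noteq> 0" and rem_poly_nz [simp]: "rem_poly D \<noteq> 0"
  using add_poly_monic[of D] rem_poly_monic[of D] by auto

lemma poly_lin: "poly (lin b) (of_int (content b')) = 0 \<longleftrightarrow> content b' = content b"
  by (simp add: lin_def)

text \<open>Adding the box \<open>b\<close> makes the box to its right addable unless the box above it was a
  removable corner, which then stops being one; both have the content of \<open>b\<close> plus one. Likewise
  below and to the left.\<close>

lemma corner_poly_insert:
  assumes D: "is_diagram D" and b: "b \<in> addable D"
  defines "a \<equiv> of_int (content b)"
  shows "rem_poly (insert b D) * add_poly D * ([:- (a + 1), 1:] * [:- (a - 1), 1:])
      = rem_poly D * add_poly (insert b D) * (lin b * lin b)"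
proof -
  obtain r c where e: "b = (r, c)" by force
  note D' = is_diagram_insert[OF b, unfolded e]
  \<comment> \<open>the boxes to the right and below that become addable, and the boxes above and to the left
    that cease to be removable\<close>
  define R where "R = (if r = 0 \<or> (r - 1, Suc c) \<in> D then {(r, Suc c)} else {})"
  define B where "B = (if c = 0 \<or> (Suc r, c - 1) \<in> D then {(Suc r, c)} else {})"
  define U where "U = (if r = 0 \<or> (r - 1, Suc c) \<in> D then {} else {(r - 1, c)})"
  define L where "L = (if c = 0 \<or> (Suc r, c - 1) \<in> D then {} else {(r, c - 1)})"
  have nb: "b \<notin> D" using b by (simp add: addable_def)
  have up: "r' < r \<Longrightarrow> (r', c) \<in> D" and left: "c' < c \<Longrightarrow> (r, c') \<in> D" for r' c'
    using b by (auto simp: e addable_iff[OF D])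
  have nR: "(r1, c1) \<notin> D" if "r1 \<ge> r" "c1 \<ge> c" for r1 c1
    using that nb is_diagramD[OF D, of r1 c1 r c] by (auto simp: e)
  have add: "insert b (addable (insert b D)) = addable D \<union> R \<union> B" (is "?l = ?r")
  proof (intro equalityI subsetI)
    fix x assume x: "x \<in> ?l"
    obtain r1 c1 where x1: "x = (r1, c1)" by force
    show "x \<in> ?r"
    proof (cases "x = b")
      case False
      then have x2: "(r1, c1) \<notin> D" "(r1, c1) \<noteq> (r, c)" "\<And>r'. r' < r1 \<Longrightarrow> (r', c1) = (r, c) \<or> (r', c1) \<in> D"
        "\<And>c'. c' < c1 \<Longrightarrow> (r1, c') = (r, c) \<or> (r1, c') \<in> D"
        using x by (auto simp: x1 addable_iff[OF D'] e)
      show ?thesis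
      proof (cases "r1 = r \<and> c < c1")
        case True
        then have "c1 = Suc c"
          using x2(4)[of "Suc c"] nR[of r "Suc c"] by (cases "Suc c < c1") auto
        moreover have "r = 0 \<or> (r - 1, Suc c) \<in> D"
          using x2(3)[of "r - 1"] True \<open>c1 = Suc c\<close> by (cases r) auto
        ultimately show ?thesis using True by (simp add: R_def x1)
      next
        case nr: False
        show ?thesis
        proof (cases "c1 = c \<and> r < r1")
          case True
          then have "r1 = Suc r"
            using x2(3)[of "Suc r"] nR[of "Suc r" c] by (cases "Suc r < r1") auto
          moreover have "c = 0 \<or> (Suc r, c - 1) \<in> D"
            using x2(4)[of "c - 1"] True \<open>r1 = Suc r\<close> by (cases c) auto
          ultimately show ?thesis using True by (simp add: B_def x1)
        next
          case False
          then show ?thesis using nr x2 by (auto simp: x1 addable_iff[OF D])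
        qed
      qed
    qed (use b in auto)
  next
    fix x assume x: "x \<in> ?r"
    show "x \<in> ?l"
    proof (cases "x \<in> addable D")
      case True then show ?thesis using addable_insert_keep[OF D b True] by (cases "x = b") auto
    next
      case False
      have 1: "(r, Suc c) \<in> addable (insert b D)" if h: "r = 0 \<or> (r - 1, Suc c) \<in> D"
        unfolding e addable_iff[OF D'] using nR[of r "Suc c"] h left
          is_diagramD[OF D, of "r - 1" "Suc c"] by (auto simp: e less_Suc_eq)
      have 2: "(Suc r, c) \<in> addable (insert b D)" if h: "c = 0 \<or> (Suc r, c - 1) \<in> D"
        unfolding e addable_iff[OF D'] using nR[of "Suc r" c] h up
          is_diagramD[OF D, of "Suc r" "c - 1"] by (auto simp: e less_Suc_eq)
      show ?thesis using x False 1 2 by (auto simp: R_def B_def split: if_splits)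
    qed
  qed
  have rem: "removable (insert b D) \<union> U \<union> L = insert b (removable D)" (is "?l = ?r")
  proof (intro equalityI subsetI)
    fix x assume x: "x \<in> ?l"
    obtain r1 c1 where x1: "x = (r1, c1)" by force
    have 1: "(r - 1, c) \<in> removable D" if h: "\<not> (r = 0 \<or> (r - 1, Suc c) \<in> D)"
      using h up[of "r - 1"] nR[of r c] by (auto simp: removable_iff[OF D])
    have 2: "(r, c - 1) \<in> removable D" if h: "\<not> (c = 0 \<or> (Suc r, c - 1) \<in> D)"
      using h left[of "c - 1"] nR[of r c] by (auto simp: removable_iff[OF D])
    show "x \<in> ?r"
      using x 1 2 by (auto simp: U_def L_def x1 removable_iff[OF D'] removable_iff[OF D] e split: if_splits)
  next
    fix x assume x: "x \<in> ?r"
    obtain r1 c1 where x1: "x = (r1, c1)" by force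
    show "x \<in> ?l"
    proof (cases "x = b")
      case True then show ?thesis using addable_removable_insert[OF b D] by simp
    next
      case False
      then have x2: "(r1, c1) \<in> D" "(Suc r1, c1) \<notin> D" "(r1, Suc c1) \<notin> D"
        using x by (auto simp: x1 removable_iff[OF D])
      show ?thesis
      proof (cases "(Suc r1, c1) = (r, c) \<or> (r1, Suc c1) = (r, c)")
        case True then show ?thesis using x2 by (auto simp: x1 U_def L_def)
      next
        case False then show ?thesis using x2 by (auto simp: x1 removable_iff[OF D'] e)
      qed
    qed
  qed
  have fin: "finite (addable D)" "finite (addable (insert b D))" "finite (removable D)"
    "finite (removable (insert b D))" "finite R" "finite B" "finite U" "finite L"
    using D D' by (auto simp: e finite_addable finite_removable R_def B_def U_def L_def)
  have dis: "addable D \<inter> R = {}" "(addable D \<union> R) \<inter> B = {}" "b \<notin> addable (insert b D)"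
    "removable (insert b D) \<inter> U = {}" "(removable (insert b D) \<union> U) \<inter> L = {}" "b \<notin> removable D"
    using nb up left by (auto simp: R_def B_def U_def L_def addable_iff[OF D] addable_iff[OF D']
        removable_iff[OF D] removable_iff[OF D'] e split: if_splits)
  have "lin b * add_poly (insert b D) = add_poly D * prod lin R * prod lin B"
    unfolding add_poly_def using add fin dis
    by (metis (no_types, lifting) prod.insert prod.union_disjoint finite_UnI)
  moreover have "rem_poly (insert b D) * prod lin U * prod lin L = lin b * rem_poly D"
    unfolding rem_poly_def using rem fin dis
    by (metis (no_types, lifting) prod.insert prod.union_disjoint finite_UnI)
  moreover have "prod lin R * prod lin U = [:- (a + 1), 1:]"
    by (auto simp: R_def U_def lin_def content_def a_def e)
  moreover have "prod lin B * prod lin L = [:- (a - 1), 1:]"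
    by (auto simp: B_def L_def lin_def content_def a_def e)
  ultimately show ?thesis
    by (smt (verit, ccfv_SIG) mult.assoc mult.commute)
qed


section \<open>Residues of rational functions at infinity\<close>

text \<open>The coefficient of \<open>1/z\<close> in the expansion of \<open>q(z) N(z) / D(z)\<close> at infinity, for monic \<open>D\<close>: the
  polynomial part of the quotient does not contribute. Working with the remainder avoids partial
  fractions, and only the quotient \<open>N / D\<close> matters (\<open>res_cross\<close>).\<close>

definition res :: "complex poly \<Rightarrow> complex poly \<Rightarrow> complex poly \<Rightarrow> complex" where
  "res N D q = coeff ((q * N) mod D) (degree D - 1)"

lemma res_add: "res N D (p + q) = res N D p + res N D q"
  by (simp add: res_def distrib_right poly_mod_add_left)

lemma res_smult: "res N D (smult c q) = c * res N D q"
  by (simp add: res_def mod_smult_left)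

lemma res_move: "res N D (u * q) = res (u * N) D q"
  by (simp add: res_def mult_ac)

lemma res_multiple: "res N D (D * q) = 0"
  by (simp add: res_def mult.assoc)

lemma res_cancel:
  assumes g: "lead_coeff g = 1" and D: "degree D \<ge> 1"
  shows "res (g * N) (g * D) q = res N D q"
proof -
  define r where "r = (q * N) mod D"
  have nz: "g \<noteq> 0" "D \<noteq> 0" using g D by auto
  have "r = 0 \<or> degree r < degree D" unfolding r_def using degree_mod_less nz by blast
  with D have r: "degree r \<le> degree D - 1" by auto
  have "(q * (g * N)) mod (g * D) = g * r"
    unfolding r_def mult_mod_right by (simp only: mult.left_commute)
  moreover have "degree (g * D) - 1 = degree g + (degree D - 1)"
    using D nz by (simp add: degree_mult_eq)
  moreover have "coeff (g * r) (degree g + (degree D - 1)) = coeff r (degree D - 1)"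
  proof (cases "degree r = degree D - 1")
    case True
    then show ?thesis using g coeff_mult_degree_sum[of g r] by simp
  next
    case False
    then have "degree r < degree D - 1" using r by simp
    then show ?thesis
      by (simp add: coeff_eq_0 le_less_trans[OF degree_mult_le])
  qed
  ultimately show ?thesis by (simp add: res_def r_def)
qed

lemma res_cross:
  assumes "N1 * D2 = N2 * D1" "lead_coeff D1 = 1" "lead_coeff D2 = 1" "degree D1 \<ge> 1" "degree D2 \<ge> 1"
  shows "res N1 D1 q = res N2 D2 q"
  using res_cancel[of D2 D1 N1 q] res_cancel[of D1 D2 N2 q] assms by (simp add: mult_ac)

lemma res_one:
  assumes "lead_coeff N = 1" "degree D = Suc (degree N)"
  shows "res N D 1 = 1"
  using assms by (simp add: res_def mod_poly_less)

lemma mod_monic_degree_eq: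
  fixes p D :: "complex poly"
  assumes "lead_coeff p = 1" "lead_coeff D = 1" "degree p = degree D" "degree D \<ge> 1"
  shows "p mod D = p - D" "degree (p - D) < degree D"
proof -
  show d: "degree (p - D) < degree D"
  proof (rule ccontr)
    assume "\<not> degree (p - D) < degree D"
    moreover have "degree (p - D) \<le> degree D"
      using assms(3) by (intro degree_diff_le) simp_all
    ultimately have e: "degree (p - D) = degree D" by simp
    then have "lead_coeff (p - D) = 0" using assms(1,2,3) unfolding e coeff_diff by simp
    then have "p - D = 0" by (simp only: leading_coeff_0_iff)
    then show False using e assms(4) by simp
  qed
  have "p mod D = ((p - D) + D) mod D" by simp
  also have "\<dots> = (p - D) mod D" by (rule mod_add_self2)
  also have "\<dots> = p - D" by (rule mod_poly_less[OF d])
  finally show "p mod D = p - D" .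
qed

text \<open>If \<open>N/D = 1/z + m/z\<^sup>2 + \<dots>\<close>, then \<open>m\<close> is the residue of \<open>z N/D\<close>. The factor \<open>v/(v - 1)\<close> is
  \<open>1 + O(1/z\<^sup>2)\<close> and does not change it.\<close>

lemma res_X_step:
  fixes N D v :: "complex poly"
  assumes N: "lead_coeff N = 1" and D: "lead_coeff D = 1" and deg: "degree D = Suc (degree N)"
    and v: "lead_coeff v = 1" "lead_coeff (v - 1) = 1" "degree v = 2" "degree (v - 1) = 2"
  shows "res (N * v) (D * (v - 1)) [:0, 1:] = res N D [:0, 1:]"
proof -
  let ?X = "[:0, 1:] :: complex poly"
  have nz: "N \<noteq> 0" "D \<noteq> 0" "v \<noteq> 0" "v - 1 \<noteq> 0" using N D v by auto
  define r where "r = ?X * N - D"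
  have "lead_coeff (?X * N) = 1" "degree (?X * N) = degree D"
    using N deg nz by (simp_all add: mult_pCons_left)
  from mod_monic_degree_eq[OF this(1) D this(2)] deg
  have r: "?X * N mod D = r" "degree r < degree D" by (auto simp: r_def)
  have lm: "lead_coeff (?X * (N * v)) = 1" "lead_coeff (D * (v - 1)) = 1"
    using N D v by (simp_all only: lead_coeff_mult lead_coeff_pCons) (simp_all)
  have dm: "degree (?X * (N * v)) = degree (D * (v - 1))" "degree (D * (v - 1)) = degree D + 2"
    using nz v deg by (simp_all add: degree_mult_eq)
  have "?X * (N * v) mod (D * (v - 1)) = ?X * (N * v) - D * (v - 1)"
    by (rule mod_monic_degree_eq(1)[OF lm dm(1)]) (simp add: dm(2))
  also have "\<dots> = v * r + D" by (simp add: r_def algebra_simps)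
  finally have "res (N * v) (D * (v - 1)) ?X = coeff (v * r + D) (degree D + 1)"
    by (simp add: res_def dm(2))
  also have "\<dots> = coeff (v * r) (2 + (degree D - 1))"
    using deg by (simp add: coeff_eq_0)
  also have "\<dots> = coeff r (degree D - 1)"
  proof (cases "degree r = degree D - 1")
    case True
    then show ?thesis using coeff_mult_degree_sum[of v r] v by simp
  next
    case False
    with r(2) have "degree r < degree D - 1" by simp
    then have "degree (v * r) < 2 + (degree D - 1)"
      using degree_mult_le[of v r] v(3) by simp
    with \<open>degree r < degree D - 1\<close> show ?thesis by (simp add: coeff_eq_0)
  qed
  finally show ?thesis by (simp only: res_def r(1))
qed


section \<open>Paths of diagrams\<close>

text \<open>The last box comes first, so that the tail of a path is the path to the previous diagram.\<close>

fun is_path :: "(nat \<times> nat) list \<Rightarrow> bool" where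
  "is_path [] \<longleftrightarrow> True"
| "is_path (b # T) \<longleftrightarrow> is_path T \<and> b \<in> addable (set T)"

lemma is_path_diagram: "is_path T \<Longrightarrow> is_diagram (set T)"
  by (induction T) (simp_all add: is_diagram_insert)

text \<open>The moment functional of the transition measure of the diagram: the rational function with
  zeros at the removable and poles at the addable contents is its Cauchy transform.\<close>

definition path_res :: "(nat \<times> nat) list \<Rightarrow> complex poly \<Rightarrow> complex" where
  "path_res T = res (rem_poly (set T)) (add_poly (set T))"

lemma addable_empty: "addable {} = {(0, 0)}"
proof -
  have "b \<in> addable {} \<longleftrightarrow> b = (0, 0)" for b
    by (cases b) (auto simp: addable_iff)
  then show ?thesis by blast
qed

lemma add_poly_empty: "add_poly {} = [:0, 1:]"
  by (simp add: add_poly_def addable_empty lin_def content_def)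

lemma rem_poly_empty: "rem_poly {} = 1"
  by (simp add: rem_poly_def removable_def)

lemma path_res_Nil: "path_res [] q = poly q 0"
proof -
  obtain a q' where "q = pCons a q'" by (cases q)
  then have "q = q' * [:0, 1:] + [:a:]" "poly q 0 = a" by simp_all
  then have "q mod [:0, 1:] = [:poly q 0:]"
    by (simp only: mod_mult_self3) (simp add: mod_poly_less)
  then show ?thesis by (simp add: path_res_def res_def rem_poly_empty add_poly_empty)
qed

definition quad :: "complex \<Rightarrow> complex poly" where
  "quad a = [:- a, 1:] * [:- a, 1:]"

lemma quad_minus_1: "quad a - 1 = [:- (a + 1), 1:] * [:- (a - 1), 1:]"
  by (simp add: quad_def one_pCons algebra_simps)

lemma quad_monic: "lead_coeff (quad a) = 1" "lead_coeff (quad a - 1) = 1"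
    "degree (quad a) = 2" "degree (quad a - 1) = 2"
  by (simp_all add: quad_def one_pCons)

lemma corner_poly_path:
  assumes "is_path (b # T)"
  defines "a \<equiv> of_int (content b)"
  shows "rem_poly (set (b # T)) * (add_poly (set T) * (quad a - 1))
      = (rem_poly (set T) * quad a) * add_poly (set (b # T))"
proof -
  have "rem_poly (insert b (set T)) * add_poly (set T) * ([:- (a + 1), 1:] * [:- (a - 1), 1:])
      = rem_poly (set T) * add_poly (insert b (set T)) * (lin b * lin b)"
    using corner_poly_insert[OF is_path_diagram[of T], of b] assms(1) unfolding a_def by simp
  then show ?thesis
    by (unfold quad_minus_1, unfold quad_def lin_def a_def list.set) (simp only: mult_ac)
qed

lemma degree_add_poly:
  assumes "is_path T"
  shows "degree (add_poly (set T)) = Suc (degree (rem_poly (set T)))"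
  using assms
proof (induction T)
  case Nil
  show ?case by (simp add: add_poly_empty rem_poly_empty)
next
  case (Cons b T)
  let ?a = "of_int (content b) :: complex"
  have nz: "quad ?a \<noteq> 0" "quad ?a - 1 \<noteq> 0" using quad_monic[of ?a] by auto
  have "degree (rem_poly (set (b # T)) * (add_poly (set T) * (quad ?a - 1)))
      = degree ((rem_poly (set T) * quad ?a) * add_poly (set (b # T)))"
    using corner_poly_path[OF Cons.prems] by simp
  then show ?case
    using Cons nz by (simp add: degree_mult_eq quad_monic del: list.set)
qed

lemma path_res_1: "is_path T \<Longrightarrow> path_res T 1 = 1"
  unfolding path_res_def by (intro res_one degree_add_poly rem_poly_monic)

lemma path_res_linear: "path_res T (p + q) = path_res T p + path_res T q"
    "path_res T (smult c q) = c * path_res T q"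
  by (simp_all add: path_res_def res_add res_smult)

text \<open>Adding a box of content \<open>a\<close> multiplies the rational function by
  \<open>(z - a)\<^sup>2 / ((z - a)\<^sup>2 - 1)\<close>.\<close>

lemma path_res_Cons:
  assumes "is_path (b # T)"
  shows "path_res (b # T) q = res (rem_poly (set T) * quad (of_int (content b)))
    (add_poly (set T) * (quad (of_int (content b)) - 1)) q"
proof -
  let ?a = "of_int (content b) :: complex"
  have nz: "quad ?a - 1 \<noteq> 0" using quad_monic[of ?a] by auto
  show ?thesis unfolding path_res_def
  proof (rule res_cross[OF corner_poly_path[OF assms]])
    show "lead_coeff (add_poly (set T) * (quad ?a - 1)) = 1"
      by (simp only: lead_coeff_mult add_poly_monic quad_monic(2) mult_1)
    show "degree (add_poly (set T) * (quad ?a - 1)) \<ge> 1"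
      using nz by (simp add: degree_mult_eq quad_monic)
    show "lead_coeff (add_poly (set (b # T))) = 1" by (rule add_poly_monic)
    show "degree (add_poly (set (b # T))) \<ge> 1" using degree_add_poly[OF assms] by simp
  qed
qed

lemma path_res_quad:
  assumes "is_path (b # T)"
  shows "path_res (b # T) ((quad (of_int (content b)) - 1) * q) = path_res T (quad (of_int (content b)) * q)"
proof -
  let ?a = "of_int (content b) :: complex"
  have "path_res (b # T) ((quad ?a - 1) * q)
      = res ((quad ?a - 1) * (rem_poly (set T) * quad ?a)) ((quad ?a - 1) * add_poly (set T)) q"
    by (subst path_res_Cons[OF assms], subst res_move) (simp only: mult.commute)
  also have "\<dots> = res (quad ?a * rem_poly (set T)) (add_poly (set T)) q"
    using assms quad_monic(2)[of ?a]
    by (subst res_cancel) (simp_all add: degree_add_poly mult.commute)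
  finally show ?thesis by (simp add: path_res_def res_move)
qed

lemma path_res_X: "is_path T \<Longrightarrow> path_res T [:0, 1:] = 0"
proof (induction T)
  case Nil
  show ?case by (simp add: path_res_Nil)
next
  case (Cons b T)
  then have "is_path T" by simp
  have "path_res (b # T) [:0, 1:] = path_res T [:0, 1:]"
    by (subst path_res_Cons[OF Cons.prems], unfold path_res_def) (rule res_X_step[OF rem_poly_monic add_poly_monic degree_add_poly[OF \<open>is_path T\<close>] quad_monic])
  then show ?case using Cons by simp
qed


section \<open>Lagrange polynomials on the addable contents\<close>

definition lag :: "(nat \<times> nat) set \<Rightarrow> nat \<times> nat \<Rightarrow> complex poly" where
  "lag D b = (\<Prod>b'\<in>addable D - {b}. smult (1 / of_int (content b - content b')) (lin b'))"

lemma poly_lag: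
  assumes D: "is_diagram D" and b: "b \<in> addable D" "b' \<in> addable D"
  shows "poly (lag D b) (of_int (content b')) = (if b = b' then 1 else 0)"
proof (cases "b = b'")
  case True
  have "poly (lag D b) (of_int (content b)) = (\<Prod>x\<in>addable D - {b}. 1)"
    unfolding lag_def poly_prod
  proof (rule prod.cong[OF refl])
    fix x assume "x \<in> addable D - {b}"
    then have "content b \<noteq> content x"
      using inj_onD[OF content_inj_addable[OF D], of b x] b by auto
    then show "poly (smult (1 / of_int (content b - content x)) (lin x)) (of_int (content b)) = 1"
      by (simp add: lin_def divide_simps)
  qed
  then show ?thesis using True by simp
next
  case False
  have "poly (lag D b) (of_int (content b')) = 0"
    unfolding lag_def poly_prod
    by (rule prod_zero) (use False b D in \<open>auto simp: finite_addable poly_lin intro!: bexI[of _ b']\<close>)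
  then show ?thesis using False by simp
qed

lemma prod_lin_dvd:
  assumes "finite B" "inj_on content B" "\<And>b. b \<in> B \<Longrightarrow> poly q (of_int (content b)) = 0"
  shows "prod lin B dvd q"
  using assms
proof (induction B arbitrary: q rule: finite_induct)
  case (insert b B)
  have "poly q (of_int (content b)) = 0" using insert by simp
  then obtain q' where q': "q = lin b * q'"
    unfolding lin_def poly_eq_0_iff_dvd by blast
  have "prod lin B dvd q'"
  proof (rule insert.IH)
    fix b' assume b': "b' \<in> B"
    then have "content b' \<noteq> content b" using insert.prems(1) insert.hyps(2) unfolding inj_on_def by blast
    then show "poly q' (of_int (content b')) = 0"
      using insert.prems(2)[of b'] b' by (simp add: q' poly_lin)
  qed (use insert in auto)
  then show ?case using insert by (simp add: q')
qed simp

text \<open>Up to a nonzero factor this is the residue of \<open>N/D\<close> at the content of \<open>b\<close>, a simple pole where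
  \<open>N\<close> does not vanish.\<close>

lemma path_res_lag:
  assumes T: "is_path T" and b: "b \<in> addable (set T)"
  shows "path_res T (lag (set T) b) \<noteq> 0"
proof -
  let ?D = "add_poly (set T)" and ?N = "rem_poly (set T)" and ?a = "of_int (content b) :: complex"
  define E where "E = prod lin (addable (set T) - {b})"
  note d = is_path_diagram[OF T]
  have DE: "?D = lin b * E"
    unfolding add_poly_def E_def using finite_addable[OF d] b by (rule prod.remove)
  have Emonic: "lead_coeff E = 1" unfolding E_def by (rule monic_prod_lin)
  have "E \<noteq> 0" using Emonic by auto
  then have degE: "degree ?D = Suc (degree E)"
    using lead_coeff_lin[of b] by (subst DE, subst degree_mult_eq) (auto simp: lin_def)
  define \<kappa> where "\<kappa> = (\<Prod>b'\<in>addable (set T) - {b}. 1 / of_int (content b - content b') :: complex)"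
  have "\<kappa> \<noteq> 0"
    unfolding \<kappa>_def using b finite_addable[OF d] inj_onD[OF content_inj_addable[OF d], of b] by auto
  have lag: "lag (set T) b = smult \<kappa> E"
    unfolding lag_def E_def \<kappa>_def by (rule prod_smult)
  obtain h where h: "?N = lin b * h + [:poly ?N ?a:]"
    using synthetic_div_correct'[of ?a ?N] unfolding lin_def by metis
  have "E * ?N = ?D * h + smult (poly ?N ?a) E"
    by (subst h) (simp add: DE algebra_simps)
  then have "(E * ?N) mod ?D = smult (poly ?N ?a) E mod ?D" by simp
  also have "\<dots> = smult (poly ?N ?a) E"
    using degE by (intro mod_poly_less) (simp add: le_less_trans[OF degree_smult_le])
  finally have "path_res T (lag (set T) b) = \<kappa> * poly ?N ?a"
    using Emonic by (simp add: lag path_res_linear) (simp add: path_res_def res_def degE)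
  moreover have "poly ?N ?a \<noteq> 0"
    unfolding rem_poly_def poly_prod using content_addable_removable[OF d b] finite_removable[OF d]
    by (auto simp: poly_lin)
  ultimately show ?thesis using \<open>\<kappa> \<noteq> 0\<close> by simp
qed


section \<open>Moments of Jucys-Murphy elements\<close>

lemma quad_times_peval:
  "peval (quad c - 1) x = x * x - cs (2 * c) x + cs (c * c - 1) 1"
  by (simp add: quad_def one_pCons algebra_simps ga.scale_right_diff_distrib ga.scale_left_diff_distrib) 

text \<open>Write \<open>x = X\<^bsub>m+2\<^esub>\<close>, \<open>y = X\<^bsub>m+1\<^esub>\<close>. On \<open>e\<close> the element \<open>(x - c)\<^sup>2 - 1\<close> equals \<open>(x - y)\<^sup>2 - 1 = - \<phi>\<^sup>2\<close>, and moving
  one factor \<open>\<phi>\<close> past \<open>q(x)\<close> turns \<open>q(x)\<close> into \<open>q(y)\<close>. The truncation of \<open>\<phi> q(y) \<phi>\<close> then involves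
  only conjugates of polynomials in \<open>y\<close> by the adjacent transposition, whose truncations are the
  moments one level below.\<close>

lemma moment_quad:
  fixes M :: "complex poly \<Rightarrow> complex"
  assumes e: "e \<in> GA (Suc m)" and c: "JM (Suc m) * e = cs c e"
    and M: "\<And>r. trunc m (peval r (JM (Suc m))) * e = cs (M r) e"
    and lin: "\<And>p q. M (p + q) = M p + M q" "\<And>a q. M (smult a q) = a * M q"
  shows "trunc (Suc m) (peval ((quad c - 1) * q) (JM (Suc (Suc m)))) * e = cs (M (quad c * q)) e"
proof -
  define x y s f where d: "x = JM (Suc (Suc m))" "y = JM (Suc m)" "s = adj (Suc m)" "f = phi (Suc m)"
  define z t where z: "z = peval q y" and t: "t = (\<lambda>r. trunc m (peval r y))"
  let ?X = "[:0, 1:] :: complex poly"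
  have one: "Suc m \<ge> 1" by simp
  have ge1: "x \<in> GA (Suc (Suc m))" "y \<in> GA (Suc m)" "z \<in> GA (Suc m)"
    by (simp_all add: d z)
  have GA2: "GA (Suc m) \<subseteq> GA (Suc (Suc m))" by (rule GA_mono) simp
  have xy: "x * y = y * x" unfolding d by (rule JM_Suc_commute) simp
  have xe: "x * e = e * x" unfolding d by (rule JM_Suc_commute[OF e])
  have ye: "y * e = cs c e" using c by (simp add: d)
  have ty: "t r * y = y * t r" for r
    unfolding t d by (rule JM_Suc_commute[symmetric]) simp
  have te: "t r * e = cs (M r) e" for r using M by (simp add: t d)
  have sts: "trunc (Suc m) (s * peval r y * s) = t r" for r
    unfolding t d by (rule trunc_adj_conj) simp
  have py: "peval (?X * r) y = y * peval r y" for r by (simp add: peval_mult)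
  have pz: "peval (?X * (?X * q)) y = y * (y * z)" "peval (?X * q) y = y * z" "peval q y = z"
    by (simp_all only: py z)
  have zy: "z * y = y * z" unfolding z by (rule peval_intertwine) simp
  have "peval ((quad c - 1) * q) x * e = peval q x * (peval (quad c - 1) x * e)"
    by (subst mult.commute) (simp add: peval_mult mult.assoc)
  also have "peval (quad c - 1) x * e = ((x - y) * (x - y) - 1) * e"
  proof -
    have yxe: "y * (x * e) = cs c (x * e)"
      using ye xy by (metis mult.assoc mult_cs(2))
    have two: "cs (2 * c) (x * e) = cs c (x * e) + cs c (x * e)"
      by (simp only: ga.scale_left_distrib[symmetric]) simp
    have "peval (quad c - 1) x * e = x * (x * e) - cs (2 * c) (x * e) + cs (c * c - 1) e"
      by (simp add: quad_times_peval distrib_right left_diff_distrib mult.assoc)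
    also have "\<dots> = x * (x * e) - (cs c (x * e) + cs c (x * e)) + (cs (c * c) e - e)"
      by (simp only: two ga.scale_left_diff_distrib ga.scale_one)
    also have "\<dots> = (x - y) * ((x - y) * e) - e"
      by (simp add: left_diff_distrib right_diff_distrib ye yxe ga.scale_right_diff_distrib)
    finally show ?thesis by (simp add: left_diff_distrib mult.assoc)
  qed
  also have "(x - y) * (x - y) - 1 = - (f * f)"
    using phi_phi[OF one] by (simp add: d)
  also have "peval q x * (- (f * f) * e) = - (peval q x * f * f * e)"
    by (simp add: mult.assoc)
  also have "peval q x * f = f * z"
    unfolding z d by (rule peval_intertwine[OF phi_JM[OF one]])
  finally have "peval ((quad c - 1) * q) x * e = - (f * z * f * e)" .
  moreover have "f * z * f = y * (s * (z * y) * s) - y * (s * z * s) * y - s * (y * (z * y)) * s + (s * (y * z) * s) * y"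
    by (simp add: d phi_def algebra_simps)
  moreover define w where "w = (\<lambda>r. s * peval r y * s)"
  ultimately have eq: "peval ((quad c - 1) * q) x * e
      = - (y * w (?X * q) - y * w q * y - w (?X * (?X * q)) + w (?X * q) * y) * e"
    by (simp only: w_def pz zy minus_mult_left)
  have sg: "w r \<in> GA (Suc (Suc m))" for r
    using adj_in_GA[OF one] GA2 ge1 by (auto simp: w_def d intro!: GA_mult)
  have ge2: "y \<in> GA (Suc (Suc m))" using ge1 GA2 by auto
  have "trunc (Suc m) (peval ((quad c - 1) * q) x) * e = trunc (Suc m) (peval ((quad c - 1) * q) x * e)"
    by (rule trunc_mult_right[where m = "Suc (Suc m)", OF e, symmetric]) (simp add: d)
  also have "\<dots> = trunc (Suc m) (- (y * w (?X * q) - y * w q * y - w (?X * (?X * q)) + w (?X * q) * y)) * e"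
    unfolding eq using sg ge2 by (intro trunc_mult_right[where m = "Suc (Suc m)", OF e]) (auto simp del: mult_pCons_left)
  also have "\<dots> = - (y * t (?X * q) - y * t q * y - t (?X * (?X * q)) + t (?X * q) * y) * e"
  proof -
    have tw: "trunc (Suc m) (w r) = t r" for r unfolding w_def by (rule sts)
    have "trunc (Suc m) (y * w r) = y * t r" "trunc (Suc m) (w r * y) = t r * y" for r
      using trunc_mult_left[OF ge1(2) sg] trunc_mult_right[OF ge1(2) sg] by (simp_all only: tw)
    moreover have "trunc (Suc m) (y * w r * y) = y * t r * y" for r
      using trunc_mult_right[OF ge1(2) GA_mult[OF ge2 sg]] calculation(1) by (simp only:)
    ultimately show ?thesis
      by (simp only: trunc_uminus trunc_add trunc_diff tw)
  qed
  also have "\<dots> = cs (- (c * M (?X * q) - c * c * M q - M (?X * (?X * q)) + c * M (?X * q))) e"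
  proof -
    have "y * t r * e = cs (c * M r) e" for r
      using te ye by (simp add: mult.assoc)
    moreover have "t r * y * e = cs (c * M r) e" for r
      using te ye by (simp add: mult.assoc)
    moreover have "y * t r * y * e = cs (c * c * M r) e" for r
      using te ye by (simp add: mult.assoc)
    ultimately show ?thesis
      by (simp only: distrib_right left_diff_distrib minus_mult_left[symmetric] te ga.scale_minus_left ga.scale_left_distrib ga.scale_left_diff_distrib)
  qed
  also have "- (c * M (?X * q) - c * c * M q - M (?X * (?X * q)) + c * M (?X * q)) = M (quad c * q)"
  proof -
    have "quad c * q = smult (c * c) q + smult (- 2 * c) (?X * q) + ?X * (?X * q)"
      by (simp add: quad_def algebra_simps)
    then have "M (quad c * q) = c * c * M q + (- 2 * c) * M (?X * q) + M (?X * (?X * q))"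
      by (simp only: lin)
    then show ?thesis by simp
  qed
  finally show ?thesis by (simp add: d)
qed

text \<open>Division by \<open>(x - c)\<^sup>2 - 1\<close> leaves a linear remainder, so the moments are determined by
  \<open>moment_quad\<close> together with those of \<open>1\<close> and \<open>x\<close>.\<close>

lemma moment_step:
  fixes M M' :: "complex poly \<Rightarrow> complex"
  assumes e: "e \<in> GA (Suc m)" and c: "JM (Suc m) * e = cs c e"
    and M: "\<And>r. trunc m (peval r (JM (Suc m))) * e = cs (M r) e"
    and lin: "\<And>p q. M (p + q) = M p + M q" "\<And>a q. M (smult a q) = a * M q"
    and lin': "\<And>p q. M' (p + q) = M' p + M' q" "\<And>a q. M' (smult a q) = a * M' q"
    and M': "M' 1 = 1" "M' [:0, 1:] = 0" "\<And>q. M' ((quad c - 1) * q) = M (quad c * q)"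
  shows "trunc (Suc m) (peval q (JM (Suc (Suc m)))) * e = cs (M' q) e"
proof -
  let ?u = "quad c - 1" and ?x = "JM (Suc (Suc m))"
  have "degree (q mod ?u) < 2"
    using degree_mod_less[of ?u q] quad_monic[of c] by (cases "?u = 0"; cases "q mod ?u = 0") auto
  then obtain \<beta> \<alpha> where r: "q mod ?u = [:\<beta>, \<alpha>:]"
    by (metis degree1_coeffs degree_0_id less_2_cases pCons_0_0 One_nat_def)
  have "q = ?u * (q div ?u) + (smult \<beta> 1 + smult \<alpha> [:0, 1:])"
    using mult_div_mod_eq[of ?u q] unfolding r by (simp add: one_pCons)
  then obtain q' where q: "q = ?u * q' + (smult \<beta> 1 + smult \<alpha> [:0, 1:])" by blast
  have "trunc (Suc m) (peval (smult \<beta> 1 + smult \<alpha> [:0, 1:]) ?x) = cs \<beta> 1"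
    by (simp add: peval_add peval_smult trunc_add trunc_cs trunc_JM_Suc del: smult_pCons)
  then have "trunc (Suc m) (peval q ?x) * e = cs (M (quad c * q')) e + cs \<beta> e"
    unfolding q peval_add[of "?u * q'"] trunc_add distrib_right moment_quad[OF e c M lin] by simp
  also have "\<dots> = cs (M' q) e"
    unfolding q lin' M' by (simp add: ga.scale_left_distrib)
  finally show ?thesis .
qed


section \<open>Gelfand-Tsetlin idempotents\<close>

text \<open>The idempotents of the Gelfand-Tsetlin algebra.\<close>

fun gz :: "(nat \<times> nat) list \<Rightarrow> ga" where
  "gz [] = 1"
| "gz (b # T) = peval (lag (set T) b) (JM (Suc (length T))) * gz T"

lemma gz_in_GA: "gz T \<in> GA (length T)"
proof (induction T)
  case (Cons b T)
  then show ?case using GA_mono[of "length T" "Suc (length T)"] by auto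
qed simp

lemma gz_in_GA' [simp]: "length T \<le> n \<Longrightarrow> gz T \<in> GA n"
  using gz_in_GA GA_mono by blast

lemma peval_JM_commute:
  "x \<in> GA k \<Longrightarrow> peval q (JM (Suc k)) * x = x * peval q (JM (Suc k))"
  by (rule peval_intertwine[OF JM_Suc_commute])

lemma iota_gz [simp]: "iota (gz T) = gz T"
proof (induction T)
  case (Cons b T)
  have "iota (gz (b # T)) = iota (gz T) * iota (peval (lag (set T) b) (JM (Suc (length T))))"
    by (simp, rule iota_mult[of _ "Suc (length T)" _ "length T"]) simp_all
  then show ?case
    using peval_JM_commute[of "gz T" "length T"] Cons by (simp add: iota_peval[of _ "Suc (length T)"])
qed simp

lemma real_el_lin: "real_el (peval (lin b) (JM k))"
  using real_el_add[OF real_el_JM real_el_cs[OF _ real_el_1], of "- of_int (content b)"]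
  by (simp add: lin_def add.commute)

lemma real_el_gz: "real_el (gz T)"
proof (induction T)
  case (Cons b T)
  have "real_el (peval (lag (set T) b) (JM (Suc (length T))))"
    unfolding lag_def
    by (intro real_el_peval_prod) (auto simp: peval_smult intro!: real_el_cs real_el_lin)
  then show ?case using Cons by (simp add: real_el_mult)
qed (simp add: real_el_1)

lemma real_el_add_poly: "real_el (peval (add_poly D) (JM k))"
  unfolding add_poly_def by (intro real_el_peval_prod real_el_lin)

text \<open>The element \<open>D(X) e\<close> is real and invariant under inversion, and the coefficient of the identity in
  its square is a moment of \<open>D\<^sup>2\<close>, which is zero because \<open>D\<close> cancels the denominator. Positivity
  gives \<open>D(X) e = 0\<close>, and \<open>D\<close> divides every polynomial that vanishes at the addable contents.\<close>

lemma vanish_on_addable: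
  assumes T: "is_path T" and idem: "gz T * gz T = gz T"
    and M: "\<And>r. trunc (length T) (peval r (JM (Suc (length T)))) * gz T = cs (path_res T r) (gz T)"
    and q: "\<And>b. b \<in> addable (set T) \<Longrightarrow> poly q (of_int (content b)) = 0"
  shows "peval q (JM (Suc (length T))) * gz T = 0"
proof -
  let ?k = "length T" and ?D = "add_poly (set T)" and ?X = "JM (Suc (length T))" and ?e = "gz T"
  define w where "w = peval ?D ?X * ?e"
  note comm = peval_JM_commute[OF gz_in_GA]
  note d = is_path_diagram[OF T]
  have "w * w = peval ?D ?X * (?e * peval ?D ?X) * ?e"
    by (simp add: w_def mult.assoc)
  also have "\<dots> = peval (?D * ?D) ?X * ?e"
    by (simp add: comm[symmetric] peval_mult mult.assoc idem)
  finally have ww: "w * w = peval (?D * ?D) ?X * ?e" .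
  have "trunc ?k (w * w) = trunc ?k (peval (?D * ?D) ?X) * ?e"
    unfolding ww by (rule trunc_mult_right[of _ _ _ "Suc ?k"]) simp_all
  also have "\<dots> = 0"
    unfolding M path_res_def res_multiple by simp
  finally have "coef (trunc ?k (w * w)) id = 0"
    by (simp add: coef_simps)
  then have "coef (w * w) id = 0"
    by (simp add: trunc.rep_eq)
  moreover have "w \<in> GA (Suc ?k)"
    unfolding w_def by simp
  moreover have "real_el w"
    unfolding w_def by (intro real_el_mult real_el_gz real_el_add_poly)
  moreover have "iota w = w"
  proof -
    have "iota w = iota ?e * iota (peval ?D ?X)"
      unfolding w_def by (rule iota_mult[of _ "Suc ?k" _ ?k]) simp_all
    then show ?thesis by (simp add: w_def iota_peval[of _ "Suc ?k"] comm)
  qed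
  ultimately have w0: "w = 0" by (rule real_symmetric_square_zero[rotated 3])
  have "?D dvd q"
    unfolding add_poly_def
    by (rule prod_lin_dvd[OF finite_addable[OF d] content_inj_addable[OF d] q])
  then obtain q' where "q = q' * ?D" by (metis dvdE mult.commute)
  then show ?thesis using w0 by (simp add: peval_mult mult.assoc w_def)
qed

text \<open>The three assertions need each other: idempotency of the extension uses the vanishing lemma, which
  uses the moments and idempotency of the shorter path, and the moments of the extension use that
  the Jucys-Murphy element acts on it by the content of the new box.\<close>

lemma gz_main:
  assumes "is_path T"
  shows gz_idem: "gz T * gz T = gz T"
    and gz_moments: "\<And>r. trunc (length T) (peval r (JM (Suc (length T)))) * gz T = cs (path_res T r) (gz T)"
    and gz_nonzero: "gz T \<noteq> 0"
proof -
  have "gz T * gz T = gz T \<and> gz T \<noteq> 0 \<and>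
      (\<forall>r. trunc (length T) (peval r (JM (Suc (length T)))) * gz T = cs (path_res T r) (gz T))"
    using assms
  proof (induction T)
    case Nil
    have "peval r 0 = cs (poly r 0) 1" for r
      using peval_eigen_left[of 0 1 0 r] by simp
    then show ?case by (simp add: path_res_Nil trunc_cs)
  next
    case (Cons b T)
    let ?k = "length T" and ?X = "JM (Suc (length T))" and ?e = "gz T" and ?l = "lag (set T) b"
    let ?a = "of_int (content b) :: complex"
    have T: "is_path T" and b: "b \<in> addable (set T)" using Cons.prems by auto
    note d = is_path_diagram[OF T]
    have idem: "?e * ?e = ?e" and nz: "?e \<noteq> 0"
      and M: "\<And>r. trunc ?k (peval r ?X) * ?e = cs (path_res T r) ?e"
      using Cons.IH[OF T] by auto
    note van = vanish_on_addable[OF T idem M]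
    note comm = peval_JM_commute[OF gz_in_GA[of T]]
    have "peval (?l * ?l - ?l) ?X * ?e = 0"
      by (rule van) (simp add: poly_lag[OF d b])
    then have ll: "peval ?l ?X * (peval ?l ?X * ?e) = peval ?l ?X * ?e"
      by (simp add: peval_diff peval_mult algebra_simps)
    have "gz (b # T) * gz (b # T) = peval ?l ?X * (?e * peval ?l ?X) * ?e"
      by (simp add: mult.assoc)
    also have "\<dots> = gz (b # T)"
      by (simp add: comm[symmetric] mult.assoc idem ll)
    finally have 1: "gz (b # T) * gz (b # T) = gz (b # T)" .
    have "peval ([:- ?a, 1:] * ?l) ?X * ?e = 0"
      by (rule van) (simp add: poly_lag[OF d b])
    then have Xe: "?X * gz (b # T) = cs ?a (gz (b # T))"
      by (simp add: peval_mult algebra_simps peval_diff peval_smult)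
    have "trunc ?k (gz (b # T)) = cs (path_res T ?l) ?e"
      unfolding gz.simps M[symmetric] by (rule trunc_mult_right[of _ _ _ "Suc ?k"]) simp_all
    then have 2: "gz (b # T) \<noteq> 0"
      using path_res_lag[OF T b] nz by auto
    have "trunc (Suc ?k) (peval r (JM (Suc (Suc ?k)))) * gz (b # T) = cs (path_res (b # T) r) (gz (b # T))" for r
    proof (rule moment_step[where M = "path_res T" and c = ?a])
      fix r
      have "trunc ?k (peval r ?X) * gz (b # T) = trunc ?k (peval r ?X) * (?e * peval ?l ?X)"
        by (simp add: comm)
      also have "\<dots> = cs (path_res T r) (gz (b # T))"
        by (simp add: mult.assoc[symmetric] M) (simp add: comm)
      finally show "trunc ?k (peval r ?X) * gz (b # T) = cs (path_res T r) (gz (b # T))" .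
    qed (use Xe path_res_1[OF Cons.prems] path_res_X[OF Cons.prems] path_res_quad[OF Cons.prems]
        in \<open>simp_all add: path_res_linear del: gz.simps\<close>)
    then show ?case using 1 2 by simp
  qed
  then show "gz T * gz T = gz T" "gz T \<noteq> 0"
    "\<And>r. trunc (length T) (peval r (JM (Suc (length T)))) * gz T = cs (path_res T r) (gz T)"
    by auto
qed

lemma peval_vanish:
  assumes "is_path T" "\<And>b. b \<in> addable (set T) \<Longrightarrow> poly q (of_int (content b)) = 0"
  shows "peval q (JM (Suc (length T))) * gz T = 0"
  by (rule vanish_on_addable[OF assms(1) gz_idem[OF assms(1)] gz_moments[OF assms(1)] assms(2)])


section \<open>Weights\<close>

definition wt :: "(nat \<times> nat) list \<Rightarrow> nat \<Rightarrow> complex" where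
  "wt T i = of_int (content (T ! (length T - i)))"

lemma wt_Cons: "wt (b # T) (Suc (length T)) = of_int (content b)"
    "i \<in> {1..length T} \<Longrightarrow> wt (b # T) i = wt T i"
  by (auto simp: wt_def Suc_diff_le)

lemma gz_Cons_right: "gz (b # T) = gz T * peval (lag (set T) b) (JM (Suc (length T)))"
  by (simp add: peval_JM_commute)

lemma JM_gz_top:
  assumes "is_path (b # T)"
  shows "JM (Suc (length T)) * gz (b # T) = cs (of_int (content b)) (gz (b # T))"
proof -
  have "peval ([:- of_int (content b), 1:] * lag (set T) b) (JM (Suc (length T))) * gz T = 0"
    using assms by (intro peval_vanish) (auto simp: poly_lag[OF is_path_diagram])
  then show ?thesis
    by (simp add: peval_mult algebra_simps peval_diff peval_smult)
qed

lemma JM_gz: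
  assumes "is_path T" "i \<in> {1..length T}"
  shows "JM i * gz T = cs (wt T i) (gz T)"
  using assms
proof (induction T)
  case (Cons b T)
  show ?case
  proof (cases "i = Suc (length T)")
    case True
    then show ?thesis using JM_gz_top[OF Cons.prems(1)] by (simp add: wt_Cons)
  next
    case False
    then have i: "i \<in> {1..length T}" using Cons.prems by auto
    then have "JM i \<in> GA (length T)" by simp
    then have "JM i * gz (b # T) = peval (lag (set T) b) (JM (Suc (length T))) * (JM i * gz T)"
      using peval_JM_commute[of "JM i" "length T"] by (simp add: mult.assoc[symmetric])
    then show ?thesis using Cons i by (simp add: wt_Cons)
  qed
qed simp

lemma gz_JM:
  assumes "is_path T" "i \<in> {1..length T}"
  shows "gz T * JM i = cs (wt T i) (gz T)"
proof -
  have "gz T * JM i = iota (JM i * gz T)"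
    using assms(2) iota_mult[of "JM i" "length T" "gz T" "length T"] by simp
  then show ?thesis using JM_gz[OF assms] by (simp add: iota_cs)
qed

text \<open>The idempotent of a path acts as the identity on every vector of the weight of the path,
  because each of its Lagrange factors takes the value one there.\<close>

lemma gz_fixes_weight:
  assumes "is_path T" "\<And>i. i \<in> {1..length T} \<Longrightarrow> JM i * v = cs (wt T i) v"
  shows "gz T * v = v"
  using assms
proof (induction T)
  case (Cons b T)
  have T: "is_path T" "b \<in> addable (set T)" using Cons.prems by auto
  have "gz T * v = v"
  proof (rule Cons.IH[OF T(1)])
    fix i assume "i \<in> {1..length T}"
    then show "JM i * v = cs (wt T i) v" using Cons.prems(2)[of i] by (simp add: wt_Cons)
  qed
  moreover have "JM (Suc (length T)) * v = cs (of_int (content b)) v"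
    using Cons.prems(2)[of "Suc (length T)"] by (simp add: wt_Cons)
  from peval_eigen_left[OF this, of "lag (set T) b"]
  have "peval (lag (set T) b) (JM (Suc (length T))) * v = v"
    by (simp add: poly_lag[OF is_path_diagram[OF T(1)] T(2) T(2)])
  ultimately show ?case by (simp add: mult.assoc)
qed simp

lemma gz_fixes_weight_right:
  assumes "is_path T" "v \<in> GA n" "length T \<le> n"
    and w: "\<And>i. i \<in> {1..length T} \<Longrightarrow> v * JM i = cs (wt T i) v"
  shows "v * gz T = v"
proof -
  have "gz T * iota v = iota v"
  proof (rule gz_fixes_weight[OF assms(1)])
    fix i assume i: "i \<in> {1..length T}"
    have "JM i * iota v = iota (v * JM i)"
      using i assms(3) by (subst iota_mult[OF assms(2), of _ n]) simp_all
    then show "JM i * iota v = cs (wt T i) (iota v)" using w[OF i] by (simp add: iota_cs)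
  qed
  then have "iota (gz T * iota v) = iota (iota v)" by simp
  then show ?thesis
    using assms(2,3) iota_mult[of "gz T" n "iota v" n] by simp
qed

definition paths :: "nat \<Rightarrow> (nat \<times> nat) list set" where
  "paths n = {T. is_path T \<and> length T = n}"

lemma paths_0: "paths 0 = {[]}"
  by (auto simp: paths_def)

lemma paths_Suc: "paths (Suc n) = (\<lambda>(T, b). b # T) ` (SIGMA T:paths n. addable (set T))"
  by (auto simp: paths_def length_Suc_conv image_iff)

lemma finite_paths [simp]: "finite (paths n)"
proof (induction n)
  case (Suc n)
  have "finite (addable (set T))" if "T \<in> paths n" for T
    using that by (auto simp: paths_def intro: finite_addable is_path_diagram)
  then show ?case
    unfolding paths_Suc by (intro finite_imageI finite_SigmaI Suc.IH)
qed (simp add: paths_0)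

lemma gz_Cons_absorb:
  assumes "is_path (b # T)"
  shows "gz T * gz (b # T) = gz (b # T)" "gz (b # T) * gz T = gz (b # T)"
proof -
  have i: "gz T * gz T = gz T" using assms by (simp add: gz_idem)
  then show "gz (b # T) * gz T = gz (b # T)" by (simp add: mult.assoc)
  show "gz T * gz (b # T) = gz (b # T)"
    unfolding gz_Cons_right by (simp add: mult.assoc[symmetric] i)
qed

lemma sum_gz_Cons:
  assumes "is_path T"
  shows "(\<Sum>b\<in>addable (set T). gz (b # T)) = gz T"
proof -
  note d = is_path_diagram[OF assms]
  have "peval ((\<Sum>b\<in>addable (set T). lag (set T) b) - 1) (JM (Suc (length T))) * gz T = 0"
  proof (rule peval_vanish[OF assms])
    fix b' assume b': "b' \<in> addable (set T)"
    have "(\<Sum>b\<in>addable (set T). poly (lag (set T) b) (of_int (content b'))) = (\<Sum>b\<in>addable (set T). if b = b' then 1 else 0)"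
      using b' by (intro sum.cong refl) (simp add: poly_lag[OF d])
    then show "poly ((\<Sum>b\<in>addable (set T). lag (set T) b) - 1) (of_int (content b')) = 0"
      using b' finite_addable[OF d] by (simp add: poly_sum)
  qed
  then show ?thesis
    by (simp add: peval_diff peval_sum left_diff_distrib sum_distrib_right)
qed

lemma sum_gz: "(\<Sum>T\<in>paths n. gz T) = 1"
proof (induction n)
  case (Suc n)
  have "(\<Sum>T\<in>paths (Suc n). gz T) = (\<Sum>(T, b)\<in>(SIGMA T:paths n. addable (set T)). gz (b # T))"
    unfolding paths_Suc by (subst sum.reindex) (auto simp: inj_on_def case_prod_unfold)
  also have "\<dots> = (\<Sum>T\<in>paths n. \<Sum>b\<in>addable (set T). gz (b # T))"
    by (rule sum.Sigma[OF finite_paths, symmetric]) (auto simp: paths_def intro!: finite_addable is_path_diagram)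
  also have "\<dots> = (\<Sum>T\<in>paths n. gz T)"
    by (intro sum.cong refl sum_gz_Cons) (simp add: paths_def)
  finally show ?case using Suc by simp
qed (simp add: paths_0)

text \<open>Where the paths first diverge, two different Lagrange polynomials at the same addable contents
  are multiplied.\<close>

lemma gz_orthogonal:
  assumes "is_path T" "is_path T'" "length T = length T'" "T \<noteq> T'"
  shows "gz T * gz T' = 0"
  using assms
proof (induction T arbitrary: T')
  case (Cons b T)
  then obtain b' T1 where T': "T' = b' # T1" by (cases T') auto
  let ?X = "JM (Suc (length T))"
  have l: "length T1 = length T" using Cons.prems T' by simp
  have "gz (b # T) * gz T' = peval (lag (set T) b) ?X * (gz T * peval (lag (set T1) b') ?X) * gz T1"
    by (simp add: T' l mult.assoc)
  also have "\<dots> = peval (lag (set T) b) ?X * (peval (lag (set T1) b') ?X * (gz T * gz T1))"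
    by (simp add: peval_JM_commute[OF gz_in_GA, symmetric] mult.assoc)
  finally have e: "gz (b # T) * gz T' = peval (lag (set T) b) ?X * (peval (lag (set T1) b') ?X * (gz T * gz T1))" .
  show ?case
  proof (cases "T = T1")
    case False
    then show ?thesis using e Cons.IH[of T1] Cons.prems T' by simp
  next
    case True
    have "peval (lag (set T) b * lag (set T) b') ?X * gz T = 0"
      using Cons.prems T' True by (intro peval_vanish) (auto simp: poly_lag[OF is_path_diagram])
    then show ?thesis using e True Cons.prems gz_idem[of T] by (simp add: peval_mult mult.assoc)
  qed
qed simp


section \<open>Blocks of the group algebra\<close>

lemma is_path_last_content:
  assumes "is_path (c # Q)" "b \<in> addable (set (c # Q))"
  shows "(of_int (content b) :: complex) \<noteq> of_int (content c)"
proof -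
  have "c \<in> removable (set (c # Q))"
    using addable_removable_insert[of c "set Q"] assms(1) is_path_diagram[of Q] by simp
  then show ?thesis
    using content_addable_removable[OF is_path_diagram[OF assms(1)] assms(2)] by simp
qed

text \<open>The intertwiner would carry the weight space of \<open>R\<close> to weight vectors whose next
  content equals the last content of \<open>R\<close>, but that content belongs to a removable
  corner and is never addable.\<close>

lemma gz_phi_gz:
  assumes R: "is_path (c # Q)"
  shows "gz (c # Q) * phi (Suc (length Q)) * gz (c # Q) = 0"
proof -
  let ?R = "c # Q" and ?a = "of_int (content c) :: complex" and ?k = "Suc (length Q)"
  let ?X = "JM (Suc ?k)" and ?D = "add_poly (set (c # Q))"
  define z where "z = gz ?R * phi ?k * gz ?R"
  have "?X * z = gz ?R * (?X * phi ?k) * gz ?R"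
    using JM_Suc_commute[of "gz ?R" ?k] by (simp add: z_def mult.assoc[symmetric] del: gz.simps)
  also have "\<dots> = gz ?R * phi ?k * (JM ?k * gz ?R)"
    by (simp add: phi_JM mult.assoc del: gz.simps)
  also have "\<dots> = cs ?a z"
    by (simp add: JM_gz_top[OF R] z_def del: gz.simps)
  finally have "peval ?D ?X * z = cs (poly ?D ?a) z"
    by (rule peval_eigen_left)
  moreover have "peval ?D ?X * gz ?R = 0"
    using peval_vanish[OF R, of ?D] finite_addable[OF is_path_diagram[OF R]]
    by (auto simp: add_poly_def poly_prod poly_lin simp del: gz.simps)
  then have "peval ?D ?X * z = 0" by (simp add: z_def mult.assoc[symmetric] del: gz.simps)
  moreover have "poly ?D ?a \<noteq> 0"
    unfolding add_poly_def poly_prod using is_path_last_content[OF R] finite_addable[OF is_path_diagram[OF R]]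
    by (fastforce simp: lin_def)
  ultimately show ?thesis by (simp add: z_def del: gz.simps)
qed

lemma GA_0_1:
  assumes "x \<in> GA k" "k \<le> 1"
  shows "\<exists>\<gamma>. x = cs \<gamma> 1"
  using assms(1)
proof (induction rule: GA_induct)
  case (grp \<sigma>)
  then have "\<sigma> permutes {1..k}" by (simp add: sym_group_def)
  moreover have "{1..k} \<subseteq> {1}" using assms(2) by auto
  ultimately have "\<sigma> permutes {1}" by (rule permutes_subset)
  then have "\<sigma> = id" by simp
  then show ?case by (intro exI[of _ 1]) simp
next
  case (add x y)
  then show ?case by (metis ga.scale_left_distrib)
next
  case (scale c x)
  then show ?case by (metis ga.scale_scale)
qed

text \<open>The blocks vanish for different shapes, and the diagonal ones consist of scalars. This is phrased for
  a single element \<open>x\<close>, so that it can be verified on generators and extended linearly.\<close>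

definition block :: "(nat \<times> nat) list \<Rightarrow> (nat \<times> nat) list \<Rightarrow> ga \<Rightarrow> bool" where
  "block S' S x \<longleftrightarrow> (gz S' * x * gz S \<noteq> 0 \<longrightarrow> set S' = set S) \<and>
     (S' = S \<longrightarrow> (\<exists>\<gamma>. gz S' * x * gz S = cs \<gamma> (gz S)))"

lemma block_0: "gz S' * x * gz S = 0 \<Longrightarrow> block S' S x"
  unfolding block_def using ga.scale_zero_left by metis

lemma block_cong:
  "block S' S x \<Longrightarrow> gz S' * x * gz S = gz S' * y * gz S \<Longrightarrow> block S' S y"
  unfolding block_def by metis

lemma block_add: "block S' S x \<Longrightarrow> block S' S y \<Longrightarrow> block S' S (x + y)"
  unfolding block_def distrib_left distrib_right
  by (metis add_0_left ga.scale_left_distrib)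

lemma block_cs: "block S' S x \<Longrightarrow> block S' S (cs c x)"
  unfolding block_def by (auto simp: ga.scale_eq_0_iff)

lemma block_sum: "(\<And>i. i \<in> I \<Longrightarrow> block S' S (f i)) \<Longrightarrow> block S' S (sum f I)"
  by (induction I rule: infinite_finite_induct) (auto intro: block_add block_0)

text \<open>Elements of the smaller algebra commute with the last Jucys-Murphy element, so that both last
  contents must agree.\<close>

lemma block_small:
  assumes T: "is_path (b # T)" "is_path (b' # T')" "length T' = length T"
    and z: "z \<in> GA (length T)" and IH: "block T' T z"
  shows "block (b' # T') (b # T) z"
proof (cases "gz (b' # T') * z * gz (b # T) = 0")
  case True
  then show ?thesis by (rule block_0)
next
  case False
  let ?X = "JM (Suc (length T))"
  let ?l = "lag (set T) b" and ?l' = "lag (set T') b'"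
  define g where "g = gz T' * z * gz T"
  define w where "w = gz (b' # T') * z * gz (b # T)"
  have g: "g \<in> GA (length T)" using z T(3) by (simp add: g_def)
  have w: "w = peval ?l' ?X * (peval ?l ?X * g)"
  proof -
    have "w = peval ?l' ?X * (g * peval ?l ?X)"
      unfolding w_def g_def gz_Cons_right[of b T] by (simp add: T(3) mult.assoc)
    then show ?thesis by (simp add: peval_JM_commute[OF g])
  qed
  have "g \<noteq> 0" using False w by (auto simp: w_def)
  then have D: "set T' = set T" using IH by (auto simp: block_def g_def)
  have "?X * w = cs (of_int (content b')) w"
    using JM_gz_top[OF T(2)] by (simp add: w_def T(3) mult.assoc[symmetric] del: gz.simps)
  moreover have "w * ?X = cs (of_int (content b)) w"
    using gz_JM[OF T(1), of "Suc (length T)"] by (simp add: w_def wt_Cons mult.assoc del: gz.simps)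
  moreover have "?X * w = w * ?X"
    unfolding w using JM_Suc_commute[OF g] peval_intertwine[of ?X ?X ?X]
    by (metis mult.assoc)
  ultimately have "of_int (content b') = (of_int (content b) :: complex)"
    using False by (simp add: w_def del: gz.simps)
  then have b: "b' = b"
    using inj_onD[OF content_inj_addable[OF is_path_diagram[of T]], of b' b] T D by simp
  have "\<exists>\<gamma>. w = cs \<gamma> (gz (b # T))" if eq: "T' = T"
  proof -
    obtain \<gamma> where "g = cs \<gamma> (gz T)" using IH eq unfolding block_def g_def by metis
    then have "w = cs \<gamma> (peval (?l * ?l) ?X * gz T)"
      using w b eq by (simp add: peval_mult mult.assoc)
    also have "peval (?l * ?l) ?X * gz T = gz (b # T)"
    proof -
      have "peval (?l * ?l - ?l) ?X * gz T = 0"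
        using T by (intro peval_vanish) (auto simp: poly_lag[OF is_path_diagram])
      then show ?thesis by (simp add: peval_diff left_diff_distrib)
    qed
    finally show ?thesis by blast
  qed
  then show ?thesis using D b by (auto simp: block_def w_def simp del: gz.simps)
qed

text \<open>One summand of a mixed element, after inserting the decomposition of the identity on both
  sides of the adjacent transposition. Multiplying by the invertible difference of contents turns
  the transposition into one minus the intertwiner; the first part is an element of the smaller
  algebra, and the second one only connects the two orders of adding the last two boxes.\<close>

lemma block_mixed_term:
  assumes S: "is_path (b # T)" "is_path (b' # T')" "length T = Suc m" "length T' = Suc m"
    and R: "is_path (c # Q)" "is_path (c' # Q')" "length Q = m" "length Q' = m"
    and z: "z1 \<in> GA (Suc m)" "z2 \<in> GA (Suc m)"
    and IH: "\<And>S S' x. is_path S \<Longrightarrow> is_path S' \<Longrightarrow> length S = Suc m \<Longrightarrow> length S' = Suc m \<Longrightarrow>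
      x \<in> GA (Suc m) \<Longrightarrow> block S' S x"
  shows "block (b' # T') (b # T) (z1 * gz (c' # Q') * adj (Suc m) * gz (c # Q) * z2)"
proof (cases "gz T' * z1 * gz (c' # Q') = 0 \<or> gz (c # Q) * z2 * gz T = 0")
  case True
  have "gz (b' # T') * z1 * gz (c' # Q') = peval (lag (set T') b') (JM (Suc (length T'))) * (gz T' * z1 * gz (c' # Q'))"
    by (simp add: mult.assoc)
  moreover have "gz (c # Q) * z2 * gz (b # T) = (gz (c # Q) * z2 * gz T) * peval (lag (set T) b) (JM (Suc (length T)))"
    unfolding gz_Cons_right[of b T] by (simp add: mult.assoc)
  ultimately have "gz (b' # T') * z1 * gz (c' # Q') = 0 \<or> gz (c # Q) * z2 * gz (b # T) = 0"
    using True by auto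
  then have "gz (b' # T') * (z1 * gz (c' # Q') * adj (Suc m) * gz (c # Q) * z2) * gz (b # T) = 0"
    by (metis mult.assoc mult_zero_left mult_zero_right)
  then show ?thesis by (rule block_0)
next
  case nz: False
  have D': "set T' = insert c' (set Q')"
    using nz IH[of "c' # Q'" T' z1] S R z by (auto simp: block_def simp del: gz.simps)
  have D: "set T = insert c (set Q)"
    using nz IH[of T "c # Q" z2] S R z by (auto simp: block_def simp del: gz.simps)
  let ?k = "Suc m" and ?S = "b # T" and ?S' = "b' # T'" and ?R = "c # Q" and ?R' = "c' # Q'"
  let ?X = "JM (Suc ?k)" and ?y = "JM ?k" and ?s = "adj ?k"
  let ?b = "of_int (content b) :: complex" and ?b' = "of_int (content b') :: complex"
  let ?c = "of_int (content c) :: complex" and ?c' = "of_int (content c') :: complex"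
  note [simp del] = gz.simps
  have gR: "gz ?R \<in> GA ?k" "gz ?R' \<in> GA ?k" using R by simp_all
  show ?thesis
  proof (cases "Q' = Q")
    case False
    have "gz ?R' = gz ?R' * gz Q'" "gz ?R = gz Q * gz ?R"
      using gz_Cons_absorb R by metis+
    moreover have "gz Q' * ?s * gz Q = 0"
    proof -
      have "gz Q' * ?s * gz Q = ?s * (gz Q' * gz Q)"
        using adj_commute[of "gz Q'" m] R by (simp add: mult.assoc[symmetric])
      then show ?thesis using gz_orthogonal[of Q' Q] R False by simp
    qed
    ultimately have "gz ?R' * ?s * gz ?R = 0"
      by (metis mult.assoc mult_zero_left mult_zero_right)
    then have "gz ?S' * (z1 * gz ?R' * ?s * gz ?R * z2) * gz ?S = 0"
      by (metis mult.assoc mult_zero_left mult_zero_right)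
    then show ?thesis by (rule block_0)
  next
    case Q: True
    define t where "t = gz ?S' * (z1 * gz ?R' * ?s * gz ?R * z2) * gz ?S"
    define t0 where "t0 = gz ?S' * (z1 * gz ?R' * gz ?R * z2) * gz ?S"
    define t1 where "t1 = gz ?S' * (z1 * gz ?R' * phi ?k * gz ?R * z2) * gz ?S"
    have XS: "?X * gz ?S' = cs ?b' (gz ?S')" "gz ?S * ?X = cs ?b (gz ?S)"
      using JM_gz_top[OF S(2)] gz_JM[OF S(1), of "Suc ?k"] wt_Cons(1)[of b T] S by simp_all
    have XS': "gz ?S' * ?X = cs ?b' (gz ?S')" "?X * gz ?S = cs ?b (gz ?S)"
      using JM_gz_top[OF S(1)] gz_JM[OF S(2), of "Suc ?k"] wt_Cons(1)[of b' T'] S by simp_all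
    have yR: "gz ?R' * ?y = cs ?c' (gz ?R')" "?y * gz ?R = cs ?c (gz ?R)"
        "?y * gz ?R' = cs ?c' (gz ?R')" "gz ?R * ?y = cs ?c (gz ?R)"
      using JM_gz_top[OF R(1)] gz_JM[OF R(1), of ?k] wt_Cons(1)[of c Q]
        JM_gz_top[OF R(2)] gz_JM[OF R(2), of ?k] wt_Cons(1)[of c' Q'] R by simp_all
    define p where "p = gz ?S' * (z1 * gz ?R')"
    define q where "q = gz ?R * z2 * gz ?S"
    have pX: "p * ?X = cs ?b' p"
    proof -
      have "p * ?X = gz ?S' * ?X * (z1 * gz ?R')"
        using JM_Suc_commute[of "z1 * gz ?R'" ?k] z gR by (simp add: p_def mult.assoc)
      then show ?thesis by (simp add: XS' p_def)
    qed
    have Xq: "?X * q = cs ?b q"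
    proof -
      have "?X * q = gz ?R * z2 * (?X * gz ?S)"
        using JM_Suc_commute[of "gz ?R * z2" ?k] z gR by (simp add: q_def mult.assoc[symmetric])
      then show ?thesis by (simp add: XS' q_def)
    qed
    have py: "p * ?y = cs ?c' p" by (simp add: p_def mult.assoc yR)
    have yq: "?y * q = cs ?c q" by (simp add: q_def mult.assoc[symmetric] yR)
    have t: "t = p * ?s * q" "t0 = p * q" "t1 = p * phi ?k * q"
      by (simp_all add: t_def t0_def t1_def p_def q_def mult.assoc)
    have "p * phi ?k * q = p * q - p * (?X - ?y) * ?s * q"
      by (simp add: phi_left algebra_simps)
    also have "p * (?X - ?y) = cs (?b' - ?c') p"
      by (simp add: right_diff_distrib pX py ga.scale_left_diff_distrib)
    finally have main: "cs (?b' - ?c') t = t0 - t1" by (simp add: t)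
    \<comment> \<open>\<open>b'\<close> is addable to a diagram from which \<open>c'\<close> can be removed\<close>
    have ne: "?b' \<noteq> ?c'"
    proof -
      have "(of_int (content b') :: complex) \<noteq> of_int (content c')"
        using is_path_last_content[OF R(2)] S(2) D' by simp
      then show ?thesis .
    qed
    have t_eq: "t = cs (1 / (?b' - ?c')) (t0 - t1)"
      using ne by (simp add: main[symmetric])
    show ?thesis
    proof (cases "c' = c")
      case True
      have "t1 = gz ?S' * (z1 * (gz ?R * phi ?k * gz ?R) * z2) * gz ?S"
        by (simp add: t1_def True Q mult.assoc)
      then have "t1 = 0" using gz_phi_gz[OF R(1)] R by simp
      have "block ?S' ?S (z1 * gz ?R' * gz ?R * z2)"
        using S R z gR by (intro block_small IH) (auto intro!: GA_mult)
      then have "block ?S' ?S (cs (1 / (?b' - ?c')) (z1 * gz ?R' * gz ?R * z2))"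
        by (rule block_cs)
      moreover have "gz ?S' * cs (1 / (?b' - ?c')) (z1 * gz ?R' * gz ?R * z2) * gz ?S = t"
        using t_eq \<open>t1 = 0\<close> by (simp add: t0_def)
      ultimately show ?thesis unfolding t_def by (rule block_cong)
    next
      case False
      have "t0 = gz ?S' * (z1 * (gz ?R' * gz ?R) * z2) * gz ?S"
        by (simp add: t0_def mult.assoc)
      then have "t0 = 0" using gz_orthogonal[OF R(2,1)] R False by simp
      then have t2: "t = cs (- 1 / (?b' - ?c')) t1"
        using t_eq by (simp add: ga.scale_minus_right)
      show ?thesis
      proof (cases "t1 = 0")
        case True
        then show ?thesis using t2 by (intro block_0) (simp add: t_def)
      next
        case t1: False
        \<comment> \<open>the contents on the two sides show that both paths add the boxes \<open>c\<close> and \<open>c'\<close>, in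
          opposite orders\<close>
        have "cs ?b' t1 = p * (?X * phi ?k) * q"
          by (simp add: t mult.assoc[symmetric] pX)
        also have "\<dots> = cs ?c t1"
          by (simp add: t phi_JM mult.assoc yq)
        finally have bc: "?b' = ?c" using t1 by simp
        have "cs ?b t1 = p * (phi ?k * ?X) * q"
          by (simp add: t mult.assoc Xq)
        also have "\<dots> = cs ?c' t1"
          by (simp add: t phi_JM_Suc mult.assoc[symmetric] py)
        finally have bc': "?b = ?c'" using t1 by simp
        have cc: "c \<in> addable (set Q)" "c' \<in> addable (set Q)" "is_diagram (set Q)"
          using R Q is_path_diagram[of Q] by auto
        have "c \<in> addable (set T')"
          using addable_insert_keep[OF cc(3,2,1)] False D' Q by simp
        then have "b' = c"
          using inj_onD[OF content_inj_addable[OF is_path_diagram[of T']], of b' c] bc S(2) by simp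
        moreover have "c' \<in> addable (set T)"
          using addable_insert_keep[OF cc(3,1,2)] False D by simp
        then have "b = c'"
          using inj_onD[OF content_inj_addable[OF is_path_diagram[of T]], of b c'] bc' S(1) by simp
        ultimately have "set ?S' = set ?S" using D D' Q by auto
        moreover have "?S' \<noteq> ?S"
          using D D' Q False cc by (auto simp: addable_def)
        ultimately show ?thesis unfolding block_def by blast
      qed
    qed
  qed
qed

text \<open>The mixed elements \<open>z\<^sub>1 s z\<^sub>2\<close> are split by inserting \<open>\<Sum> e\<^sub>R = 1\<close> on both sides of \<open>s\<close>.\<close>

lemma block_all:
  assumes "is_path S" "is_path S'" "length S = n" "length S' = n" "x \<in> GA n"
  shows "block S' S x"
  using assms
proof (induction n arbitrary: S S' x)
  case 0
  then obtain \<gamma> where "x = cs \<gamma> 1" using GA_0_1 by force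
  then show ?case using 0 by (auto simp: block_def)
next
  case (Suc k)
  obtain b T where S: "S = b # T" "length T = k" using Suc.prems by (auto simp: length_Suc_conv)
  obtain b' T' where S': "S' = b' # T'" "length T' = k" using Suc.prems by (auto simp: length_Suc_conv)
  show ?case
  proof (cases k)
    case 0
    obtain \<gamma> where "x = cs \<gamma> 1" using GA_0_1[OF Suc.prems(5)] 0 by auto
    moreover have "S' = S"
      using Suc.prems S S' 0 by (simp add: addable_empty)
    ultimately show ?thesis using gz_idem[OF Suc.prems(1)] by (auto simp: block_def)
  next
    case k: (Suc m)
    then have "k \<ge> 1" by simp
    from Suc.prems(5) this show ?thesis
    proof (induction rule: GA_Suc_induct)
      case (small x)
      then show ?case
        unfolding S S' using Suc.prems Suc.IH S S' by (intro block_small) auto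
    next
      case (mixed z1 z2)
      have "z1 * adj k * z2 = z1 * (\<Sum>R'\<in>paths k. gz R') * adj k * (\<Sum>R\<in>paths k. gz R) * z2"
        by (simp add: sum_gz)
      also have "\<dots> = (\<Sum>R'\<in>paths k. \<Sum>R\<in>paths k. z1 * gz R' * adj k * gz R * z2)"
        by (simp add: sum_distrib_left sum_distrib_right)
          (intro sum.swap)
      finally have e: "z1 * adj k * z2 = (\<Sum>R'\<in>paths k. \<Sum>R\<in>paths k. z1 * gz R' * adj k * gz R * z2)" .
      show ?case
        unfolding e
      proof (intro block_sum)
        fix R R' assume R: "R' \<in> paths k" "R \<in> paths k"
        then obtain c Q c' Q' where "R = c # Q" "length Q = m" "R' = c' # Q'" "length Q' = m"
          using k by (auto simp: paths_def length_Suc_conv)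
        then show "block S' S (z1 * gz R' * adj k * gz R * z2)"
          using block_mixed_term[of b T b' T' m c Q c' Q' z1 z2] Suc.prems S S' R k mixed Suc.IH
          by (simp add: paths_def)
      qed
    qed (auto intro: block_add block_cs)
  qed
qed


section \<open>Equivalence of the idempotents of one shape\<close>

text \<open>Equivalence of idempotents in the sense of Murray and von Neumann.\<close>

definition gz_equiv :: "nat \<Rightarrow> (nat \<times> nat) list \<Rightarrow> (nat \<times> nat) list \<Rightarrow> bool" where
  "gz_equiv n T T' \<longleftrightarrow> (\<exists>u\<in>GA n. \<exists>w\<in>GA n. w * u = gz T \<and> u * w = gz T' \<and>
     gz T' * u = u \<and> u * gz T = u \<and> gz T * w = w \<and> w * gz T' = w)"

lemma gz_equiv_refl: "is_path T \<Longrightarrow> length T \<le> n \<Longrightarrow> gz_equiv n T T"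
  unfolding gz_equiv_def by (intro bexI[of _ "gz T"]) (simp_all add: gz_idem)

lemma gz_equiv_sym: "gz_equiv n T T' \<Longrightarrow> gz_equiv n T' T"
  unfolding gz_equiv_def by blast

lemma gz_equiv_trans:
  assumes "gz_equiv n T T'" "gz_equiv n T' T''"
  shows "gz_equiv n T T''"
proof -
  obtain u w where 1: "u \<in> GA n" "w \<in> GA n" "w * u = gz T" "u * w = gz T'"
    "gz T' * u = u" "u * gz T = u" "gz T * w = w" "w * gz T' = w"
    using assms(1) unfolding gz_equiv_def by blast
  obtain u' w' where 2: "u' \<in> GA n" "w' \<in> GA n" "w' * u' = gz T'" "u' * w' = gz T''"
    "gz T'' * u' = u'" "u' * gz T' = u'" "gz T' * w' = w'" "w' * gz T'' = w'"
    using assms(2) unfolding gz_equiv_def by blast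
  have "(w * w') * (u' * u) = w * (w' * u') * u" by (simp only: mult.assoc)
  also have "\<dots> = gz T" by (simp only: 1 2)
  finally have wu: "(w * w') * (u' * u) = gz T" .
  have "(u' * u) * (w * w') = u' * (u * w) * w'" by (simp only: mult.assoc)
  also have "\<dots> = gz T''" by (simp only: 1 2)
  finally have "(u' * u) * (w * w') = gz T''" .
  moreover have "gz T'' * (u' * u) = u' * u" "gz T * (w * w') = w * w'"
    by (simp_all only: mult.assoc[symmetric] 1 2)
  moreover have "u' * u * gz T = u' * u" "w * w' * gz T'' = w * w'"
    by (simp_all only: mult.assoc 1 2)
  moreover note wu
  moreover have "u' * u \<in> GA n" "w * w' \<in> GA n"
    by (rule GA_mult 1 2)+
  ultimately show ?thesis
    unfolding gz_equiv_def by blast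
qed

lemma gz_equiv_Cons:
  assumes "gz_equiv n T T'" "length T = n" "length T' = n" "set T = set T'" "is_path T'" "is_path (b # T)"
  shows "gz_equiv (Suc n) (b # T) (b # T')"
proof -
  obtain u w where 1: "u \<in> GA n" "w \<in> GA n" "w * u = gz T" "u * w = gz T'"
    "gz T' * u = u" "u * gz T = u" "gz T * w = w" "w * gz T' = w"
    using assms(1) unfolding gz_equiv_def by blast
  define p where "p = peval (lag (set T) b) (JM (Suc n))"
  have pu: "p * u = u * p" "p * w = w * p"
    unfolding p_def using 1 by (simp_all add: peval_JM_commute)
  have g: "gz (b # T) = p * gz T" "gz (b # T') = p * gz T'"
    using assms by (simp_all add: p_def)
  have g': "gz (b # T) = gz T * p" "gz (b # T') = gz T' * p"
    using assms gz_Cons_right[of b T] gz_Cons_right[of b T'] by (simp_all add: p_def)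
  have pp: "p * (p * gz U) = p * gz U" if "is_path U" "set U = set T" "length U = n" for U
  proof -
    have "peval (lag (set U) b * lag (set U) b - lag (set U) b) (JM (Suc (length U))) * gz U = 0"
      using that(1,2) assms(6) by (intro peval_vanish) (auto simp: poly_lag[OF is_path_diagram])
    then show ?thesis
      using that(2,3) by (simp add: peval_diff peval_mult left_diff_distrib mult.assoc p_def)
  qed
  have pT: "p * (p * gz T) = p * gz T" "p * (p * gz T') = p * gz T'"
    using assms(2-6) by (simp_all add: pp)
  have pw2: "p * (p * w) = p * w"
  proof -
    have "p * (p * w) = p * (p * gz T) * w" by (simp only: mult.assoc 1)
    also have "\<dots> = p * w" by (simp only: pT) (simp only: mult.assoc 1)
    finally show ?thesis .
  qed
  have pu2: "p * (p * u) = p * u"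
  proof -
    have "p * (p * u) = p * (p * gz T') * u" by (simp only: mult.assoc 1)
    also have "\<dots> = p * u" by (simp only: pT) (simp only: mult.assoc 1)
    finally show ?thesis .
  qed
  have "p * w * (p * u) = w * (p * (p * u))" by (simp only: pu mult.assoc)
  also have "\<dots> = gz (b # T)" by (simp only: pu2) (simp only: mult.assoc[symmetric] pu(2)[symmetric], simp only: mult.assoc 1 g)
  finally have wu: "p * w * (p * u) = gz (b # T)" .
  have "p * u * (p * w) = u * (p * (p * w))" by (simp only: pu mult.assoc)
  also have "\<dots> = gz (b # T')" by (simp only: pw2) (simp only: mult.assoc[symmetric] pu(1)[symmetric], simp only: mult.assoc 1 g)
  finally have uw: "p * u * (p * w) = gz (b # T')" .
  have "gz (b # T') * (p * u) = p * (gz T' * (p * u))" by (simp only: g mult.assoc)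
  also have "gz T' * (p * u) = p * u" by (simp only: pu) (simp only: mult.assoc[symmetric] 1)
  finally have "gz (b # T') * (p * u) = p * u" by (simp only: pu2)
  moreover have "gz (b # T) * (p * w) = p * w"
  proof -
    have "gz (b # T) * (p * w) = p * (gz T * (p * w))" by (simp only: g mult.assoc)
    also have "gz T * (p * w) = p * w" by (simp only: pu) (simp only: mult.assoc[symmetric] 1)
    finally show ?thesis by (simp only: pw2)
  qed
  moreover have "p * u * gz (b # T) = p * u"
  proof -
    have "p * u * gz (b # T) = p * (u * gz T) * p" by (simp only: g' mult.assoc)
    also have "\<dots> = p * (p * u)" by (simp only: 1 mult.assoc) (simp only: pu)
    finally show ?thesis by (simp only: pu2)
  qed
  moreover have "p * w * gz (b # T') = p * w"
  proof -
    have "p * w * gz (b # T') = p * (w * gz T') * p" by (simp only: g' mult.assoc)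
    also have "\<dots> = p * (p * w)" by (simp only: 1 mult.assoc) (simp only: pu)
    finally show ?thesis by (simp only: pw2)
  qed
  moreover note wu uw
  moreover have "u \<in> GA (Suc n)" "w \<in> GA (Suc n)"
    using 1(1,2) GA_mono[of n "Suc n"] by auto
  then have "p * u \<in> GA (Suc n)" "p * w \<in> GA (Suc n)"
    by (simp_all add: p_def)
  ultimately show ?thesis unfolding gz_equiv_def by blast
qed

text \<open>The intertwiner exchanges the last two weights and preserves the others.\<close>

lemma phi_swaps:
  assumes S: "is_path (b # b' # Q)" and S': "is_path (b' # b # Q)"
  shows "gz (b' # b # Q) * (phi (Suc (length Q)) * gz (b # b' # Q)) = phi (Suc (length Q)) * gz (b # b' # Q)"
proof (rule gz_fixes_weight[OF S'])
  let ?S = "b # b' # Q" and ?S' = "b' # b # Q" and ?k = "Suc (length Q)"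
  note [simp del] = gz.simps
  have e: "JM i * gz ?S = cs (wt ?S i) (gz ?S)" if "i \<in> {1..Suc ?k}" for i
    using JM_gz[OF S, of i] that by simp
  fix i assume "i \<in> {1..length ?S'}"
  then consider "i = Suc ?k" | "i = ?k" | "i \<in> {1..length Q}" by fastforce
  then show "JM i * (phi ?k * gz ?S) = cs (wt ?S' i) (phi ?k * gz ?S)"
  proof cases
    case 1
    have "wt ?S' (Suc ?k) = wt ?S ?k" by (simp add: wt_def)
    then show ?thesis using e[of ?k] phi_JM[of ?k] 1 by (simp add: mult.assoc[symmetric]) (simp add: mult.assoc)
  next
    case 2
    have "wt ?S' ?k = wt ?S (Suc ?k)" by (simp add: wt_def)
    then show ?thesis
      using e[of "Suc ?k"] phi_JM_Suc[of ?k, symmetric] 2 by (simp add: mult.assoc[symmetric]) (simp add: mult.assoc)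
  next
    case 3
    then have J: "JM i \<in> GA (length Q)" by simp
    have "JM i * (JM ?k * adj ?k) = JM ?k * adj ?k * JM i" "JM i * (adj ?k * JM ?k) = adj ?k * JM ?k * JM i"
      using adj_commute[OF J] JM_Suc_commute[OF J] by (metis mult.assoc)+
    then have "JM i * phi ?k = phi ?k * JM i"
      by (simp only: phi_def left_diff_distrib right_diff_distrib)
    moreover have "wt ?S' i = wt ?S i" using 3 by (simp add: wt_def Suc_diff_le)
    ultimately show ?thesis using e[of i] 3 by (simp add: mult.assoc[symmetric]) (simp add: mult.assoc)
  qed
qed

lemma phi_phi_gz:
  assumes S: "is_path (b # b' # Q)"
  defines "d \<equiv> of_int (content b) - of_int (content b')"
  shows "phi (Suc (length Q)) * (phi (Suc (length Q)) * gz (b # b' # Q)) = cs (1 - d * d) (gz (b # b' # Q))"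
proof -
  let ?S = "b # b' # Q" and ?k = "Suc (length Q)"
  note [simp del] = gz.simps
  have "JM (Suc ?k) * gz ?S = cs (of_int (content b)) (gz ?S)" "JM ?k * gz ?S = cs (of_int (content b')) (gz ?S)"
    using JM_gz[OF S, of ?k] JM_gz[OF S, of "Suc ?k"] by (simp_all add: wt_def)
  then have "(JM (Suc ?k) - JM ?k) * gz ?S = cs d (gz ?S)"
    by (simp add: left_diff_distrib d_def ga.scale_left_diff_distrib)
  then have "(JM (Suc ?k) - JM ?k) * ((JM (Suc ?k) - JM ?k) * gz ?S) = cs (d * d) (gz ?S)"
    by simp
  then have "(1 - (JM (Suc ?k) - JM ?k) * (JM (Suc ?k) - JM ?k)) * gz ?S = gz ?S - cs (d * d) (gz ?S)"
    by (simp only: left_diff_distrib[of 1] mult_1 mult.assoc)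
  then show ?thesis
    by (simp only: mult.assoc[symmetric] phi_phi[of ?k] ga.scale_left_diff_distrib ga.scale_one)
qed

text \<open>On the two paths the square of the intertwiner is \<open>1 - d\<^sup>2\<close> with \<open>d\<close> the difference of the two
  contents, and \<open>\<bar>d\<bar> \<ge> 2\<close> because both boxes are addable to the same diagram.\<close>

lemma gz_equiv_swap:
  assumes S: "is_path (b # b' # Q)" and S': "is_path (b' # b # Q)" and ne: "b \<noteq> b'"
  shows "gz_equiv (Suc (Suc (length Q))) (b # b' # Q) (b' # b # Q)"
proof -
  let ?S = "b # b' # Q" and ?S' = "b' # b # Q" and ?k = "Suc (length Q)"
  let ?f = "phi ?k" and ?d = "of_int (content b) - of_int (content b') :: complex"
  note [simp del] = gz.simps
  define \<kappa> where "\<kappa> = 1 - ?d * ?d"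
  have "is_path Q" "b \<in> addable (set Q)" "b' \<in> addable (set Q)"
    using S S' by simp_all
  then have "\<bar>content b - content b'\<bar> \<ge> 2"
    using ne by (rule addable_content_gap[OF is_path_diagram])
  then have "(content b - content b') * (content b - content b') \<noteq> 1"
    by (auto simp: zmult_eq_1_iff)
  then have "(of_int ((content b - content b') * (content b - content b')) :: complex) \<noteq> 1"
    by (simp only: of_int_eq_1_iff not_False_eq_True)
  then have \<kappa>: "\<kappa> \<noteq> 0"
    unfolding \<kappa>_def by simp
  have 1: "?f * (?f * gz ?S) = cs \<kappa> (gz ?S)"
    using phi_phi_gz[OF S] by (simp add: \<kappa>_def)
  have 2: "?f * (?f * gz ?S') = cs \<kappa> (gz ?S')"
    using phi_phi_gz[OF S'] by (simp add: \<kappa>_def algebra_simps)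
  have sw: "gz ?S' * (?f * gz ?S) = ?f * gz ?S" "gz ?S * (?f * gz ?S') = ?f * gz ?S'"
    using phi_swaps[OF S S'] phi_swaps[OF S' S] by simp_all
  define u w where "u = ?f * gz ?S" and "w = cs (1 / \<kappa>) (?f * gz ?S')"
  have id: "gz ?S * gz ?S = gz ?S" "gz ?S' * gz ?S' = gz ?S'"
    using S S' by (simp_all only: gz_idem)
  have "w * u = gz ?S" "u * w = gz ?S'"
    using sw 1 2 \<kappa> by (simp_all add: u_def w_def mult.assoc)
  moreover have "gz ?S' * u = u" "u * gz ?S = u" "gz ?S * w = w" "w * gz ?S' = w"
    using sw id by (simp_all add: u_def w_def mult.assoc)
  moreover have "u \<in> GA (Suc ?k)" "w \<in> GA (Suc ?k)"
    by (simp_all add: u_def w_def phi_in_GA)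
  ultimately show ?thesis unfolding gz_equiv_def by blast
qed

lemma is_diagram_Int: "is_diagram D \<Longrightarrow> is_diagram D' \<Longrightarrow> is_diagram (D \<inter> D')"
  unfolding is_diagram_def by (intro conjI finite_Int) (blast+)

lemma removable_addable:
  assumes "is_diagram D" "b \<in> removable D"
  shows "is_diagram (D - {b})" "b \<in> addable (D - {b})" "insert b (D - {b}) = D"
proof -
  show 1: "is_diagram (D - {b})" using assms(2) by (simp add: removable_def)
  show 2: "insert b (D - {b}) = D" using assms(2) by (intro insert_Diff) (simp add: removable_def)
  show "b \<in> addable (D - {b})" unfolding addable_def mem_Collect_eq 2 using assms(1) by simp
qed

text \<open>A box that maximises row plus column is a removable corner.\<close>

lemma diagram_path:
  assumes "is_diagram D"
  shows "\<exists>T. is_path T \<and> set T = D"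
  using assms
proof (induction "card D" arbitrary: D)
  case 0
  then show ?case by (intro exI[of _ "[]"]) (auto simp: is_diagram_def)
next
  case (Suc n)
  have fin: "finite D" using Suc by (simp add: is_diagram_def)
  define N where "N = Max ((\<lambda>b. fst b + snd b) ` D)"
  have ne: "D \<noteq> {}" using Suc by auto
  have "N \<in> (\<lambda>b. fst b + snd b) ` D" unfolding N_def using fin ne by (intro Max_in) auto
  then obtain r c where rc: "(r, c) \<in> D" "N = r + c" by auto
  have mx: "r' + c' \<le> N" if "(r', c') \<in> D" for r' c'
  proof -
    have "r' + c' \<in> (\<lambda>b. fst b + snd b) ` D" using that by (intro image_eqI[of _ _ "(r', c')"]) simp_all
    then show ?thesis unfolding N_def using fin by (intro Max_ge) simp_all
  qed
  from mx[of "Suc r" c] mx[of r "Suc c"] have "(r, c) \<in> removable D"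
    using rc by (auto simp: removable_iff[OF Suc.prems])
  then have rem: "is_diagram (D - {(r, c)})" "(r, c) \<in> addable (D - {(r, c)})" "insert (r, c) (D - {(r, c)}) = D"
    using removable_addable[OF Suc.prems] by blast+
  have "card (D - {(r, c)}) = n" using Suc fin rc by simp
  then obtain T where "is_path T" "set T = D - {(r, c)}" using Suc.hyps(1) rem(1) by metis
  then show ?case using rem by (intro exI[of _ "(r, c) # T"]) simp
qed

lemma is_path_distinct: "is_path T \<Longrightarrow> distinct T"
  by (induction T) (auto simp: addable_def)

lemma is_path_length: "is_path T \<Longrightarrow> length T = card (set T)"
  by (simp add: is_path_distinct distinct_card)

text \<open>Two paths to the same diagram with different last boxes \<open>b\<close> and \<open>b'\<close> are linked through
  the two paths that add \<open>b\<close> and \<open>b'\<close> last, in either order.\<close>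

lemma gz_equiv_same_set:
  assumes "is_path S" "is_path S'" "set S = set S'"
  shows "gz_equiv (length S) S S'"
  using assms
proof (induction "length S" arbitrary: S S')
  case 0
  then show ?case using gz_equiv_refl[of "[]" 0] by simp
next
  case (Suc n)
  have l: "length S' = Suc n" using Suc is_path_length[of S] is_path_length[of S'] by simp
  obtain b T where S: "S = b # T" "length T = n" using Suc.hyps(2) by (cases S) auto
  obtain b' T' where S': "S' = b' # T'" "length T' = n" using l by (cases S') auto
  have p: "is_path T" "is_path T'" "b \<in> addable (set T)" "b' \<in> addable (set T')"
    using Suc.prems S S' by auto
  have sT: "b \<notin> set T" "b' \<notin> set T'" "insert b (set T) = insert b' (set T')"
    using p Suc.prems(3) S(1) S'(1) by (simp_all add: addable_def)
  have same: "gz_equiv (Suc n) (a # U) (a # U')"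
    if "is_path (a # U)" "is_path U'" "set U = set U'" "length U = n" for a U U'
  proof -
    have U: "is_path U" using that(1) by simp
    have U': "length U' = n"
      using is_path_length[OF U] is_path_length[OF that(2)] that(3,4) by simp
    have "gz_equiv (length U) U U'"
      by (rule Suc.hyps(1)[OF _ U that(2,3)]) (simp add: that(4))
    then have "gz_equiv n U U'" by (simp add: that(4))
    then show ?thesis by (rule gz_equiv_Cons[OF _ that(4) U' that(3,2,1)])
  qed
  show ?case
  proof (cases "b = b'")
    case True
    have "gz_equiv (Suc n) (b # T) (b # T')"
    proof (rule same)
      show "is_path (b # T)" "is_path T'" "length T = n" using p S by simp_all
      show "set T = set T'" using sT True by (metis insert_ident)
    qed
    then show ?thesis using S S' True by simp
  next
    case False
    \<comment> \<open>\<open>D\<close> is the diagram without both last boxes\<close>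
    define D where "D = set T \<inter> set T'"
    have "is_diagram D"
      using is_path_diagram[OF p(1)] is_path_diagram[OF p(2)] unfolding D_def by (rule is_diagram_Int)
    from diagram_path[OF this] obtain Q where Q: "is_path Q" "set Q = D" by auto
    have D: "set T = insert b' D" "set T' = insert b D" "b \<notin> D" "b' \<notin> D"
    proof -
      have 1: "b' \<in> set T" "b \<in> set T'" using sT(3) False by (metis insertE insertI1)+
      have 2: "set T \<subseteq> insert b' (set T')" "set T' \<subseteq> insert b (set T)"
        unfolding sT(3)[symmetric] by (rule subset_insertI, unfold sT(3), rule subset_insertI)
      show "set T = insert b' D" unfolding D_def using 1(1) 2(1) by blast
      show "set T' = insert b D" unfolding D_def using 1(2) 2(2) by blast
      show "b \<notin> D" "b' \<notin> D" unfolding D_def using sT(1,2) by blast+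
    qed
    have a: "b \<in> addable D" "b' \<in> addable D"
      using D(3,4) is_path_diagram[OF p(1)] is_path_diagram[OF p(2)]
      unfolding addable_def mem_Collect_eq D(1,2) by blast+
    have P: "is_path (b' # Q)" "is_path (b # Q)"
      unfolding is_path.simps Q(2) using Q(1) a by blast+
    have P': "is_path (b # b' # Q)" "is_path (b' # b # Q)"
      using P p(3,4) unfolding is_path.simps(2)[of b] is_path.simps(2)[of b'] list.set(2) Q(2) D(1,2) by blast+
    have "length (b' # Q) = length T" "length (b # Q) = length T'"
      unfolding is_path_length[OF P(1)] is_path_length[OF P(2)] is_path_length[OF p(1)] is_path_length[OF p(2)]
      by (simp_all add: D Q)
    then have len: "Suc (length Q) = n" using S by simp
    then have "gz_equiv (Suc n) (b # b' # Q) (b' # b # Q)"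
      using gz_equiv_swap[OF P' False] by simp
    moreover have "gz_equiv (Suc n) (b # T) (b # b' # Q)"
    proof (rule same)
      show "is_path (b # T)" using p(1,3) by simp
      show "set T = set (b' # Q)" unfolding D(1) list.set(2) Q(2) ..
    qed (fact S(2) P(1))+
    moreover have "gz_equiv (Suc n) (b' # T') (b' # b # Q)"
    proof (rule same)
      show "is_path (b' # T')" using p(2,4) by simp
      show "set T' = set (b # Q)" unfolding D(2) list.set(2) Q(2) ..
    qed (fact S'(2) P(2))+
    ultimately have "gz_equiv (Suc n) (b # T) (b' # T')"
      by (metis gz_equiv_sym gz_equiv_trans)
    then show ?thesis using S S' by simp
  qed
qed

lemma gz_block_zero:
  assumes "T \<in> paths n" "T' \<in> paths n" "set T' \<noteq> set T" "x \<in> GA n"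
  shows "gz T' * x * gz T = 0"
  using block_all[of T T' n x] assms by (auto simp: block_def paths_def)

text \<open>Composition with an equivalence maps the block into the scalars \<open>e\<^bsub>T'\<^esub> A\<^sub>n e\<^bsub>T'\<^esub>\<close>.\<close>

lemma gz_block_one_dim:
  assumes "T \<in> paths n" "T' \<in> paths n" "set T' = set T"
  obtains u where "u \<in> GA n" "u \<noteq> 0" "gz T' * u = u" "u * gz T = u"
    "\<And>x. x \<in> GA n \<Longrightarrow> \<exists>\<gamma>. gz T' * x * gz T = cs \<gamma> u"
    "\<exists>w\<in>GA n. w * u = gz T"
proof -
  have p: "is_path T" "is_path T'" "length T = n" "length T' = n" using assms by (auto simp: paths_def)
  then obtain u w where u: "u \<in> GA n" "w \<in> GA n" "w * u = gz T" "u * w = gz T'"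
    "gz T' * u = u" "u * gz T = u" "gz T * w = w" "w * gz T' = w"
    using gz_equiv_same_set[of T T'] assms(3) unfolding gz_equiv_def by auto
  have "\<exists>\<gamma>. gz T' * x * gz T = cs \<gamma> u" if x: "x \<in> GA n" for x
  proof -
    obtain \<gamma> where g: "gz T' * (x * w) * gz T' = cs \<gamma> (gz T')"
      using block_all[of T' T' n "x * w"] p x u by (auto simp: block_def)
    have "gz T' * x * gz T = gz T' * (x * w) * gz T' * u"
      using u by (metis mult.assoc)
    then show ?thesis using g u by auto
  qed
  moreover have "u \<noteq> 0" using u(3) gz_nonzero[OF p(1)] by auto
  ultimately show ?thesis using that u by blast
qed


section \<open>Standard tableaux as paths\<close>

lemma down_closed_eq_lessThan:
  fixes S :: "nat set"
  assumes "finite S" "\<And>x y. x \<in> S \<Longrightarrow> y \<le> x \<Longrightarrow> y \<in> S"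
  shows "S = {..<card S}"
proof -
  have "{..<card S} \<subseteq> S"
  proof
    fix x assume x: "x \<in> {..<card S}"
    show "x \<in> S"
    proof (rule ccontr)
      assume "x \<notin> S"
      then have "S \<subseteq> {..<x}" using assms(2) by (metis lessThan_iff not_le_imp_less subsetI)
      then have "card S \<le> x" using card_mono[of "{..<x}" S] by simp
      then show False using x by simp
    qed
  qed
  then show ?thesis using card_subset_eq[OF assms(1), of "{..<card S}"] by simp
qed

lemma young_diagram_is_diagram:
  assumes "D \<in> young_diagrams n"
  shows "is_diagram D"
proof -
  obtain ls where ls: "is_partition n ls" and D: "D = diagram ls"
    using assms by (auto simp: young_diagrams_def)
  have mono: "ls ! r \<le> ls ! r'" if "r' \<le> r" "r < length ls" for r r'
    using ls that sorted_wrt_nth_less[of "(\<ge>)" ls r' r]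
    by (cases "r' = r") (auto simp: is_partition_def)
  have "D \<subseteq> (SIGMA r:{..<length ls}. {..<ls ! r})" by (auto simp: D diagram_def)
  then have "finite D" by (rule finite_subset) auto
  moreover have "(r', c') \<in> D" if "(r, c) \<in> D" "r' \<le> r" "c' \<le> c" for r c r' c'
    using that mono[of r' r] by (auto simp: D diagram_def)
  ultimately show ?thesis unfolding is_diagram_def by blast
qed

text \<open>The partition consists of the row lengths; rows and the first column are initial segments.\<close>

lemma is_diagram_young_diagram:
  assumes D: "is_diagram D"
  shows "D \<in> young_diagrams (card D)"
proof -
  define row where "row = (\<lambda>r. {c. (r, c) \<in> D})"
  define h where "h = card {r. (r, 0) \<in> D}"
  have fin: "finite D" using D by (simp add: is_diagram_def)
  have finrow: "finite (row r)" for r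
    unfolding row_def by (rule finite_subset[OF _ finite_imageI[OF fin, of snd]]) force
  have fincol: "finite {r. (r, 0) \<in> D}"
    by (rule finite_subset[OF _ finite_imageI[OF fin, of fst]]) force
  have row: "row r = {..<card (row r)}" for r
    by (rule down_closed_eq_lessThan[OF finrow]) (use is_diagramD[OF D] in \<open>auto simp: row_def\<close>)
  have col: "{r. (r, 0) \<in> D} = {..<h}"
    unfolding h_def by (rule down_closed_eq_lessThan[OF fincol]) (use is_diagramD[OF D] in auto)
  define ls where "ls = map (\<lambda>r. card (row r)) [0..<h]"
  have in_D: "(r, c) \<in> D \<longleftrightarrow> r < h \<and> c < card (row r)" for r c
  proof -
    have "(r, c) \<in> D \<longleftrightarrow> (r, 0) \<in> D \<and> c \<in> row r"
      using is_diagramD[OF D, of r c r 0] by (auto simp: row_def)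
    also have "\<dots> \<longleftrightarrow> r < h \<and> c < card (row r)"
      using row[of r] col by blast
    finally show ?thesis .
  qed
  have "diagram ls = D"
    by (auto simp: diagram_def ls_def in_D)
  moreover have "is_partition (card D) ls"
    unfolding is_partition_def
  proof (intro conjI)
    have "card (row r') \<le> card (row r)" if "r \<le> r'" for r r'
      using is_diagramD[OF D, of r' _ r] that by (intro card_mono finrow) (auto simp: row_def)
    then show "sorted_wrt (\<ge>) ls"
      by (auto simp: ls_def sorted_wrt_iff_nth_less)
    have "card (row r) \<noteq> 0" if "r < h" for r
      using that col finrow[of r] by (auto simp: row_def)
    then show "0 \<notin> set ls" unfolding ls_def set_map image_iff by (metis atLeastLessThan_iff set_upt)
    have "D = (SIGMA r:{..<h}. row r)"
      using col is_diagramD[OF D, of _ _ _ 0] by (auto simp: row_def)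
    then have "card D = (\<Sum>r<h. card (row r))"
      using finrow by (metis card_SigmaI finite_lessThan)
    also have "\<dots> = sum_list ls"
      by (simp add: ls_def sum_list_distinct_conv_sum_set lessThan_atLeast0)
    finally show "sum_list ls = card D" ..
  qed
  ultimately show ?thesis unfolding young_diagrams_def by blast
qed

fun path_of :: "tableau \<Rightarrow> nat \<Rightarrow> (nat \<times> nat) list" where
  "path_of T 0 = []"
| "path_of T (Suc k) = box_of T (Suc k) # path_of T k"

lemma length_path_of [simp]: "length (path_of T k) = k"
  by (induction k) auto

lemma nth_path_of: "j < k \<Longrightarrow> path_of T k ! j = box_of T (k - j)"
  by (induction k arbitrary: j) (auto simp: nth_Cons')

text \<open>The inverse of \<open>path_of\<close>.\<close>

fun tab :: "(nat \<times> nat) list \<Rightarrow> tableau" where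
  "tab [] = (\<lambda>_. 0)"
| "tab (b # p) = (tab p)(b := Suc (length p))"

lemma box_of_inverse:
  assumes "standard n T"
  shows "i \<in> {1..n} \<Longrightarrow> box_of T i \<in> shape T \<and> T (box_of T i) = i"
    and "b \<in> shape T \<Longrightarrow> box_of T (T b) = b"
proof -
  have b: "bij_betw T (shape T) {1..n}" using assms by (simp add: standard_def)
  show "box_of T i \<in> shape T \<and> T (box_of T i) = i" if "i \<in> {1..n}"
    using that b unfolding box_of_def bij_betw_def by (metis f_inv_into_f inv_into_into)
  show "box_of T (T b) = b" if "b \<in> shape T"
    using that b unfolding box_of_def bij_betw_def by (simp add: inv_into_f_f)
qed

lemma set_path_of:
  assumes "standard n T" "k \<le> n"
  shows "set (path_of T k) = {b. T b \<noteq> 0 \<and> T b \<le> k}"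
  using assms(2)
proof (induction k)
  case (Suc k)
  have box: "T (box_of T (Suc k)) = Suc k"
    using box_of_inverse(1)[OF assms(1), of "Suc k"] Suc.prems by simp
  have inv: "T b = Suc k \<longleftrightarrow> b = box_of T (Suc k)" for b
  proof
    assume h: "T b = Suc k"
    then have "b \<in> shape T" by (simp add: shape_def)
    from box_of_inverse(2)[OF assms(1) this] h show "b = box_of T (Suc k)" by simp
  qed (simp add: box)
  have "{b. T b \<noteq> 0 \<and> T b \<le> Suc k} = insert (box_of T (Suc k)) {b. T b \<noteq> 0 \<and> T b \<le> k}"
    unfolding set_eq_iff mem_Collect_eq insert_iff inv[symmetric] by (intro allI) auto
  then show ?case using Suc by simp
qed auto

lemma shape_subtableau:
  assumes "standard n T" "k \<le> n"
  shows "shape (subtableau T k) = set (path_of T k)"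
  unfolding set_path_of[OF assms] by (auto simp: shape_def subtableau_def)

lemma set_path_of_full: "standard n T \<Longrightarrow> set (path_of T n) = shape T"
  by (subst set_path_of) (auto simp: shape_def standard_def bij_betw_def)

lemma is_diagram_initial:
  assumes T: "standard n T"
  shows "is_diagram {b. T b \<noteq> 0 \<and> T b \<le> k}"
proof -
  have d: "is_diagram (shape T)" using T young_diagram_is_diagram by (auto simp: standard_def)
  have row: "(r, c) \<in> shape T \<Longrightarrow> (r, c') \<in> shape T \<Longrightarrow> c \<le> c' \<Longrightarrow> T (r, c) \<le> T (r, c')"
    and col: "(r, c) \<in> shape T \<Longrightarrow> (r', c) \<in> shape T \<Longrightarrow> r \<le> r' \<Longrightarrow> T (r, c) \<le> T (r', c)" for r c r' c'
    using T unfolding standard_def by (metis le_eq_less_or_eq)+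
  show ?thesis
    unfolding is_diagram_def
  proof (intro conjI allI impI)
    show "finite {b. T b \<noteq> 0 \<and> T b \<le> k}"
      using d by (auto simp: is_diagram_def shape_def intro: finite_subset)
    fix r c r' c' assume h: "(r, c) \<in> {b. T b \<noteq> 0 \<and> T b \<le> k} \<and> r' \<le> r \<and> c' \<le> c"
    then have "(r, c) \<in> shape T" by (simp add: shape_def)
    then have s: "(r', c) \<in> shape T" "(r', c') \<in> shape T"
      using is_diagramD[OF d] h by blast+
    then have "T (r', c') \<le> T (r, c)"
      using row[of r' c' c] col[of r' c r] h \<open>(r, c) \<in> shape T\<close> by (meson order_trans)
    then show "(r', c') \<in> {b. T b \<noteq> 0 \<and> T b \<le> k}" using s h by (simp add: shape_def)
  qed
qed

lemma is_path_path_of: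
  assumes T: "standard n T" and k: "k \<le> n"
  shows "is_path (path_of T k)"
  using k
proof (induction k)
  case (Suc k)
  have "is_diagram (set (path_of T (Suc k)))"
    unfolding set_path_of[OF T Suc.prems] by (rule is_diagram_initial[OF T])
  moreover have "T (box_of T (Suc k)) = Suc k"
    using box_of_inverse(1)[OF T, of "Suc k"] Suc.prems by simp
  then have "box_of T (Suc k) \<notin> set (path_of T k)"
    using Suc.prems by (subst set_path_of[OF T]) simp_all
  moreover have "is_path (path_of T k)" using Suc by simp
  ultimately show ?case by (simp add: addable_def)
qed simp

lemma path_of_in_paths: "standard n T \<Longrightarrow> k \<le> n \<Longrightarrow> path_of T k \<in> paths k"
  by (simp add: paths_def is_path_path_of)

lemma cont_eq_wt: "i \<in> {1..n} \<Longrightarrow> cont T i = wt (path_of T n) i"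
  by (simp add: cont_def wt_def nth_path_of)

lemma shape_tab: "shape (tab p) = set p"
proof -
  have "tab p b \<noteq> 0 \<longleftrightarrow> b \<in> set p" for b
    by (induction p) simp_all
  then show ?thesis by (simp add: shape_def)
qed

lemma tab_le: "tab p b \<le> length p"
  by (induction p) auto

lemma tab_nth: "distinct p \<Longrightarrow> j < length p \<Longrightarrow> tab p (p ! j) = length p - j"
proof (induction p arbitrary: j)
  case (Cons b p)
  then show ?case by (cases j) auto
qed simp

lemma bij_tab:
  assumes "distinct p"
  shows "bij_betw (tab p) (set p) {1..length p}"
proof (rule bij_betw_imageI)
  show "inj_on (tab p) (set p)"
  proof (rule inj_onI)
    fix x y assume "x \<in> set p" "y \<in> set p" and eq: "tab p x = tab p y"
    then obtain i j where "i < length p" "x = p ! i" "j < length p" "y = p ! j"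
      unfolding in_set_conv_nth by blast
    moreover have "i = j" using calculation eq assms by (simp add: tab_nth)
    ultimately show "x = y" by simp
  qed
  have "i \<in> tab p ` set p" if "i \<in> {1..length p}" for i
    using that assms by (intro image_eqI[of _ _ "p ! (length p - i)"]) (auto simp: tab_nth)
  moreover have "tab p b \<in> {1..length p}" if "b \<in> set p" for b
    using that assms tab_le[of p b] by (auto simp: in_set_conv_nth tab_nth)
  ultimately show "tab p ` set p = {1..length p}" by blast
qed

lemma tab_increasing:
  assumes "is_path p" "(r, c) \<in> set p" "(r', c') \<in> set p" "r \<le> r'" "c \<le> c'" "(r, c) \<noteq> (r', c')"
  shows "tab p (r, c) < tab p (r', c')"
  using assms
proof (induction p)
  case (Cons b p)
  note d = is_path_diagram[of p]
  consider "(r', c') = b" | "(r, c) = b" "(r', c') \<in> set p" | "(r', c') \<noteq> b" "(r, c) \<noteq> b"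
    using Cons.prems by auto
  then show ?case
  proof cases
    case 1
    moreover have "(r, c) \<noteq> b" using 1 Cons.prems by blast
    ultimately show ?thesis using tab_le[of p "(r, c)"] by simp
  next
    case 2
    have "(r, c) \<in> set p"
      using Cons.prems 2 by (intro is_diagramD[OF d, of r' c' r c]) simp_all
    moreover have "(r, c) \<notin> set p" using 2 Cons.prems(1) by (simp add: addable_def)
    ultimately show ?thesis by simp
  next
    case 3
    then have "tab p (r, c) < tab p (r', c')"
      using Cons.prems by (intro Cons.IH) auto
    then show ?thesis using 3 by simp
  qed
qed simp

lemma standard_tab:
  assumes "p \<in> paths n"
  shows "standard n (tab p)"
proof -
  have p: "is_path p" "length p = n" using assms by (auto simp: paths_def)
  show ?thesis
    unfolding standard_def shape_tab
  proof (intro conjI allI impI)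
    show "set p \<in> young_diagrams n"
      using is_diagram_young_diagram[OF is_path_diagram[OF p(1)]] is_path_length[OF p(1)] p(2) by simp
    show "bij_betw (tab p) (set p) {1..n}"
      using bij_tab[OF is_path_distinct[OF p(1)]] p(2) by simp
    fix r c c' assume "(r, c) \<in> set p \<and> (r, c') \<in> set p \<and> c < c'"
    then show "tab p (r, c) < tab p (r, c')"
      by (intro tab_increasing[OF p(1)]) simp_all
  next
    fix r r' c assume "(r, c) \<in> set p \<and> (r', c) \<in> set p \<and> r < r'"
    then show "tab p (r, c) < tab p (r', c)"
      by (intro tab_increasing[OF p(1)]) simp_all
  qed
qed

lemma path_of_tab:
  assumes "p \<in> paths n"
  shows "path_of (tab p) n = p"
proof (rule nth_equalityI)
  have p: "is_path p" "length p = n" using assms by (auto simp: paths_def)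
  show "length (path_of (tab p) n) = length p" using p by simp
  fix j assume "j < length (path_of (tab p) n)"
  then have j: "j < n" by simp
  have "box_of (tab p) (tab p (p ! j)) = p ! j"
    using box_of_inverse(2)[OF standard_tab[OF assms]] j p(2) by (simp add: shape_tab)
  then show "path_of (tab p) n ! j = p ! j"
    using j p is_path_distinct[OF p(1)] by (simp add: nth_path_of tab_nth)
qed

lemma path_of_inj:
  assumes T: "standard n T" and T': "standard n T'" and eq: "path_of T n = path_of T' n"
  shows "T = T'"
proof
  fix b
  have sh: "shape T = shape T'" using set_path_of_full[OF T] set_path_of_full[OF T'] eq by simp
  show "T b = T' b"
  proof (cases "b \<in> shape T")
    case True
    have i: "T b \<in> {1..n}" using T True unfolding standard_def bij_betw_def by blast
    have "box_of T (T b) = box_of T' (T b)"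
      using arg_cong[OF eq, of "\<lambda>p. p ! (n - T b)"] i by (simp add: nth_path_of)
    then have "b = box_of T' (T b)" using box_of_inverse(2)[OF T True] by simp
    then show ?thesis using box_of_inverse(1)[OF T' i] by metis
  next
    case False
    then have "b \<notin> shape T'" using sh by simp
    with False show ?thesis by (simp add: shape_def)
  qed
qed

lemma bij_path_of_shape:
  "bij_betw (\<lambda>T. path_of T n) (std_tableaux n D) {p \<in> paths n. set p = D}"
proof (rule bij_betw_imageI)
  show "inj_on (\<lambda>T. path_of T n) (std_tableaux n D)"
    using path_of_inj by (auto simp: inj_on_def std_tableaux_def)
  have "p \<in> (\<lambda>T. path_of T n) ` std_tableaux n D" if "p \<in> paths n" "set p = D" for p
    using standard_tab[OF that(1)] path_of_tab[OF that(1)] shape_tab[of p] that(2)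
    by (intro image_eqI[of _ _ "tab p"]) (simp_all add: std_tableaux_def)
  moreover have "path_of T n \<in> paths n \<and> set (path_of T n) = D" if "T \<in> std_tableaux n D" for T
    using that path_of_in_paths[of n T n] set_path_of_full[of n T] by (auto simp: std_tableaux_def)
  ultimately show "(\<lambda>T. path_of T n) ` std_tableaux n D = {p \<in> paths n. set p = D}" by blast
qed


section \<open>Transport of modules\<close>

lemma is_moduleD:
  assumes "is_module k act W"
  shows "fn.subspace W"
    and "\<sigma> \<in> sym_group k \<Longrightarrow> v \<in> W \<Longrightarrow> act \<sigma> v \<in> W"
    and "\<sigma> \<in> sym_group k \<Longrightarrow> v \<in> W \<Longrightarrow> w \<in> W \<Longrightarrow> act \<sigma> (v + w) = act \<sigma> v + act \<sigma> w"
    and "\<sigma> \<in> sym_group k \<Longrightarrow> v \<in> W \<Longrightarrow> act \<sigma> (fscale c v) = fscale c (act \<sigma> v)"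
    and "v \<in> W \<Longrightarrow> act id v = v"
    and "\<sigma> \<in> sym_group k \<Longrightarrow> \<tau> \<in> sym_group k \<Longrightarrow> v \<in> W \<Longrightarrow> act (\<sigma> \<circ> \<tau>) v = act \<sigma> (act \<tau> v)"
  using assms unfolding is_module_def by blast+

definition linear_on :: "('a \<Rightarrow> complex) set \<Rightarrow> (('a \<Rightarrow> complex) \<Rightarrow> ('b \<Rightarrow> complex)) \<Rightarrow> bool" where
  "linear_on W f \<longleftrightarrow> (\<forall>v\<in>W. \<forall>w\<in>W. f (v + w) = f v + f w) \<and> (\<forall>v\<in>W. \<forall>c. f (fscale c v) = fscale c (f v))"

lemma linear_onD:
  assumes "linear_on W f"
  shows "v \<in> W \<Longrightarrow> w \<in> W \<Longrightarrow> f (v + w) = f v + f w" "v \<in> W \<Longrightarrow> f (fscale c v) = fscale c (f v)"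
  using assms unfolding linear_on_def by blast+

lemma linear_on_0:
  assumes "linear_on W f" "fn.subspace W"
  shows "f 0 = 0"
  using linear_onD(2)[OF assms(1) fn.subspace_0[OF assms(2)], of 0]
  by (simp only: fn.scale_zero_left)

lemma linear_on_sum:
  assumes "linear_on W f" "fn.subspace W" "\<And>i. i \<in> I \<Longrightarrow> g i \<in> W"
  shows "f (\<Sum>i\<in>I. g i) = (\<Sum>i\<in>I. f (g i))"
  using assms(3)
proof (induction I rule: infinite_finite_induct)
  case (insert i I)
  have "f (\<Sum>i\<in>insert i I. g i) = f (g i + (\<Sum>i\<in>I. g i))" by (simp only: sum.insert[OF insert(1,2)])
  also have "\<dots> = f (g i) + f (\<Sum>i\<in>I. g i)"
    using insert.prems by (intro linear_onD(1)[OF assms(1)] fn.subspace_sum[OF assms(2)]) blast+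
  also have "f (\<Sum>i\<in>I. g i) = (\<Sum>i\<in>I. f (g i))" using insert.prems by (intro insert.IH) blast
  finally show ?case by (simp only: sum.insert[OF insert(1,2)])
qed (simp_all only: sum.infinite sum.empty linear_on_0[OF assms(1,2)] not_False_eq_True)

lemma module_image:
  assumes M: "is_module k act W" and lin: "linear_on W f"
    and eq: "\<And>\<sigma> v. \<sigma> \<in> sym_group k \<Longrightarrow> v \<in> W \<Longrightarrow> act' \<sigma> (f v) = f (act \<sigma> v)"
  shows "is_module k act' (f ` W)"
proof -
  note m = is_moduleD[OF M] and l = linear_onD[OF lin]
  have sub: "fn.subspace (f ` W)"
  proof (rule fn.subspaceI)
    show "0 \<in> f ` W"
      using linear_on_0[OF lin m(1)] fn.subspace_0[OF m(1)] by (metis image_eqI)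
    show "x + y \<in> f ` W" if "x \<in> f ` W" "y \<in> f ` W" for x y
    proof -
      obtain v w where "v \<in> W" "w \<in> W" "x = f v" "y = f w" using \<open>x \<in> f ` W\<close> \<open>y \<in> f ` W\<close> by blast
      then show ?thesis using l(1) fn.subspace_add[OF m(1)] by (metis image_eqI)
    qed
    show "fscale c x \<in> f ` W" if "x \<in> f ` W" for c x
    proof -
      obtain v where "v \<in> W" "x = f v" using \<open>x \<in> f ` W\<close> by blast
      then show ?thesis using l(2) fn.subspace_scale[OF m(1)] by (metis image_eqI)
    qed
  qed
  have 1: "act' \<sigma> (f v) \<in> f ` W" if "\<sigma> \<in> sym_group k" "v \<in> W" for \<sigma> v
    using eq[OF that] m(2)[OF that] by (metis image_eqI)
  have 2: "act' \<sigma> (f v + f w) = act' \<sigma> (f v) + act' \<sigma> (f w)" if "\<sigma> \<in> sym_group k" "v \<in> W" "w \<in> W" for \<sigma> v w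
    using that eq l(1) m(2,3) fn.subspace_add[OF m(1)] by metis
  have 3: "act' \<sigma> (fscale c (f v)) = fscale c (act' \<sigma> (f v))" if "\<sigma> \<in> sym_group k" "v \<in> W" for \<sigma> v c
    using that eq l(2) m(2,4) fn.subspace_scale[OF m(1)] by metis
  have 4: "act' id (f v) = f v" if "v \<in> W" for v
    using eq[OF sym_group_id that] m(5)[OF that] by metis
  have 5: "act' (\<sigma> \<circ> \<tau>) (f v) = act' \<sigma> (act' \<tau> (f v))" if "\<sigma> \<in> sym_group k" "\<tau> \<in> sym_group k" "v \<in> W" for \<sigma> \<tau> v
    using that eq m(2,6) sym_group_comp by metis
  show ?thesis
    unfolding is_module_def using sub 1 2 3 4 5 by blast
qed

lemma isomorphic_image:
  assumes M: "is_module k act W" and lin: "linear_on W f" and inj: "inj_on f W"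
    and eq: "\<And>\<sigma> v. \<sigma> \<in> sym_group k \<Longrightarrow> v \<in> W \<Longrightarrow> act' \<sigma> (f v) = f (act \<sigma> v)"
  shows "isomorphic_modules k act W act' (f ` W)"
  unfolding isomorphic_modules_def
proof (intro conjI exI[of _ f])
  show "is_module k act' (f ` W)" by (rule module_image[OF M lin eq])
  show "bij_betw f W (f ` W)" using inj by (rule inj_on_imp_bij_betw)
  show "\<forall>v\<in>W. \<forall>w\<in>W. f (v + w) = f v + f w" "\<forall>v\<in>W. \<forall>c. f (fscale c v) = fscale c (f v)"
    using lin unfolding linear_on_def by blast+
  show "\<forall>\<sigma>\<in>sym_group k. \<forall>v\<in>W. f (act \<sigma> v) = act' \<sigma> (f v)"
    using eq by metis
qed (rule M)

lemma isomorphic_modulesE: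
  assumes "isomorphic_modules k act W act' W'"
  obtains f where "is_module k act W" "is_module k act' W'" "inj_on f W" "f ` W = W'" "linear_on W f"
    "\<forall>\<sigma>\<in>sym_group k. \<forall>v\<in>W. act' \<sigma> (f v) = f (act \<sigma> v)"
proof -
  obtain f where f: "bij_betw f W W'" "linear_on W f" "\<forall>\<sigma>\<in>sym_group k. \<forall>v\<in>W. f (act \<sigma> v) = act' \<sigma> (f v)"
    and m: "is_module k act W" "is_module k act' W'"
    using assms unfolding isomorphic_modules_def linear_on_def by blast
  show ?thesis
    using that[OF m, of f] f unfolding bij_betw_def by metis
qed

lemma isomorphic_trans:
  assumes "isomorphic_modules k act W act' W'" "isomorphic_modules k act' W' act'' W''"
  shows "isomorphic_modules k act W act'' W''"
proof -
  obtain f where f: "is_module k act W" "is_module k act' W'" "inj_on f W" "f ` W = W'" "linear_on W f"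
    and f6: "\<forall>\<sigma>\<in>sym_group k. \<forall>v\<in>W. act' \<sigma> (f v) = f (act \<sigma> v)"
    by (rule isomorphic_modulesE[OF assms(1)])
  obtain g where g: "is_module k act' W'" "is_module k act'' W''" "inj_on g W'" "g ` W' = W''" "linear_on W' g"
    and g6: "\<forall>\<sigma>\<in>sym_group k. \<forall>v\<in>W'. act'' \<sigma> (g v) = g (act' \<sigma> v)"
    by (rule isomorphic_modulesE[OF assms(2)])
  have W': "f v \<in> W'" if "v \<in> W" for v using that f(4) by blast
  have "isomorphic_modules k act W act'' ((\<lambda>v. g (f v)) ` W)"
  proof (rule isomorphic_image[OF f(1)])
    show "linear_on W (\<lambda>v. g (f v))"
      unfolding linear_on_def using W' linear_onD[OF f(5)] linear_onD[OF g(5)] by metis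
    show "inj_on (\<lambda>v. g (f v)) W"
      using f(3) g(3) W' unfolding inj_on_def by metis
    show "act'' \<sigma> (g (f v)) = g (f (act \<sigma> v))" if "\<sigma> \<in> sym_group k" "v \<in> W" for \<sigma> v
      using g6 f6 that W' by metis
  qed
  moreover have "(\<lambda>v. g (f v)) ` W = W''" using f(4) g(4) by (metis image_image)
  ultimately show ?thesis by simp
qed

lemma isomorphic_irreducible:
  assumes iso: "isomorphic_modules k act W act' W'" and irr: "irreducible_module k act W"
  shows "irreducible_module k act' W'"
proof -
  obtain f where f: "is_module k act W" "is_module k act' W'" "inj_on f W" "f ` W = W'" "linear_on W f"
    and f6: "\<forall>\<sigma>\<in>sym_group k. \<forall>v\<in>W. act' \<sigma> (f v) = f (act \<sigma> v)"
    by (rule isomorphic_modulesE[OF iso])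
  note m = is_moduleD[OF f(1)]
  have f0: "f 0 = 0" by (rule linear_on_0[OF f(5) m(1)])
  have "W' \<noteq> {0}"
  proof
    assume "W' = {0}"
    then have "W \<subseteq> {0}"
      using f(3,4) f0 fn.subspace_0[OF m(1)] unfolding inj_on_def by (metis image_eqI singletonD singletonI subsetI)
    then have "W = {0}" using fn.subspace_0[OF m(1)] by blast
    then show False using irr by (simp add: irreducible_module_def)
  qed
  moreover have "U' = {0} \<or> U' = W'" if U': "U' \<subseteq> W'" "is_module k act' U'" for U'
  proof -
    define g where "g = inv_into W f"
    have fg: "f (g v) = v" "g v \<in> W" if "v \<in> W'" for v
      using that f(4) unfolding g_def by (metis f_inv_into_f, metis inv_into_into)
    have gf: "g (f v) = v" if "v \<in> W" for v
      using that f(3) unfolding g_def by simp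
    have "is_module k act (g ` U')"
    proof (rule module_image[OF U'(2)])
      have "g (v + w) = g v + g w" if "v \<in> U'" "w \<in> U'" for v w
      proof -
        have "v \<in> W'" "w \<in> W'" using that U'(1) by blast+
        then have "f (g v + g w) = v + w" "g v + g w \<in> W"
          using linear_onD(1)[OF f(5)] fg fn.subspace_add[OF m(1)] by metis+
        then show ?thesis using gf by metis
      qed
      moreover have "g (fscale c v) = fscale c (g v)" if "v \<in> U'" for v c
      proof -
        have "v \<in> W'" using that U'(1) by blast
        then have "f (fscale c (g v)) = fscale c v" "fscale c (g v) \<in> W"
          using linear_onD(2)[OF f(5)] fg fn.subspace_scale[OF m(1)] by metis+
        then show ?thesis using gf by metis
      qed
      ultimately show "linear_on U' g" unfolding linear_on_def by blast
      show "act \<sigma> (g v) = g (act' \<sigma> v)" if "\<sigma> \<in> sym_group k" "v \<in> U'" for \<sigma> v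
      proof -
        have "v \<in> W'" using that U'(1) by blast
        then show ?thesis using f6 that(1) fg gf m(2)[OF that(1) fg(2)] by metis
      qed
    qed
    moreover have "g ` U' \<subseteq> W" using fg(2) U'(1) by blast
    ultimately have "g ` U' = {0} \<or> g ` U' = W"
      using irr unfolding irreducible_module_def by blast
    moreover have "U' = f ` (g ` U')"
      using fg(1) U'(1) by (force simp: image_image)
    ultimately show ?thesis using f(4) f0 by (metis image_empty image_insert)
  qed
  ultimately show ?thesis unfolding irreducible_module_def using f(2) by blast
qed

lemma isomorphic_has_type:
  "isomorphic_modules k act W act' W' \<Longrightarrow> has_type k D act' W' \<Longrightarrow> has_type k D act W"
  unfolding has_type_def using isomorphic_trans by blast


section \<open>The left construction\<close>

lemma coef_image_GA: "coef ` GA k = group_algebra k"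
proof
  show "coef ` GA k \<subseteq> group_algebra k" by (auto simp: GA_def)
  show "group_algebra k \<subseteq> coef ` GA k"
  proof
    fix f assume f: "f \<in> group_algebra k"
    have "finite {p. f p \<noteq> 0}"
      by (rule finite_subset[OF _ finite_sym_group[of k]]) (use f in \<open>auto simp: group_algebra_def\<close>)
    then have c: "coef (Abs_ga f) = f" by (simp add: Abs_ga_inverse)
    then have "Abs_ga f \<in> GA k" using f unfolding GA_def mem_Collect_eq by (simp only: c)
    then show "f \<in> coef ` GA k" using c by (metis image_eqI)
  qed
qed

lemma left_act_coef: "left_act \<sigma> (coef x) = coef (grp \<sigma> * x)"
  unfolding left_act_def coef_simps ..

lemma right_act_coef: "right_act \<sigma> (coef x) = coef (x * grp (inv \<sigma>))"
  unfolding right_act_def coef_simps ..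

lemma subspace_coef:
  assumes "0 \<in> S" "\<And>x y. x \<in> S \<Longrightarrow> y \<in> S \<Longrightarrow> x + y \<in> S" "\<And>c x. x \<in> S \<Longrightarrow> cs c x \<in> S"
  shows "fn.subspace (coef ` S)"
proof (rule fn.subspaceI)
  show "0 \<in> coef ` S" using assms(1) coef_simps(4) by (metis image_eqI)
  show "x + y \<in> coef ` S" if "x \<in> coef ` S" "y \<in> coef ` S" for x y
    using that assms(2) coef_simps(1) by (metis (no_types, opaque_lifting) image_iff)
  show "fscale c x \<in> coef ` S" if "x \<in> coef ` S" for c x
    using that assms(3) coef_simps(7) by (metis (no_types, opaque_lifting) image_iff)
qed

lemma left_submodule_closed:
  assumes U: "is_module k left_act U" and x: "x \<in> GA k" and y: "coef y \<in> U"
  shows "coef (x * y) \<in> U"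
  using x
proof (induction rule: GA_induct)
  case (grp \<sigma>)
  then show ?case using is_moduleD(2)[OF U grp y] by (simp only: left_act_coef)
next
  case (add x x')
  then show ?case
    using fn.subspace_add[OF is_moduleD(1)[OF U]] by (simp only: distrib_right coef_simps)
next
  case (scale c x)
  then show ?case
    using fn.subspace_scale[OF is_moduleD(1)[OF U]] by (simp only: mult_cs coef_simps)
qed

text \<open>The left ideal generated by the idempotent of a path.\<close>

definition left_ideal :: "nat \<Rightarrow> (nat \<times> nat) list \<Rightarrow> ga set" where
  "left_ideal k p = {x \<in> GA k. x * gz p = x}"

lemma left_ideal_props:
  shows "0 \<in> left_ideal k p"
    and "x \<in> left_ideal k p \<Longrightarrow> y \<in> left_ideal k p \<Longrightarrow> x + y \<in> left_ideal k p"
    and "x \<in> left_ideal k p \<Longrightarrow> cs c x \<in> left_ideal k p"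
    and "x \<in> left_ideal k p \<Longrightarrow> z \<in> GA k \<Longrightarrow> z * x \<in> left_ideal k p"
  by (simp_all add: left_ideal_def distrib_right mult.assoc)

lemma subspace_left_ideal: "fn.subspace (coef ` left_ideal k p)"
  by (rule subspace_coef) (rule left_ideal_props; assumption)+

lemma gz_in_left_ideal: "p \<in> paths k \<Longrightarrow> gz p \<in> left_ideal k p"
  by (simp add: left_ideal_def paths_def gz_idem)

lemma module_left_ideal: "is_module k left_act (coef ` left_ideal k p)"
proof -
  have 1: "left_act \<sigma> (coef x) \<in> coef ` left_ideal k p" if "\<sigma> \<in> sym_group k" "x \<in> left_ideal k p" for \<sigma> x
    unfolding left_act_coef using that by (intro imageI left_ideal_props GA_grp)
  have 2: "left_act \<sigma> (coef x + coef y) = left_act \<sigma> (coef x) + left_act \<sigma> (coef y)" for \<sigma> x y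
    unfolding coef_simps(1)[symmetric] left_act_coef distrib_left ..
  have 3: "left_act \<sigma> (fscale c (coef x)) = fscale c (left_act \<sigma> (coef x))" for \<sigma> c x
    unfolding coef_simps(7)[symmetric] left_act_coef mult_cs ..
  have 4: "left_act id (coef x) = coef x" for x
    unfolding left_act_coef by simp
  have 5: "left_act (\<sigma> \<circ> \<tau>) (coef x) = left_act \<sigma> (left_act \<tau> (coef x))" for \<sigma> \<tau> x
    unfolding left_act_coef grp_mult[symmetric] mult.assoc ..
  show ?thesis
    unfolding is_module_def using subspace_left_ideal 1 2 3 4 5 by blast
qed

lemma expand_paths: "x = (\<Sum>S\<in>paths n. gz S * x)" "x = (\<Sum>S\<in>paths n. x * gz S)"
  using sum_gz[of n] by (simp_all add: sum_distrib_left[symmetric] sum_distrib_right[symmetric])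

text \<open>A nonzero submodule contains a nonzero element of some block ending in \<open>e\<^sub>p\<close>. That block is a line
  from which \<open>e\<^sub>p\<close> is recovered by left multiplication.\<close>

lemma irreducible_left_ideal:
  assumes p: "p \<in> paths k"
  shows "irreducible_module k left_act (coef ` left_ideal k p)"
  unfolding irreducible_module_def
proof (intro conjI allI impI module_left_ideal)
  have ip: "is_path p" using p by (simp add: paths_def)
  have "coef (gz p) \<noteq> 0"
    using gz_nonzero[OF ip] coef_simps(4) by (metis coef_inject)
  then show "coef ` left_ideal k p \<noteq> {0}"
    using gz_in_left_ideal[OF p] by blast
  fix U assume U: "U \<subseteq> coef ` left_ideal k p \<and> is_module k left_act U"
  show "U = {0} \<or> U = coef ` left_ideal k p"
  proof (cases "U = {0}")
    case False
    have "0 \<in> U" using U fn.subspace_0[OF is_moduleD(1)] by blast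
    with False obtain f where f: "f \<in> U" "f \<noteq> 0" by blast
    then obtain x where x: "x \<in> left_ideal k p" "f = coef x" using U by blast
    have "x \<noteq> 0" using f x coef_simps(4) by metis
    have "\<exists>S\<in>paths k. gz S * x \<noteq> 0"
    proof (rule ccontr)
      assume "\<not> ?thesis"
      then have "(\<Sum>S\<in>paths k. gz S * x) = 0" by (intro sum.neutral) blast
      with expand_paths(1)[of x k] \<open>x \<noteq> 0\<close> show False by metis
    qed
    then obtain S where S: "S \<in> paths k" "gz S * x \<noteq> 0" by blast
    have xp: "x \<in> GA k" "x * gz p = x" using x by (auto simp: left_ideal_def)
    have nz: "gz S * x * gz p \<noteq> 0" using S xp by (simp add: mult.assoc)
    then have "set S = set p" using gz_block_zero[OF p S(1)] xp by blast
    then obtain u where u: "\<And>x. x \<in> GA k \<Longrightarrow> \<exists>\<gamma>. gz S * x * gz p = cs \<gamma> u" "\<exists>w\<in>GA k. w * u = gz p"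
      using gz_block_one_dim[OF p S(1)] by metis
    obtain \<gamma> w where g: "gz S * x * gz p = cs \<gamma> u" "w \<in> GA k" "w * u = gz p"
      using u xp by blast
    have "\<gamma> \<noteq> 0" using g nz by auto
    have "cs (1 / \<gamma>) w * (gz S * x) = cs (1 / \<gamma>) (w * (gz S * x * gz p))"
      using xp by (simp add: mult.assoc)
    also have "\<dots> = gz p" using g \<open>\<gamma> \<noteq> 0\<close> by simp
    finally have e: "gz p = (cs (1 / \<gamma>) w * gz S) * x" by (simp add: mult.assoc)
    have "coef (gz p) \<in> U"
      unfolding e by (rule left_submodule_closed[of k]) (use U f x g S in \<open>auto simp: paths_def\<close>)
    then have "coef (y * gz p) \<in> U" if "y \<in> GA k" for y
      using U left_submodule_closed[of k] that by blast
    then have "coef ` left_ideal k p \<subseteq> U"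
      unfolding left_ideal_def by (metis (mono_tags, lifting) image_subsetI mem_Collect_eq)
    then show ?thesis using U by blast
  qed simp
qed

lemma weight_vector_sum_left:
  "(\<Sum>j\<in>{1..<i}. left_act (transpose j i) (coef x)) = coef (JM i * x)"
  unfolding left_act_coef JM_def sum_distrib_right coef_sum ..

lemma subspace_young_carrier: "fn.subspace (young_carrier k D)"
proof (rule fn.subspaceI)
  show "0 \<in> young_carrier k D" by (simp add: young_carrier_def)
  fix x y :: "tableau \<Rightarrow> complex" and c
  assume x: "x \<in> young_carrier k D"
  show "fscale c x \<in> young_carrier k D" using x by (simp add: young_carrier_def fscale_def)
  assume y: "y \<in> young_carrier k D"
  have "T \<in> std_tableaux k D" if "(x + y) T \<noteq> 0" for T
  proof -
    have "x T \<noteq> 0 \<or> y T \<noteq> 0" using that unfolding plus_fun_apply by fastforce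
    then show ?thesis using x y unfolding young_carrier_def by blast
  qed
  then show "x + y \<in> young_carrier k D" unfolding young_carrier_def by blast
qed

text \<open>Choosing a vector in each one-dimensional block identifies the left ideal with the
  functions on the standard tableaux of its shape; transporting the action along this
  identification gives a model of the irreducible module of that shape.\<close>

lemma has_type_left_ideal:
  assumes p: "p \<in> paths k"
  shows "has_type k (set p) left_act (coef ` left_ideal k p)"
proof -
  let ?D = "set p" and ?W = "coef ` left_ideal k p"
  let ?I = "std_tableaux k ?D"
  define q where "q = (\<lambda>T. path_of T k)"
  have q: "q T \<in> paths k" "set (q T) = ?D" if "T \<in> ?I" for T
    using that bij_betw_apply[OF bij_path_of_shape[of k ?D]] by (auto simp: q_def)
  have fin: "finite ?I"
    using bij_betw_finite[OF bij_path_of_shape[of k ?D]] by simp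
  have "\<forall>T\<in>?I. \<exists>u. u \<in> GA k \<and> u \<noteq> 0 \<and> gz (q T) * u = u \<and> u * gz p = u \<and>
      (\<forall>x\<in>GA k. \<exists>\<gamma>. gz (q T) * x * gz p = cs \<gamma> u)"
  proof
    fix T assume T: "T \<in> ?I"
    show "\<exists>u. u \<in> GA k \<and> u \<noteq> 0 \<and> gz (q T) * u = u \<and> u * gz p = u \<and>
      (\<forall>x\<in>GA k. \<exists>\<gamma>. gz (q T) * x * gz p = cs \<gamma> u)"
      by (rule gz_block_one_dim[OF p q(1)[OF T] q(2)[OF T]]) blast
  qed
  from bchoice[OF this] obtain u where "\<forall>T\<in>?I. u T \<in> GA k \<and> u T \<noteq> 0 \<and> gz (q T) * u T = u T \<and>
      u T * gz p = u T \<and> (\<forall>x\<in>GA k. \<exists>\<gamma>. gz (q T) * x * gz p = cs \<gamma> (u T))" by blast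
  then have u: "u T \<in> GA k" "u T \<noteq> 0" "gz (q T) * u T = u T" "u T * gz p = u T"
      "x \<in> GA k \<Longrightarrow> \<exists>\<gamma>. gz (q T) * x * gz p = cs \<gamma> (u T)" if "T \<in> ?I" for T x
    using that by blast+
  have uL: "u T \<in> left_ideal k p" if "T \<in> ?I" for T using u(1,4)[OF that] by (simp add: left_ideal_def)
  have orth: "gz (q T) * u T' = (if T = T' then u T else 0)" if "T \<in> ?I" "T' \<in> ?I" for T T'
  proof (cases "T = T'")
    case False
    have "q T \<noteq> q T'" using False that path_of_inj by (auto simp: q_def std_tableaux_def)
    then have "gz (q T) * gz (q T') = 0"
      using q[OF that(1)] q[OF that(2)] by (intro gz_orthogonal) (auto simp: paths_def)
    then have "gz (q T) * (gz (q T') * u T') = 0" by (simp add: mult.assoc[symmetric])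
    then show ?thesis using u(3)[OF that(2)] False by simp
  qed (simp add: u(3)[OF that(2)])
  \<comment> \<open>the vector with coordinates \<open>f\<close>; projecting with the idempotents recovers the coordinates\<close>
  define \<psi> where "\<psi> = (\<lambda>f. \<Sum>T\<in>?I. cs (f T) (u T))"
  define \<Psi> where "\<Psi> = (\<lambda>f. coef (\<psi> f))"
  have \<psi>L: "\<psi> f \<in> left_ideal k p" for f
    unfolding \<psi>_def left_ideal_def using u(1,4) by (simp add: sum_distrib_right)
  have proj: "gz (q T) * \<psi> f = cs (f T) (u T)" if "T \<in> ?I" for f T
  proof -
    have "gz (q T) * \<psi> f = (\<Sum>T'\<in>?I. if T = T' then cs (f T) (u T) else 0)"
      unfolding \<psi>_def sum_distrib_left by (intro sum.cong refl) (simp add: orth that)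
    then show ?thesis using fin that by simp
  qed
  have surj: "\<exists>f\<in>young_carrier k ?D. \<psi> f = x" if x: "x \<in> left_ideal k p" for x
  proof -
    have xp: "x \<in> GA k" "x * gz p = x" using x by (auto simp: left_ideal_def)
    have "\<forall>T\<in>?I. \<exists>\<gamma>. gz (q T) * x = cs \<gamma> (u T)"
      using u(5)[OF _ xp(1)] by (simp add: mult.assoc xp)
    from bchoice[OF this] obtain g where g: "\<And>T. T \<in> ?I \<Longrightarrow> gz (q T) * x = cs (g T) (u T)" by blast
    define f where "f = (\<lambda>T. if T \<in> ?I then g T else 0)"
    have "x = (\<Sum>S\<in>paths k. gz S * x)" by (rule expand_paths)
    also have "\<dots> = (\<Sum>S\<in>{S \<in> paths k. set S = ?D}. gz S * x)"
    proof (rule sum.mono_neutral_right)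
      show "\<forall>S\<in>paths k - {S \<in> paths k. set S = ?D}. gz S * x = 0"
        using gz_block_zero[OF p _ _ xp(1)] xp by (auto simp: mult.assoc)
    qed auto
    also have "\<dots> = (\<Sum>T\<in>?I. gz (q T) * x)"
      using sum.reindex_bij_betw[OF bij_path_of_shape[of k ?D], of "\<lambda>S. gz S * x"] by (simp add: q_def)
    also have "\<dots> = \<psi> f" unfolding \<psi>_def by (intro sum.cong refl) (simp add: g f_def)
    finally have "\<psi> f = x" by simp
    moreover have "f \<in> young_carrier k ?D" by (simp add: young_carrier_def f_def)
    ultimately show ?thesis by blast
  qed
  have img: "\<Psi> ` young_carrier k ?D = ?W"
  proof
    show "\<Psi> ` young_carrier k ?D \<subseteq> ?W" unfolding \<Psi>_def using \<psi>L by blast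
    show "?W \<subseteq> \<Psi> ` young_carrier k ?D"
    proof
      fix w assume "w \<in> ?W"
      then obtain x where x: "x \<in> left_ideal k p" "w = coef x" by blast
      then obtain f where "f \<in> young_carrier k ?D" "\<psi> f = x" using surj by blast
      then show "w \<in> \<Psi> ` young_carrier k ?D" unfolding \<Psi>_def x(2) by blast
    qed
  qed
  have inj: "inj_on \<Psi> (young_carrier k ?D)"
  proof (rule inj_onI)
    fix f g assume fg: "f \<in> young_carrier k ?D" "g \<in> young_carrier k ?D" and "\<Psi> f = \<Psi> g"
    then have e: "\<psi> f = \<psi> g" unfolding \<Psi>_def coef_inject by simp
    show "f = g"
    proof
      fix T show "f T = g T"
      proof (cases "T \<in> ?I")
        case True
        have "cs (f T) (u T) = gz (q T) * \<psi> f" by (rule proj[OF True, symmetric])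
        also have "\<dots> = cs (g T) (u T)" unfolding e by (rule proj[OF True])
        finally show ?thesis using u(2)[OF True] by (simp only: ga.scale_cancel_right) blast
      next
        case False
        then have "f T = 0" "g T = 0" using fg unfolding young_carrier_def mem_Collect_eq by blast+
        then show ?thesis by simp
      qed
    qed
  qed
  have \<psi>lin: "\<psi> (f + g) = \<psi> f + \<psi> g" "\<psi> (fscale c f) = cs c (\<psi> f)" for f g c
    by (simp_all add: \<psi>_def ga.scale_left_distrib sum.distrib ga.scale_sum_right fscale_def)
  define \<phi> where "\<phi> = inv_into (young_carrier k ?D) \<Psi>"
  have \<phi>\<Psi>: "\<phi> (\<Psi> f) = f" if "f \<in> young_carrier k ?D" for f
    using inj that unfolding \<phi>_def by simp
  have \<Psi>\<phi>: "\<Psi> (\<phi> w) = w" "\<phi> w \<in> young_carrier k ?D" if "w \<in> ?W" for w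
    using that img unfolding \<phi>_def by (metis f_inv_into_f, metis inv_into_into)
  have sub: "fn.subspace ?W" "fn.subspace (young_carrier k ?D)"
    by (rule subspace_left_ideal subspace_young_carrier)+
  have \<Psi>lin: "\<Psi> (f + g) = \<Psi> f + \<Psi> g" "\<Psi> (fscale c f) = fscale c (\<Psi> f)" for f g c
    unfolding \<Psi>_def \<psi>lin coef_simps by (rule refl)+
  have \<phi>lin: "linear_on ?W \<phi>"
    unfolding linear_on_def
  proof (intro conjI ballI allI)
    fix v w c assume v: "v \<in> ?W"
    have "\<phi> (fscale c v) = \<phi> (\<Psi> (fscale c (\<phi> v)))"
      by (simp only: \<Psi>lin(2) \<Psi>\<phi>(1)[OF v])
    also have "\<dots> = fscale c (\<phi> v)"
      by (rule \<phi>\<Psi>[OF fn.subspace_scale[OF sub(2) \<Psi>\<phi>(2)[OF v]]])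
    finally show "\<phi> (fscale c v) = fscale c (\<phi> v)" .
    assume w: "w \<in> ?W"
    have "\<phi> (v + w) = \<phi> (\<Psi> (\<phi> v + \<phi> w))"
      by (simp only: \<Psi>lin(1) \<Psi>\<phi>(1)[OF v] \<Psi>\<phi>(1)[OF w])
    also have "\<dots> = \<phi> v + \<phi> w"
      by (rule \<phi>\<Psi>[OF fn.subspace_add[OF sub(2) \<Psi>\<phi>(2)[OF v] \<Psi>\<phi>(2)[OF w]]])
    finally show "\<phi> (v + w) = \<phi> v + \<phi> w" .
  qed
  have \<phi>inj: "inj_on \<phi> ?W" by (rule inj_on_inverseI[of _ \<Psi>]) (rule \<Psi>\<phi>(1))
  have \<phi>img: "\<phi> ` ?W = young_carrier k ?D"
    unfolding img[symmetric] image_image using \<phi>\<Psi> by (simp cong: image_cong)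
  define \<rho> where "\<rho> = (\<lambda>\<sigma> f. \<phi> (left_act \<sigma> (\<Psi> f)))"
  have \<rho>: "\<rho> \<sigma> (\<phi> v) = \<phi> (left_act \<sigma> v)" if "v \<in> ?W" for \<sigma> v
    unfolding \<rho>_def using \<Psi>\<phi>(1)[OF that] by simp
  have iso: "isomorphic_modules k left_act ?W \<rho> (young_carrier k ?D)"
    using isomorphic_image[OF module_left_ideal \<phi>lin \<phi>inj, of \<rho>] \<rho> unfolding \<phi>img by blast
  have wt: "(\<Sum>j\<in>{1..<i}. \<rho> (transpose j i) (delta T)) = fscale (cont T i) (delta T)"
    if T: "T \<in> ?I" and i: "i \<in> {1..k}" for T i
  proof -
    have dc: "delta T \<in> young_carrier k ?D" using T by (simp add: young_carrier_def delta_def)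
    have "\<psi> (delta T) = (\<Sum>T'\<in>?I. if T' = T then u T else 0)"
      unfolding \<psi>_def by (intro sum.cong refl) (simp add: delta_def)
    then have "\<Psi> (delta T) = coef (u T)" using fin T by (simp add: \<Psi>_def)
    then have d: "delta T = \<phi> (coef (u T))" using \<phi>\<Psi>[OF dc] by metis
    have cu: "coef (u T) \<in> ?W" using uL[OF T] by blast
    have "(\<Sum>j\<in>{1..<i}. \<rho> (transpose j i) (delta T)) = (\<Sum>j\<in>{1..<i}. \<phi> (left_act (transpose j i) (coef (u T))))"
      unfolding d by (intro sum.cong refl \<rho>[OF cu])
    also have "\<dots> = \<phi> (\<Sum>j\<in>{1..<i}. left_act (transpose j i) (coef (u T)))"
    proof (rule linear_on_sum[OF \<phi>lin sub(1), symmetric])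
      fix j assume "j \<in> {1..<i}"
      then have "transpose j i \<in> sym_group k" using i by (intro sym_group_transpose) auto
      then show "left_act (transpose j i) (coef (u T)) \<in> ?W"
        by (rule is_moduleD(2)[OF module_left_ideal _ cu])
    qed
    also have "\<dots> = \<phi> (coef (JM i * u T))" unfolding weight_vector_sum_left ..
    also have "JM i * u T = cs (cont T i) (u T)"
    proof -
      have "JM i * gz (q T) = cs (cont T i) (gz (q T))"
        using JM_gz[of "q T" i] q(1)[OF T] i cont_eq_wt[OF i, of T] by (simp add: paths_def q_def)
      then have "JM i * (gz (q T) * u T) = cs (cont T i) (gz (q T) * u T)"
        by (simp add: mult.assoc[symmetric])
      then show ?thesis by (simp only: u(3)[OF T])
    qed
    also have "\<phi> (coef (cs (cont T i) (u T))) = fscale (cont T i) (delta T)"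
      unfolding coef_simps d by (rule linear_onD(2)[OF \<phi>lin cu])
    finally show ?thesis .
  qed
  have "is_young_action k ?D \<rho>"
    unfolding is_young_action_def
    using isomorphic_irreducible[OF iso irreducible_left_ideal[OF p]] wt by blast
  then show ?thesis unfolding has_type_def using iso by blast
qed


lemma span_left_induction:
  assumes k: "T \<in> paths k"
  shows "fn.span {a \<star> w | a w. a \<in> group_algebra (Suc k) \<and> w \<in> coef ` left_ideal k T}
      = coef ` left_ideal (Suc k) T"
proof
  show "fn.span {a \<star> w | a w. a \<in> group_algebra (Suc k) \<and> w \<in> coef ` left_ideal k T}
      \<subseteq> coef ` left_ideal (Suc k) T"
  proof (rule fn.span_minimal[OF _ subspace_left_ideal], rule subsetI)
    fix f assume "f \<in> {a \<star> w | a w. a \<in> group_algebra (Suc k) \<and> w \<in> coef ` left_ideal k T}"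
    then obtain a w where f: "f = a \<star> w" "a \<in> group_algebra (Suc k)" "w \<in> coef ` left_ideal k T" by blast
    obtain x where x: "a = coef x" "x \<in> GA (Suc k)" using f(2) unfolding coef_image_GA[symmetric] by blast
    obtain y where y: "w = coef y" "y \<in> left_ideal k T" using f(3) by blast
    have "y \<in> left_ideal (Suc k) T"
      using y(2) GA_mono[of k "Suc k"] by (auto simp: left_ideal_def)
    then have "x * y \<in> left_ideal (Suc k) T" using x(2) by (rule left_ideal_props(4))
    then show "f \<in> coef ` left_ideal (Suc k) T"
      unfolding f(1) x(1) y(1) coef_simps(6)[symmetric] by blast
  qed
  show "coef ` left_ideal (Suc k) T
      \<subseteq> fn.span {a \<star> w | a w. a \<in> group_algebra (Suc k) \<and> w \<in> coef ` left_ideal k T}"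
  proof (rule image_subsetI)
    fix x assume "x \<in> left_ideal (Suc k) T"
    then have x: "x \<in> GA (Suc k)" "x * gz T = x" by (auto simp: left_ideal_def)
    have "coef x = coef x \<star> coef (gz T)" unfolding coef_simps(6)[symmetric] x(2) ..
    moreover have "coef x \<in> group_algebra (Suc k)" using x(1) unfolding coef_image_GA[symmetric] by blast
    moreover have "coef (gz T) \<in> coef ` left_ideal k T" using gz_in_left_ideal[OF k] by blast
    ultimately show "coef x \<in> fn.span {a \<star> w | a w. a \<in> group_algebra (Suc k) \<and> w \<in> coef ` left_ideal k T}"
      by (intro fn.span_base) blast
  qed
qed

text \<open>An irreducible submodule of the type of the extended path contains a weight vector of that
  path. Blocks of different shapes vanish, so the induced module has only one line of such
  vectors, the one spanned by the idempotent.\<close>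

lemma irreducible_of_type_unique:
  assumes p: "b # T \<in> paths (Suc k)"
    and W: "W \<subseteq> coef ` left_ideal (Suc k) T" "irreducible_module (Suc k) left_act W"
      "has_type (Suc k) (set (b # T)) left_act W"
  shows "W = coef ` left_ideal (Suc k) (b # T)"
proof -
  let ?n = "Suc k" and ?p = "b # T"
  note [simp del] = gz.simps
  have ip: "is_path ?p" "is_path T" "length T = k" using p by (auto simp: paths_def)
  obtain \<rho> where \<rho>: "is_young_action ?n (set ?p) \<rho>"
    and iso: "isomorphic_modules ?n left_act W \<rho> (young_carrier ?n (set ?p))"
    using W(3) unfolding has_type_def by blast
  obtain f where f: "is_module ?n left_act W" "is_module ?n \<rho> (young_carrier ?n (set ?p))" "inj_on f W"
    "f ` W = young_carrier ?n (set ?p)" "linear_on W f"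
    and f6: "\<forall>\<sigma>\<in>sym_group ?n. \<forall>v\<in>W. \<rho> \<sigma> (f v) = f (left_act \<sigma> v)"
    by (rule isomorphic_modulesE[OF iso])
  note sub = is_moduleD(1)[OF f(1)]
  define T0 where "T0 = tab ?p"
  have T0: "T0 \<in> std_tableaux ?n (set ?p)" "path_of T0 ?n = ?p"
    using standard_tab[OF p] path_of_tab[OF p] shape_tab[of ?p] unfolding T0_def std_tableaux_def by blast+
  have "delta T0 \<in> f ` W"
    unfolding f(4) using T0(1) by (simp add: young_carrier_def delta_def)
  then obtain v where v: "v \<in> W" "f v = delta T0" by (metis imageE)
  obtain y where y: "y \<in> left_ideal ?n T" "v = coef y" using v(1) W(1) by blast
  have "y \<noteq> 0"
  proof
    assume "y = 0"
    then have "v = 0" by (simp only: y(2) coef_simps)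
    then have "delta T0 = (0 :: tableau \<Rightarrow> complex)" using v(2) linear_on_0[OF f(5) sub] by simp
    then have "delta T0 T0 = (0 :: complex)" by (simp only: zero_fun_apply)
    then show False by (simp add: delta_def)
  qed
  have wt: "JM i * y = cs (wt ?p i) y" if i: "i \<in> {1..?n}" for i
  proof -
    have tr: "transpose j i \<in> sym_group ?n" if "j \<in> {1..<i}" for j
      using that i by (intro sym_group_transpose) auto
    have "f (\<Sum>j\<in>{1..<i}. left_act (transpose j i) v) = (\<Sum>j\<in>{1..<i}. f (left_act (transpose j i) v))"
      by (rule linear_on_sum[OF f(5) sub]) (rule is_moduleD(2)[OF f(1) tr v(1)])
    also have "\<dots> = (\<Sum>j\<in>{1..<i}. \<rho> (transpose j i) (delta T0))"
    proof (rule sum.cong[OF refl])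
      fix j assume "j \<in> {1..<i}"
      then show "f (left_act (transpose j i) v) = \<rho> (transpose j i) (delta T0)"
        using f6 tr v by metis
    qed
    also have "\<dots> = fscale (cont T0 i) (delta T0)"
      using \<rho> T0(1) i unfolding is_young_action_def by blast
    also have "\<dots> = f (fscale (cont T0 i) v)"
      using linear_onD(2)[OF f(5) v(1)] v(2) by simp
    finally have e: "f (coef (JM i * y)) = f (fscale (cont T0 i) v)"
      unfolding y(2) weight_vector_sum_left .
    have "coef (JM i * y) \<in> W"
      using left_submodule_closed[OF f(1), of "JM i" y] v(1) y(2) i by simp
    moreover have "fscale (cont T0 i) v \<in> W" by (rule fn.subspace_scale[OF sub v(1)])
    ultimately have "coef (JM i * y) = fscale (cont T0 i) v"
      using f(3) e unfolding inj_on_def by blast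
    then have "JM i * y = cs (cont T0 i) y"
      unfolding y(2) coef_simps(7)[symmetric] coef_inject .
    then show ?thesis using cont_eq_wt[OF i, of T0] T0(2) by simp
  qed
  have yg: "y \<in> GA ?n" "y * gz T = y" using y(1) by (auto simp: left_ideal_def)
  have gy: "gz ?p * y = y"
    by (rule gz_fixes_weight[OF ip(1)]) (use wt ip in simp)
  have "y = gz ?p * y * gz T" by (simp only: gy yg)
  also have "\<dots> = (\<Sum>b'\<in>addable (set T). gz ?p * y * gz (b' # T))"
    unfolding sum_gz_Cons[OF ip(2), symmetric] sum_distrib_left ..
  also have "\<dots> = (\<Sum>b'\<in>addable (set T). if b' = b then gz ?p * y * gz ?p else 0)"
  proof (rule sum.cong[OF refl])
    fix b' assume b': "b' \<in> addable (set T)"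
    show "gz ?p * y * gz (b' # T) = (if b' = b then gz ?p * y * gz ?p else 0)"
    proof (cases "b' = b")
      case False
      have "b \<notin> set T" "b' \<notin> set T" using b' ip(1) by (auto simp: addable_def)
      then have "set ?p \<noteq> set (b' # T)" using False by (metis insert_iff list.set(2))
      moreover have "b' # T \<in> paths ?n" using b' ip by (simp add: paths_def)
      ultimately show ?thesis using gz_block_zero[OF _ p _ yg(1)] False by simp
    qed simp
  qed
  also have "\<dots> = gz ?p * y * gz ?p"
    using ip(1) finite_addable[OF is_path_diagram[OF ip(2)]] by simp
  finally have e: "y = gz ?p * y * gz ?p" .
  have pn: "length ?p = ?n" using ip by simp
  obtain \<gamma> where "gz ?p * y * gz ?p = cs \<gamma> (gz ?p)"
    using block_all[OF ip(1) ip(1) pn pn yg(1)] unfolding block_def by blast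
  with e have \<gamma>: "y = cs \<gamma> (gz ?p)" by simp
  with \<open>y \<noteq> 0\<close> have "\<gamma> \<noteq> 0" by auto
  then have "gz ?p = cs (1 / \<gamma>) y" using \<gamma> by simp
  then have gW: "coef (gz ?p) \<in> W"
    using fn.subspace_scale[OF sub v(1), of "1 / \<gamma>"] unfolding y(2) coef_simps(7)[symmetric] by simp
  have "coef ` left_ideal ?n ?p \<subseteq> W"
  proof (rule image_subsetI)
    fix x assume "x \<in> left_ideal ?n ?p"
    then have x: "x \<in> GA ?n" "x * gz ?p = x" by (auto simp: left_ideal_def)
    show "coef x \<in> W" using left_submodule_closed[OF f(1) x(1) gW] unfolding x(2) .
  qed
  moreover have "coef ` left_ideal ?n ?p \<noteq> {0}"
    using irreducible_left_ideal[OF p] unfolding irreducible_module_def by blast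
  ultimately show ?thesis
    using W(2) module_left_ideal[of ?n ?p] unfolding irreducible_module_def by blast
qed

lemma left_ideal_Cons_subset: "is_path (b # T) \<Longrightarrow> left_ideal n (b # T) \<subseteq> left_ideal n T"
  using gz_Cons_absorb(2)[of b T] unfolding left_ideal_def
  by (auto simp del: gz.simps) (metis mult.assoc)

lemma left_step_iff:
  assumes p: "b # T \<in> paths (Suc k)"
  shows "W \<subseteq> coef ` left_ideal (Suc k) T \<and> irreducible_module (Suc k) left_act W \<and>
      has_type (Suc k) (set (b # T)) left_act W \<longleftrightarrow> W = coef ` left_ideal (Suc k) (b # T)"
proof
  assume "W = coef ` left_ideal (Suc k) (b # T)"
  moreover have "is_path (b # T)" using p by (simp add: paths_def)
  ultimately show "W \<subseteq> coef ` left_ideal (Suc k) T \<and> irreducible_module (Suc k) left_act W \<and>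
      has_type (Suc k) (set (b # T)) left_act W"
    using irreducible_left_ideal[OF p] has_type_left_ideal[OF p] left_ideal_Cons_subset image_mono by metis
qed (use irreducible_of_type_unique[OF p] in blast)

lemma left_ideal_1: "p \<in> paths (Suc 0) \<Longrightarrow> left_ideal (Suc 0) p = GA (Suc 0)"
proof -
  assume p: "p \<in> paths (Suc 0)"
  then obtain b where b: "p = [b]" "b \<in> addable {}" by (auto simp: paths_def length_Suc_conv)
  have "gz p = 1" using b by (simp add: addable_empty lag_def)
  then show ?thesis by (simp add: left_ideal_def)
qed

lemma left_induced_eq:
  assumes T: "standard n T" and k: "1 \<le> k" "k \<le> n"
  shows "left_induced T k = coef ` left_ideal k (path_of T k)"
  using k
proof (induction k rule: nat_induct_at_least)
  case base
  have p: "path_of T (Suc 0) \<in> paths (Suc 0)"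
    by (rule path_of_in_paths[OF T]) (use base in simp)
  show ?case unfolding One_nat_def left_induced.simps left_ideal_1[OF p] coef_image_GA ..
next
  case (Suc k)
  then obtain m where m: "k = Suc m" by (cases k) auto
  have IH: "left_induced T (Suc m) = coef ` left_ideal k (path_of T k)" using Suc m by simp
  define b where "b = box_of T (Suc k)"
  have p: "b # path_of T k \<in> paths (Suc k)" "path_of T k \<in> paths k"
    using path_of_in_paths[OF T Suc.prems] path_of_in_paths[OF T, of k] Suc.prems by (simp_all add: b_def)
  have D: "shape (subtableau T (Suc k)) = set (b # path_of T k)"
    using shape_subtableau[OF T Suc.prems] by (simp add: b_def)
  have "left_induced T (Suc k) = (THE W. W = coef ` left_ideal (Suc k) (b # path_of T k))"
    unfolding m left_induced.simps Let_def IH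
    unfolding m[symmetric] span_left_induction[OF p(2)] D left_step_iff[OF p(1)] ..
  then show ?case by (simp add: b_def)
qed


section \<open>The right construction\<close>

text \<open>The anti-automorphism \<open>iota\<close> on coefficient functions. It exchanges the left and the right
  action.\<close>

definition flip :: "galg \<Rightarrow> galg" where
  "flip f = coef (iota (Abs_ga f))"

lemma flip_coef: "flip (coef x) = coef (iota x)"
  by (simp add: flip_def coef_inverse)

lemma flip_flip: "f \<in> group_algebra k \<Longrightarrow> flip (flip f) = f"
  unfolding coef_image_GA[symmetric] by (auto simp: flip_coef)

lemma flip_image_flip: "W \<subseteq> group_algebra k \<Longrightarrow> flip ` flip ` W = W"
  unfolding image_image using flip_flip by (force simp: subset_iff)

lemma flip_group_algebra: "f \<in> group_algebra k \<Longrightarrow> flip f \<in> group_algebra k"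
  unfolding coef_image_GA[symmetric] by (auto simp: flip_coef)

lemma linear_on_flip:
  assumes W: "W \<subseteq> group_algebra k"
  shows "linear_on W flip"
proof -
  have "flip (coef x + coef y) = flip (coef x) + flip (coef y)" for x y
    unfolding coef_simps(1)[symmetric] flip_coef iota_add ..
  moreover have "flip (fscale c (coef x)) = fscale c (flip (coef x))" for x c
    unfolding coef_simps(7)[symmetric] flip_coef iota_cs ..
  ultimately show ?thesis
    using W unfolding linear_on_def coef_image_GA[symmetric] by blast
qed

lemma inj_on_flip: "W \<subseteq> group_algebra k \<Longrightarrow> inj_on flip W"
  using flip_flip by (intro inj_on_inverseI[of _ flip]) blast

lemma right_act_flip:
  assumes "\<sigma> \<in> sym_group k" "v \<in> group_algebra k"
  shows "right_act \<sigma> (flip v) = flip (left_act \<sigma> v)"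
proof -
  obtain x where x: "x \<in> GA k" "v = coef x" using assms(2) unfolding coef_image_GA[symmetric] by blast
  show ?thesis
    unfolding x(2) flip_coef right_act_coef left_act_coef
    using iota_mult[OF GA_grp[OF assms(1)] x(1)] iota_grp[OF sym_group_bij[OF assms(1)]] by simp
qed

lemma left_act_flip:
  assumes "\<sigma> \<in> sym_group k" "v \<in> group_algebra k"
  shows "left_act \<sigma> (flip v) = flip (right_act \<sigma> v)"
proof -
  obtain x where x: "x \<in> GA k" "v = coef x" using assms(2) unfolding coef_image_GA[symmetric] by blast
  have "iota (x * grp (inv \<sigma>)) = grp \<sigma> * iota x"
    using iota_mult[OF x(1) GA_grp[OF sym_group_inv[OF assms(1)]]]
      iota_grp[OF sym_group_bij[OF sym_group_inv[OF assms(1)]]] sym_group_inv_comp(3)[OF assms(1)] by simp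
  then show ?thesis
    unfolding x(2) flip_coef right_act_coef left_act_coef by simp
qed

lemma irreducible_has_type_flip:
  assumes W: "W \<subseteq> group_algebra k"
  shows "irreducible_module k left_act (flip ` W) \<and> has_type k D left_act (flip ` W) \<longleftrightarrow>
      irreducible_module k right_act W \<and> has_type k D right_act W"
    (is "?L \<longleftrightarrow> ?R")
proof -
  have FW: "flip ` W \<subseteq> group_algebra k" using W flip_group_algebra by blast
  have to: "isomorphic_modules k left_act (flip ` W) right_act W" if "is_module k left_act (flip ` W)"
    using isomorphic_image[OF that linear_on_flip[OF FW] inj_on_flip[OF FW], of right_act]
      right_act_flip[of _ k] FW unfolding flip_image_flip[OF W] by blast
  have fro: "isomorphic_modules k right_act W left_act (flip ` W)" if "is_module k right_act W"
    using isomorphic_image[OF that linear_on_flip[OF W] inj_on_flip[OF W], of left_act]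
      left_act_flip[of _ k] W by blast
  show ?thesis
  proof
    assume L: ?L
    then have 1: "isomorphic_modules k left_act (flip ` W) right_act W"
      using to by (simp add: irreducible_module_def)
    then have "is_module k right_act W" unfolding isomorphic_modules_def by blast
    then show ?R using L isomorphic_irreducible[OF 1] isomorphic_has_type[OF fro] by blast
  next
    assume R: ?R
    then have 1: "isomorphic_modules k right_act W left_act (flip ` W)"
      using fro by (simp add: irreducible_module_def)
    then have "is_module k left_act (flip ` W)" unfolding isomorphic_modules_def by blast
    then show ?L using R isomorphic_irreducible[OF 1] isomorphic_has_type[OF to] by blast
  qed
qed

definition right_ideal :: "nat \<Rightarrow> (nat \<times> nat) list \<Rightarrow> ga set" where
  "right_ideal k p = {x \<in> GA k. gz p * x = x}"

lemma iota_left_ideal: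
  assumes "length p \<le> k"
  shows "iota ` left_ideal k p = right_ideal k p"
proof -
  have 1: "iota x \<in> right_ideal k p" if "x \<in> left_ideal k p" for x
    using that iota_mult[of x k "gz p" k] assms by (simp add: left_ideal_def right_ideal_def)
  have 2: "iota x \<in> left_ideal k p \<and> iota (iota x) = x" if "x \<in> right_ideal k p" for x
    using that iota_mult[of "gz p" k x k] iota_iota[of x k] assms by (simp add: left_ideal_def right_ideal_def)
  show ?thesis using 1 2 by (metis image_eqI image_subsetI subsetI subset_antisym)
qed

lemma flip_left_ideal: "length p \<le> k \<Longrightarrow> flip ` coef ` left_ideal k p = coef ` right_ideal k p"
  unfolding image_image flip_coef iota_left_ideal[symmetric] ..

lemma left_ideal_subset: "coef ` left_ideal k p \<subseteq> group_algebra k"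
  unfolding coef_image_GA[symmetric] left_ideal_def by blast

lemma right_ideal_subset: "coef ` right_ideal k p \<subseteq> group_algebra k"
  unfolding coef_image_GA[symmetric] right_ideal_def by blast

lemma right_ideal_props:
  shows "0 \<in> right_ideal k p"
    and "x \<in> right_ideal k p \<Longrightarrow> y \<in> right_ideal k p \<Longrightarrow> x + y \<in> right_ideal k p"
    and "x \<in> right_ideal k p \<Longrightarrow> cs c x \<in> right_ideal k p"
    and "x \<in> right_ideal k p \<Longrightarrow> z \<in> GA k \<Longrightarrow> x * z \<in> right_ideal k p"
  by (simp_all add: right_ideal_def distrib_left mult.assoc[symmetric])

lemma subspace_right_ideal: "fn.subspace (coef ` right_ideal k p)"
  by (rule subspace_coef) (rule right_ideal_props; assumption)+

lemma span_right_induction: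
  assumes k: "T \<in> paths k"
  shows "fn.span {w \<star> a | w a. w \<in> coef ` right_ideal k T \<and> a \<in> group_algebra (Suc k)}
      = coef ` right_ideal (Suc k) T"
proof
  have gT: "gz T \<in> right_ideal k T" using k by (simp add: right_ideal_def paths_def gz_idem)
  show "fn.span {w \<star> a | w a. w \<in> coef ` right_ideal k T \<and> a \<in> group_algebra (Suc k)}
      \<subseteq> coef ` right_ideal (Suc k) T"
  proof (rule fn.span_minimal[OF _ subspace_right_ideal], rule subsetI)
    fix f assume "f \<in> {w \<star> a | w a. w \<in> coef ` right_ideal k T \<and> a \<in> group_algebra (Suc k)}"
    then obtain a w where f: "f = w \<star> a" "a \<in> group_algebra (Suc k)" "w \<in> coef ` right_ideal k T" by blast
    obtain x where x: "a = coef x" "x \<in> GA (Suc k)" using f(2) unfolding coef_image_GA[symmetric] by blast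
    obtain y where y: "w = coef y" "y \<in> right_ideal k T" using f(3) by blast
    have "y \<in> right_ideal (Suc k) T"
      using y(2) GA_mono[of k "Suc k"] by (auto simp: right_ideal_def)
    then have "y * x \<in> right_ideal (Suc k) T" using x(2) by (rule right_ideal_props(4))
    then show "f \<in> coef ` right_ideal (Suc k) T"
      unfolding f(1) x(1) y(1) coef_simps(6)[symmetric] by blast
  qed
  show "coef ` right_ideal (Suc k) T
      \<subseteq> fn.span {w \<star> a | w a. w \<in> coef ` right_ideal k T \<and> a \<in> group_algebra (Suc k)}"
  proof (rule image_subsetI)
    fix x assume "x \<in> right_ideal (Suc k) T"
    then have x: "x \<in> GA (Suc k)" "gz T * x = x" by (auto simp: right_ideal_def)
    have "coef x = coef (gz T) \<star> coef x" unfolding coef_simps(6)[symmetric] x(2) ..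
    moreover have "coef x \<in> group_algebra (Suc k)" using x(1) unfolding coef_image_GA[symmetric] by blast
    moreover have "coef (gz T) \<in> coef ` right_ideal k T" using gT by blast
    ultimately show "coef x \<in> fn.span {w \<star> a | w a. w \<in> coef ` right_ideal k T \<and> a \<in> group_algebra (Suc k)}"
      by (intro fn.span_base) blast
  qed
qed

text \<open>Flipping reduces this to \<open>left_step_iff\<close>.\<close>

lemma right_step_iff:
  assumes p: "b # T \<in> paths (Suc k)"
  shows "W \<subseteq> coef ` right_ideal (Suc k) T \<and> irreducible_module (Suc k) right_act W \<and>
      has_type (Suc k) (set (b # T)) right_act W \<longleftrightarrow> W = coef ` right_ideal (Suc k) (b # T)"
proof -
  have len: "length T \<le> Suc k" "length (b # T) \<le> Suc k" using p by (auto simp: paths_def)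
  have fT: "flip ` coef ` left_ideal (Suc k) T = coef ` right_ideal (Suc k) T"
    and fp: "flip ` coef ` left_ideal (Suc k) (b # T) = coef ` right_ideal (Suc k) (b # T)"
    using flip_left_ideal len by blast+
  have rT: "flip ` coef ` right_ideal (Suc k) T = coef ` left_ideal (Suc k) T"
    unfolding fT[symmetric] by (rule flip_image_flip[OF left_ideal_subset])
  have rp: "flip ` coef ` right_ideal (Suc k) (b # T) = coef ` left_ideal (Suc k) (b # T)"
    unfolding fp[symmetric] by (rule flip_image_flip[OF left_ideal_subset])
  have eqp: "W = coef ` right_ideal (Suc k) (b # T) \<longleftrightarrow> flip ` W = coef ` left_ideal (Suc k) (b # T)"
    if "W \<subseteq> group_algebra (Suc k)"
  proof
    assume "flip ` W = coef ` left_ideal (Suc k) (b # T)"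
    then have "flip ` flip ` W = flip ` coef ` left_ideal (Suc k) (b # T)" by (rule arg_cong)
    then show "W = coef ` right_ideal (Suc k) (b # T)" unfolding flip_image_flip[OF that] fp .
  qed (simp only: rp)
  show ?thesis
  proof (cases "W \<subseteq> group_algebra (Suc k)")
    case True
    have sub: "W \<subseteq> coef ` right_ideal (Suc k) T \<longleftrightarrow> flip ` W \<subseteq> coef ` left_ideal (Suc k) T"
    proof
      assume "W \<subseteq> coef ` right_ideal (Suc k) T"
      from image_mono[OF this, of flip] show "flip ` W \<subseteq> coef ` left_ideal (Suc k) T" unfolding rT .
    next
      assume "flip ` W \<subseteq> coef ` left_ideal (Suc k) T"
      from image_mono[OF this, of flip] show "W \<subseteq> coef ` right_ideal (Suc k) T"
        unfolding fT flip_image_flip[OF True] .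
    qed
    show ?thesis
      by (simp only: sub irreducible_has_type_flip[OF True, symmetric] left_step_iff[OF p] eqp[OF True])
  next
    case False
    then have "\<not> W \<subseteq> coef ` right_ideal (Suc k) T" "W \<noteq> coef ` right_ideal (Suc k) (b # T)"
      using right_ideal_subset by blast+
    then show ?thesis by simp
  qed
qed

lemma right_induced_eq:
  assumes T: "standard n T" and k: "1 \<le> k" "k \<le> n"
  shows "right_induced T k = coef ` right_ideal k (path_of T k)"
  using k
proof (induction k rule: nat_induct_at_least)
  case base
  have p: "path_of T (Suc 0) \<in> paths (Suc 0)"
    by (rule path_of_in_paths[OF T]) (use base in simp)
  then obtain b where b: "path_of T (Suc 0) = [b]" "b \<in> addable {}" by (auto simp: paths_def)
  have "gz (path_of T (Suc 0)) = 1" unfolding b(1) using b(2) by (simp add: addable_empty lag_def)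
  then have "right_ideal (Suc 0) (path_of T (Suc 0)) = GA (Suc 0)" by (simp add: right_ideal_def del: path_of.simps)
  then show ?case unfolding One_nat_def right_induced.simps coef_image_GA[symmetric] by (simp only:)
next
  case (Suc k)
  then obtain m where m: "k = Suc m" by (cases k) auto
  have IH: "right_induced T (Suc m) = coef ` right_ideal k (path_of T k)" using Suc m by simp
  define b where "b = box_of T (Suc k)"
  have p: "b # path_of T k \<in> paths (Suc k)" "path_of T k \<in> paths k"
    using path_of_in_paths[OF T Suc.prems] path_of_in_paths[OF T, of k] Suc.prems by (simp_all add: b_def)
  have D: "shape (subtableau T (Suc k)) = set (b # path_of T k)"
    using shape_subtableau[OF T Suc.prems] by (simp add: b_def)
  have "right_induced T (Suc k) = (THE W. W = coef ` right_ideal (Suc k) (b # path_of T k))"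
    unfolding m right_induced.simps Let_def IH
    unfolding m[symmetric] span_right_induction[OF p(2)] D right_step_iff[OF p(1)] ..
  then show ?case by (simp add: b_def)
qed


section \<open>The two weight bases\<close>

lemma right_weight_vector_iff:
  assumes T': "standard n T'" and T: "standard n T" and n: "n \<ge> 1" and x: "x \<in> GA n"
  shows "right_weight_vector n T' T (coef x) \<longleftrightarrow>
    x \<noteq> 0 \<and> gz (path_of T' n) * x = x \<and> x * gz (path_of T n) = x"
proof -
  let ?p = "path_of T n"
  have ip: "is_path ?p" "length ?p = n" using path_of_in_paths[OF T, of n] by (simp_all add: paths_def)
  have 1: "coef x \<in> right_induced T' n \<longleftrightarrow> gz (path_of T' n) * x = x"
  proof -
    have "inj coef" by (rule injI) (simp only: coef_inject)
    then show ?thesis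
      unfolding right_induced_eq[OF T' n order_refl] inj_image_mem_iff[OF \<open>inj coef\<close>]
      using x by (simp add: right_ideal_def)
  qed
  have eq: "coef x \<star> jucys_murphy i = fscale (cont T i) (coef x) \<longleftrightarrow> x * JM i = cs (cont T i) x" for i
    unfolding coef_JM[symmetric] coef_simps(6,7)[symmetric] coef_inject ..
  have 2: "(\<forall>i\<in>{1..n}. coef x \<star> jucys_murphy i = fscale (cont T i) (coef x)) \<longleftrightarrow>
      (\<forall>i\<in>{1..n}. x * JM i = cs (wt ?p i) x)"
  proof (rule ball_cong[OF refl])
    fix i assume "i \<in> {1..n}"
    then show "coef x \<star> jucys_murphy i = fscale (cont T i) (coef x) \<longleftrightarrow> x * JM i = cs (wt ?p i) x"
      unfolding eq by (simp only: cont_eq_wt)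
  qed
  have 3: "(\<forall>i\<in>{1..n}. x * JM i = cs (wt ?p i) x) \<longleftrightarrow> x * gz ?p = x"
  proof
    assume "\<forall>i\<in>{1..n}. x * JM i = cs (wt ?p i) x"
    then show "x * gz ?p = x" using ip by (intro gz_fixes_weight_right[OF ip(1) x]) simp_all
  next
    assume e: "x * gz ?p = x"
    have "x * gz ?p * JM i = cs (wt ?p i) (x * gz ?p)" if "i \<in> {1..n}" for i
      using gz_JM[OF ip(1), of i] that ip(2) by (simp add: mult.assoc)
    then show "\<forall>i\<in>{1..n}. x * JM i = cs (wt ?p i) x" by (simp only: e) blast
  qed
  have "coef x \<noteq> 0 \<longleftrightarrow> x \<noteq> 0" using coef_simps(4) coef_inject by metis
  then show ?thesis unfolding right_weight_vector_def 1 2 3 by blast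
qed

lemma left_weight_vectorD:
  assumes T: "standard n T" and T': "standard n T'" and n: "n \<ge> 1" and v: "left_weight_vector n T T' v"
  obtains x where "v = coef x" "x \<in> GA n" "x \<noteq> 0" "gz (path_of T' n) * x = x" "x * gz (path_of T n) = x"
proof -
  have ip: "is_path (path_of T' n)" "length (path_of T' n) = n"
    using path_of_in_paths[OF T', of n] by (simp_all add: paths_def)
  have "v \<in> coef ` left_ideal n (path_of T n)"
    using v left_induced_eq[OF T n order_refl] unfolding left_weight_vector_def by blast
  then obtain x where x: "v = coef x" "x \<in> GA n" "x * gz (path_of T n) = x"
    unfolding left_ideal_def by blast
  have "x \<noteq> 0" using v x(1) coef_simps(4) unfolding left_weight_vector_def by metis
  have "coef (JM i * x) = coef (cs (cont T' i) x)" if "i \<in> {1..n}" for i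
    using v that unfolding x(1) left_weight_vector_def coef_simps(6,7) coef_JM by blast
  then have "JM i * x = cs (wt (path_of T' n) i) x" if "i \<in> {1..n}" for i
    using cont_eq_wt[OF that] that unfolding coef_inject by simp
  then have "gz (path_of T' n) * x = x"
    using ip by (intro gz_fixes_weight[OF ip(1)]) simp
  then show ?thesis using that x \<open>x \<noteq> 0\<close> by blast
qed

text \<open>Any nonzero vector of the block can serve as its generator, in particular the given weight
  vectors.\<close>

lemma block_line:
  assumes p: "p \<in> paths n" "p' \<in> paths n" "set p' = set p"
    and y: "y \<in> GA n" "y \<noteq> 0" "gz p' * y = y" "y * gz p = y" and x: "x \<in> GA n"
  shows "\<exists>\<gamma>. gz p' * x * gz p = cs \<gamma> y"
proof -
  obtain u where u: "\<And>x. x \<in> GA n \<Longrightarrow> \<exists>\<gamma>. gz p' * x * gz p = cs \<gamma> u"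
    by (rule gz_block_one_dim[OF p]) blast
  obtain \<gamma>0 where "gz p' * y * gz p = cs \<gamma>0 u" using u[OF y(1)] by blast
  then have g0: "y = cs \<gamma>0 u" by (simp only: y)
  then have "\<gamma>0 \<noteq> 0" using y(2) by auto
  then have "u = cs (1 / \<gamma>0) y" using g0 by simp
  moreover obtain \<gamma> where "gz p' * x * gz p = cs \<gamma> u" using u[OF x] by blast
  ultimately have "gz p' * x * gz p = cs (\<gamma> * (1 / \<gamma>0)) y" by simp
  then show ?thesis by blast
qed

theorem theorem2p1:
  fixes n :: nat
    and v :: "tableau \<Rightarrow> tableau \<Rightarrow> galg"
  assumes "n \<ge> 1"
    and "\<And>T' T. (T', T) \<in> tableau_pairs n \<Longrightarrow> left_weight_vector n T T' (v T' T)"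
  shows "(\<forall>T. standard n T \<longrightarrow>
            fn.span {v T T' | T'. T' \<in> std_tableaux n (shape T)} = right_induced T n) \<and>
         indexed_basis n v \<and>
         (\<forall>(T', T)\<in>tableau_pairs n.
            {w. right_weight_vector n T' T w} = {fscale c (v T' T) | c. c \<noteq> 0})"
proof -
  define q where "q = (\<lambda>T. path_of T n)"
  let ?P = "tableau_pairs n"
  have q: "q T \<in> paths n" "set (q T) = shape T" if "standard n T" for T
    using path_of_in_paths[OF that order_refl] set_path_of_full[OF that] by (simp_all add: q_def)
  have P: "standard n T'" "standard n T" "shape T' = shape T" if "(T', T) \<in> ?P" for T' T
    using that by (simp_all add: tableau_pairs_def)
  have "\<forall>z\<in>?P. \<exists>x. v (fst z) (snd z) = coef x \<and> x \<in> GA n \<and> x \<noteq> 0 \<and>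
      gz (q (fst z)) * x = x \<and> x * gz (q (snd z)) = x"
  proof
    fix z assume z: "z \<in> ?P"
    then have z': "(fst z, snd z) \<in> ?P" by simp
    show "\<exists>x. v (fst z) (snd z) = coef x \<and> x \<in> GA n \<and> x \<noteq> 0 \<and>
        gz (q (fst z)) * x = x \<and> x * gz (q (snd z)) = x"
      using left_weight_vectorD[OF P(2,1)[OF z'] assms(1) assms(2)[OF z']] unfolding q_def by metis
  qed
  from bchoice[OF this] obtain y0 where y0: "\<forall>z\<in>?P. v (fst z) (snd z) = coef (y0 z) \<and> y0 z \<in> GA n \<and> y0 z \<noteq> 0 \<and>
      gz (q (fst z)) * y0 z = y0 z \<and> y0 z * gz (q (snd z)) = y0 z" by blast
  define y where "y = (\<lambda>T' T. y0 (T', T))"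
  have y: "v T' T = coef (y T' T)" "y T' T \<in> GA n" "y T' T \<noteq> 0"
    "gz (q T') * y T' T = y T' T" "y T' T * gz (q T) = y T' T" if "(T', T) \<in> ?P" for T' T
    using bspec[OF y0 that] unfolding y_def by simp_all
  have line: "\<exists>\<gamma>. gz (q T') * x * gz (q T) = cs \<gamma> (y T' T)" if "(T', T) \<in> ?P" "x \<in> GA n" for T' T x
    by (rule block_line[OF q(1)[OF P(2)[OF that(1)]] q(1)[OF P(1)[OF that(1)]] _ y(2-5)[OF that(1)] that(2)])
      (simp add: q(2) P[OF that(1)])
  have orth: "gz (q T) * gz (q T') = 0" if "standard n T" "standard n T'" "T \<noteq> T'" for T T'
    using q(1)[OF that(1)] q(1)[OF that(2)] path_of_inj[OF that(1,2)] that(3)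
    by (intro gz_orthogonal) (auto simp: paths_def q_def)
  have proj: "gz (q T') * y S' S * gz (q T) = (if (S', S) = (T', T) then y T' T else 0)"
    if "(T', T) \<in> ?P" "(S', S) \<in> ?P" for T' T S' S
  proof (cases "S' = T' \<and> S = T")
    case True
    then show ?thesis using y(4,5)[OF that(1)] by simp
  next
    case False
    have "gz (q T') * y S' S * gz (q T) = gz (q T') * (gz (q S') * y S' S * gz (q S)) * gz (q T)"
      by (simp only: y(4,5)[OF that(2)])
    also have "\<dots> = (gz (q T') * gz (q S')) * y S' S * (gz (q S) * gz (q T))"
      by (simp only: mult.assoc)
    also have "\<dots> = 0"
      using False orth[of T' S'] orth[of S T] P[OF that(1)] P[OF that(2)] by (cases "S' = T'") auto
    finally have "gz (q T') * y S' S * gz (q T) = 0" .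
    moreover have "(S', S) \<noteq> (T', T)" using False by blast
    ultimately show ?thesis by (simp only: if_False)
  qed
  have zero: "gz (q T') * x * gz (q T) = 0"
    if "standard n T'" "standard n T" "shape T' \<noteq> shape T" "x \<in> GA n" for T' T x
    using gz_block_zero[OF q(1)[OF that(2)] q(1)[OF that(1)] _ that(4)] q(2)[OF that(1)] q(2)[OF that(2)] that(3)
    by simp
  have in_span: "coef (gz p' * x * gz p) \<in> fn.span B"
    if p: "p' \<in> paths n" "p \<in> paths n" and x: "x \<in> GA n"
      and B: "(tab p', tab p) \<in> ?P \<Longrightarrow> v (tab p') (tab p) \<in> B" for p' p x B
  proof -
    have st: "standard n (tab p')" "standard n (tab p)" "q (tab p') = p'" "q (tab p) = p"
      using standard_tab p path_of_tab by (simp_all add: q_def)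
    show ?thesis
    proof (cases "shape (tab p') = shape (tab p)")
      case True
      then have pr: "(tab p', tab p) \<in> ?P" using st by (simp add: tableau_pairs_def)
      obtain \<gamma> where "gz p' * x * gz p = cs \<gamma> (y (tab p') (tab p))"
        using line[OF pr x] st(3,4) by auto
      then have "coef (gz p' * x * gz p) = fscale \<gamma> (v (tab p') (tab p))"
        by (simp only: coef_simps y(1)[OF pr])
      then show ?thesis using fn.span_scale[OF fn.span_base[OF B[OF pr]], of \<gamma>] by simp
    next
      case False
      have "gz p' * x * gz p = 0" using zero[OF st(1,2) False x] st(3,4) by simp
      then have "coef (gz p' * x * gz p) = 0" by (simp only: coef_simps)
      then show ?thesis using fn.span_zero by simp
    qed
  qed
  have part1: "fn.span {v T T' | T'. T' \<in> std_tableaux n (shape T)} = right_induced T n" if T: "standard n T" for T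
    unfolding right_induced_eq[OF T assms(1) order_refl]
  proof
    have pr: "(T, T') \<in> ?P" if "T' \<in> std_tableaux n (shape T)" for T'
      using that T by (simp add: tableau_pairs_def std_tableaux_def)
    show "fn.span {v T T' | T'. T' \<in> std_tableaux n (shape T)} \<subseteq> coef ` right_ideal n (path_of T n)"
    proof (rule fn.span_minimal[OF _ subspace_right_ideal], rule subsetI)
      fix f assume "f \<in> {v T T' | T'. T' \<in> std_tableaux n (shape T)}"
      then obtain T' where T': "f = v T T'" "T' \<in> std_tableaux n (shape T)" by blast
      have "y T T' \<in> right_ideal n (path_of T n)"
        using y(2,4)[OF pr[OF T'(2)]] by (simp add: right_ideal_def q_def)
      then show "f \<in> coef ` right_ideal n (path_of T n)" unfolding T'(1) y(1)[OF pr[OF T'(2)]] by blast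
    qed
    show "coef ` right_ideal n (path_of T n) \<subseteq> fn.span {v T T' | T'. T' \<in> std_tableaux n (shape T)}"
    proof (rule image_subsetI)
      fix x assume "x \<in> right_ideal n (path_of T n)"
      then have x: "x \<in> GA n" "gz (q T) * x = x" by (simp_all add: right_ideal_def q_def)
      have tq: "tab (q T) = T"
        using path_of_inj[OF standard_tab[OF q(1)[OF T]] T] path_of_tab[OF q(1)[OF T]] by (simp add: q_def)
      have "x = (\<Sum>S\<in>paths n. gz (q T) * x * gz S)"
        using expand_paths(2)[of x n] by (simp only: x(2))
      then have "coef x = coef (\<Sum>S\<in>paths n. gz (q T) * x * gz S)" by (rule arg_cong)
      also have "\<dots> = (\<Sum>S\<in>paths n. coef (gz (q T) * x * gz S))" by (rule coef_sum)
      also have "\<dots> \<in> fn.span {v T T' | T'. T' \<in> std_tableaux n (shape T)}"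
      proof (rule fn.span_sum, rule in_span[OF q(1)[OF T] _ x(1)])
        fix S assume S: "S \<in> paths n" and "(tab (q T), tab S) \<in> ?P"
        then have "tab S \<in> std_tableaux n (shape T)"
          unfolding tq by (simp add: tableau_pairs_def std_tableaux_def)
        then show "v (tab (q T)) (tab S) \<in> {v T T' | T'. T' \<in> std_tableaux n (shape T)}"
          unfolding tq by blast
      qed
      finally show "coef x \<in> fn.span {v T T' | T'. T' \<in> std_tableaux n (shape T)}" .
    qed
  qed
  have v_inj: "(S', S) = (T', T)" if "(T', T) \<in> ?P" "(S', S) \<in> ?P" "v S' S = v T' T" for T' T S' S
  proof (rule ccontr)
    assume ne: "(S', S) \<noteq> (T', T)"
    have "y S' S = y T' T" using that(3) unfolding y(1)[OF that(1)] y(1)[OF that(2)] coef_inject .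
    moreover have "gz (q T') * y S' S * gz (q T) = 0"
      unfolding proj[OF that(1,2)] using ne by (simp only: if_False)
    moreover have "gz (q T') * y T' T * gz (q T) = y T' T"
      unfolding proj[OF that(1,1)] by simp
    ultimately have "y T' T = 0" by simp
    then show False using y(3)[OF that(1)] by simp
  qed
  have part2: "indexed_basis n v"
    unfolding indexed_basis_def
  proof (intro conjI)
    let ?B = "(\<lambda>(T', T). v T' T) ` ?P"
    show "inj_on (\<lambda>(T', T). v T' T) ?P"
    proof (rule inj_onI)
      fix z z' assume "z \<in> ?P" "z' \<in> ?P" "(case z of (T', T) \<Rightarrow> v T' T) = (case z' of (T', T) \<Rightarrow> v T' T)"
      then show "z = z'" using v_inj[of "fst z'" "snd z'" "fst z" "snd z"] by (simp add: case_prod_beta)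
    qed
    show "fn.independent ?B"
    proof
      assume "fn.dependent ?B"
      then obtain t u a where t: "finite t" "t \<subseteq> ?B" "(\<Sum>b\<in>t. fscale (u b) b) = 0" "a \<in> t" "u a \<noteq> 0"
        unfolding fn.dependent_explicit by blast
      have member: "\<exists>T' T. b = v T' T \<and> (T', T) \<in> ?P" if bt: "b \<in> t" for b
      proof -
        obtain z where z: "b = (case z of (T', T) \<Rightarrow> v T' T)" "z \<in> ?P"
          using subsetD[OF t(2) bt] by (rule imageE)
        then show ?thesis by (intro exI[of _ "fst z"] exI[of _ "snd z"]) (simp add: case_prod_beta)
      qed
      obtain T' T where a: "a = v T' T" "(T', T) \<in> ?P" using member[OF t(4)] by blast
      have pr: "gz (q T') * Abs_ga b * gz (q T) = (if b = a then y T' T else 0)" if bt: "b \<in> t" for b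
      proof -
        obtain S' S where b: "b = v S' S" "(S', S) \<in> ?P" using member[OF bt] by blast
        have "Abs_ga b = y S' S" unfolding b(1) y(1)[OF b(2)] by (rule coef_inverse)
        moreover have "b = a \<longleftrightarrow> (S', S) = (T', T)"
          unfolding a(1) b(1) using v_inj[OF a(2) b(2)] by blast
        ultimately show ?thesis using proj[OF a(2) b(2)] by (simp only:)
      qed
      have cb: "coef (Abs_ga b) = b" if bt: "b \<in> t" for b
      proof -
        obtain S' S where b: "b = v S' S" "(S', S) \<in> ?P" using member[OF bt] by blast
        show ?thesis unfolding b(1) y(1)[OF b(2)] coef_inverse ..
      qed
      have "coef (\<Sum>b\<in>t. cs (u b) (Abs_ga b)) = (\<Sum>b\<in>t. fscale (u b) b)"
        unfolding coef_sum coef_simps(7) by (intro sum.cong refl) (simp only: cb)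
      then have "coef (\<Sum>b\<in>t. cs (u b) (Abs_ga b)) = coef 0"
        using t(3) by (simp only: coef_simps)
      then have "(\<Sum>b\<in>t. cs (u b) (Abs_ga b)) = 0" unfolding coef_inject .
      then have "0 = gz (q T') * (\<Sum>b\<in>t. cs (u b) (Abs_ga b)) * gz (q T)" by simp
      also have "\<dots> = (\<Sum>b\<in>t. cs (u b) (gz (q T') * Abs_ga b * gz (q T)))"
        by (simp add: sum_distrib_left sum_distrib_right)
      also have "\<dots> = (\<Sum>b\<in>t. if b = a then cs (u a) (y T' T) else 0)"
        by (intro sum.cong refl) (simp add: pr)
      also have "\<dots> = cs (u a) (y T' T)" using t(1,4) by simp
      finally show False using t(5) y(3)[OF a(2)] by simp
    qed
    show "fn.span ?B = group_algebra n"
    proof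
      have "fn.subspace (group_algebra n)"
        unfolding coef_image_GA[symmetric] by (rule subspace_coef) simp_all
      moreover have "?B \<subseteq> group_algebra n"
      proof (rule image_subsetI)
        fix z assume z: "z \<in> ?P"
        obtain T' T where zz: "z = (T', T)" by force
        have pr: "(T', T) \<in> ?P" using z zz by simp
        have "coef (y T' T) \<in> coef ` GA n" using y(2)[OF pr] by blast
        then show "(case z of (T', T) \<Rightarrow> v T' T) \<in> group_algebra n"
          unfolding zz prod.case y(1)[OF pr] coef_image_GA .
      qed
      ultimately show "fn.span ?B \<subseteq> group_algebra n" by (intro fn.span_minimal)
      show "group_algebra n \<subseteq> fn.span ?B"
        unfolding coef_image_GA[symmetric]
      proof (rule image_subsetI)
        fix x assume x: "x \<in> GA n"
        have "x = (\<Sum>S'\<in>paths n. gz S' * x)" by (rule expand_paths)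
        also have "\<dots> = (\<Sum>S'\<in>paths n. \<Sum>S\<in>paths n. gz S' * x * gz S)"
          by (intro sum.cong refl expand_paths(2))
        finally have "coef x = coef (\<Sum>S'\<in>paths n. \<Sum>S\<in>paths n. gz S' * x * gz S)" by (rule arg_cong)
        also have "\<dots> = (\<Sum>S'\<in>paths n. \<Sum>S\<in>paths n. coef (gz S' * x * gz S))"
          by (simp only: coef_sum)
        also have "\<dots> \<in> fn.span ?B"
        proof (intro fn.span_sum)
          fix S' S assume S: "S' \<in> paths n" "S \<in> paths n"
          show "coef (gz S' * x * gz S) \<in> fn.span ?B"
          proof (rule in_span[OF S x])
            assume "(tab S', tab S) \<in> ?P"
            then show "v (tab S') (tab S) \<in> ?B" by (intro image_eqI[of _ _ "(tab S', tab S)"]) simp_all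
          qed
        qed
        finally show "coef x \<in> fn.span ?B" .
      qed
    qed
  qed
  have part3: "{w. right_weight_vector n T' T w} = {fscale c (v T' T) | c. c \<noteq> 0}" if pr: "(T', T) \<in> ?P" for T' T
  proof
    note iff = right_weight_vector_iff[OF P(1,2)[OF pr] assms(1)]
    show "{w. right_weight_vector n T' T w} \<subseteq> {fscale c (v T' T) | c. c \<noteq> 0}"
    proof
      fix w assume "w \<in> {w. right_weight_vector n T' T w}"
      then have w: "right_weight_vector n T' T w" by simp
      then have "w \<in> coef ` right_ideal n (path_of T' n)"
        using right_induced_eq[OF P(1)[OF pr] assms(1) order_refl] unfolding right_weight_vector_def by blast
      then obtain x where x: "w = coef x" "x \<in> GA n" unfolding right_ideal_def by blast
      then have xw: "x \<noteq> 0" "gz (q T') * x = x" "x * gz (q T) = x"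
        using w iff[OF x(2)] unfolding x(1) q_def by blast+
      obtain \<gamma> where "gz (q T') * x * gz (q T) = cs \<gamma> (y T' T)" using line[OF pr x(2)] by blast
      then have g: "x = cs \<gamma> (y T' T)" by (simp only: xw)
      then have "\<gamma> \<noteq> 0" using xw(1) by auto
      moreover have "w = fscale \<gamma> (v T' T)" unfolding x(1) y(1)[OF pr] coef_simps(7)[symmetric] g[symmetric] ..
      ultimately show "w \<in> {fscale c (v T' T) | c. c \<noteq> 0}" by blast
    qed
    show "{fscale c (v T' T) | c. c \<noteq> 0} \<subseteq> {w. right_weight_vector n T' T w}"
    proof
      fix w assume "w \<in> {fscale c (v T' T) | c. c \<noteq> 0}"
      then obtain c where c: "w = fscale c (v T' T)" "c \<noteq> 0" by blast
      have w: "w = coef (cs c (y T' T))" unfolding c(1) y(1)[OF pr] coef_simps(7) ..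
      have "cs c (y T' T) \<noteq> 0" using c(2) y(3)[OF pr] by simp
      then have "right_weight_vector n T' T (coef (cs c (y T' T)))"
        using iff[of "cs c (y T' T)"] y(2,4,5)[OF pr] by (simp add: q_def)
      then show "w \<in> {w. right_weight_vector n T' T w}" unfolding w by simp
    qed
  qed
  show ?thesis using part1 part2 part3 by blast
qed

end
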